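(* Let $H$ be a Hopf algebra over a field $k$ and let $M$ be a modular crossed module over $H$. For $n\ge0$ put $Z_n(H,M)=H^{\otimes(n+1)}\otimes_HM$ and, for $0\le i\le n$, $$\delta_i((h^0,\ldots,h^n)\otimes_Hm)=\varepsilon(h^i)(h^0,\ldots,\widehat{h^i},\ldots,h^n)\otimes_Hm\quad(n\ge1),$$ $$\sigma_i((h^0,\ldots,h^n)\otimes_Hm)=(h^0,\ldots,\Delta(h^i),\ldots,h^n)\otimes_Hm,$$ $$\tau_n((h^0,\ldots,h^n)\otimes_Hm)=\sum(h^nm_{\langle1\rangle},h^0,\ldots,h^{n-1})\otimes_Hm_{\langle0\rangle}.$$ Then $(Z_*(H,M),\delta_*,\sigma_*,\tau_* )$, with face maps $\delta_i$, degeneracy maps $\sigma_i$ and cyclic operators $\tau_n$, is a cyclic object.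
   Context: $\otimes=\otimes_k$; $H$ has comultiplication $\Delta(h)=\sum h_{(1)}\otimes h_{(2)}$, counit $\varepsilon$, antipode $S$. Elements $h^0\otimes\cdots\otimes h^n$ of $H^{\otimes(n+1)}$ are written $(h^0,\ldots,h^n)$, and $H^{\otimes(n+1)}$ is a right $H$-module by the diagonal action $(h^0,\ldots,h^n)h=\sum(h^0h_{(1)},\ldots,h^nh_{(n+1)})$. $\Delta(h^i)$ in $\sigma_i$ occupies two consecutive tensor positions. A crossed module over $H$ is a left $H$-module $M$ which is also a right $H$-comodule via $\rho:M\to M\otimes H$, $\rho(m)=\sum m_{\langle0\rangle}\otimes m_{\langle1\rangle}$, such that $\rho(hm)=\sum h_{(2)}m_{\langle0\rangle}\otimes h_{(3)}m_{\langle1\rangle}S(h_{(1)})$ for all $h\in H$, $m\in M$. It is modular if $\sum m_{\langle1\rangle}m_{\langle0\rangle}=m$ for all $m\in M$. A cyclic object is a simplicial object with operators $\tau_n$ satisfying $\delta_i\tau_n=\tau_{n-1}\delta_{i-1}$ and $\sigma_i\tau_n=\tau_{n+1}\sigma_{i-1}$ for $0<i\le n$, $\delta_0\tau_n=\delta_n$, $\sigma_0\tau_n=\tau_{n+1}^2\sigma_n$, and $\tau_n^{n+1}=\mathrm{Id}$. *)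

theory Defs
  imports "HOL-Algebra.Module" "HOL-Algebra.AbelCoset"
begin

section \<open>Modules given by generators and relations\<close>

definition linear_maps ::
  "'k ring \<Rightarrow> ('k, 'v) module \<Rightarrow> ('k, 'w) module \<Rightarrow> ('v \<Rightarrow> 'w) set" where
  "linear_maps K V W = {f \<in> carrier V \<rightarrow> carrier W.
     (\<forall>x\<in>carrier V. \<forall>y\<in>carrier V. f (x \<oplus>\<^bsub>V\<^esub> y) = f x \<oplus>\<^bsub>W\<^esub> f y) \<and>
     (\<forall>c\<in>carrier K. \<forall>x\<in>carrier V. f (c \<odot>\<^bsub>V\<^esub> x) = c \<odot>\<^bsub>W\<^esub> f x)}"

text \<open>The multiplicative fields of the module records below carry no meaning.\<close>

definition free_module :: "'k ring \<Rightarrow> 'x set \<Rightarrow> ('k, 'x \<Rightarrow> 'k) module" where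
  "free_module K X =
     \<lparr>carrier = {f. range f \<subseteq> carrier K \<and> finite {x. f x \<noteq> \<zero>\<^bsub>K\<^esub>} \<and> {x. f x \<noteq> \<zero>\<^bsub>K\<^esub>} \<subseteq> X},
      mult = undefined, one = undefined,
      zero = (\<lambda>x. \<zero>\<^bsub>K\<^esub>),
      add = (\<lambda>f g x. f x \<oplus>\<^bsub>K\<^esub> g x),
      smult = (\<lambda>c f x. c \<otimes>\<^bsub>K\<^esub> f x)\<rparr>"

definition basis_vec :: "'k ring \<Rightarrow> 'x \<Rightarrow> 'x \<Rightarrow> 'k" where
  "basis_vec K x = (\<lambda>y. if y = x then \<one>\<^bsub>K\<^esub> else \<zero>\<^bsub>K\<^esub>)"

definition generated_submodule :: "'k ring \<Rightarrow> ('k, 'v) module \<Rightarrow> 'v set \<Rightarrow> 'v set" where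
  "generated_submodule K V R = \<Inter>{N. submodule N K V \<and> R \<subseteq> N}"

definition quotient_module :: "('k, 'v) module \<Rightarrow> 'v set \<Rightarrow> ('k, 'v set) module" where
  "quotient_module V N =
     \<lparr>carrier = a_rcosets\<^bsub>V\<^esub> N,
      mult = undefined, one = undefined,
      zero = N,
      add = (<+>\<^bsub>V\<^esub>),
      smult = (\<lambda>c A. \<Union>x\<in>A. N +>\<^bsub>V\<^esub> (c \<odot>\<^bsub>V\<^esub> x))\<rparr>"

definition presented_module ::
  "'k ring \<Rightarrow> 'x set \<Rightarrow> ('x \<Rightarrow> 'k) set \<Rightarrow> ('k, ('x \<Rightarrow> 'k) set) module" where
  "presented_module K X R =
     quotient_module (free_module K X) (generated_submodule K (free_module K X) R)"

definition presented_gen ::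
  "'k ring \<Rightarrow> 'x set \<Rightarrow> ('x \<Rightarrow> 'k) set \<Rightarrow> 'x \<Rightarrow> ('x \<Rightarrow> 'k) set" where
  "presented_gen K X R x =
     generated_submodule K (free_module K X) R +>\<^bsub>free_module K X\<^esub> basis_vec K x"

text \<open>
  The linear map out of a presented module into \<open>W\<close> that sends the generator \<open>x\<close> to \<open>F x\<close>: it takes
  the common value on all representatives \<open>r\<close> of \<open>t\<close> of the linear extension of \<open>F\<close>, and is only
  meaningful if \<open>F\<close> respects the relations.  For \<open>t\<close> in a tensor product, \<open>tlift K W F t\<close> is the
  Sweedler sum of \<open>F\<close> over any expression of \<open>t\<close> by pure tensors; \<open>F\<close> is multilinear in
  all uses below.
\<close>

definition tlift ::
  "'k ring \<Rightarrow> ('k, 'w) module \<Rightarrow> ('x \<Rightarrow> 'w) \<Rightarrow> ('x \<Rightarrow> 'k) set \<Rightarrow> 'w" where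
  "tlift K W F t =
     the_elem ((\<lambda>r. \<Oplus>\<^bsub>W\<^esub>x\<in>{x. r x \<noteq> \<zero>\<^bsub>K\<^esub>}. r x \<odot>\<^bsub>W\<^esub> F x) ` t)"


section \<open>Tensor products\<close>

definition bilinear_rels ::
  "'k ring \<Rightarrow> ('k, 'v) module \<Rightarrow> ('k, 'w) module \<Rightarrow> ('v \<times> 'w \<Rightarrow> 'k) set" where
  "bilinear_rels K V W = (let F = free_module K (carrier V \<times> carrier W); e = basis_vec K in
     {e (v \<oplus>\<^bsub>V\<^esub> v', w) \<ominus>\<^bsub>F\<^esub> (e (v, w) \<oplus>\<^bsub>F\<^esub> e (v', w)) | v v' w.
        v \<in> carrier V \<and> v' \<in> carrier V \<and> w \<in> carrier W} \<union>
     {e (v, w \<oplus>\<^bsub>W\<^esub> w') \<ominus>\<^bsub>F\<^esub> (e (v, w) \<oplus>\<^bsub>F\<^esub> e (v, w')) | v w w'.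
        v \<in> carrier V \<and> w \<in> carrier W \<and> w' \<in> carrier W} \<union>
     {e (c \<odot>\<^bsub>V\<^esub> v, w) \<ominus>\<^bsub>F\<^esub> c \<odot>\<^bsub>F\<^esub> e (v, w) | c v w.
        c \<in> carrier K \<and> v \<in> carrier V \<and> w \<in> carrier W} \<union>
     {e (v, c \<odot>\<^bsub>W\<^esub> w) \<ominus>\<^bsub>F\<^esub> c \<odot>\<^bsub>F\<^esub> e (v, w) | c v w.
        c \<in> carrier K \<and> v \<in> carrier V \<and> w \<in> carrier W})"

definition tensor ::
  "'k ring \<Rightarrow> ('k, 'v) module \<Rightarrow> ('k, 'w) module \<Rightarrow> ('k, ('v \<times> 'w \<Rightarrow> 'k) set) module" where
  "tensor K V W = presented_module K (carrier V \<times> carrier W) (bilinear_rels K V W)"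

definition tens ::
  "'k ring \<Rightarrow> ('k, 'v) module \<Rightarrow> ('k, 'w) module \<Rightarrow> 'v \<Rightarrow> 'w \<Rightarrow> ('v \<times> 'w \<Rightarrow> 'k) set" where
  "tens K V W v w = presented_gen K (carrier V \<times> carrier W) (bilinear_rels K V W) (v, w)"

text \<open>
  \<open>tensor_over K H X ract M act\<close> is the tensor product over the \<open>K\<close>-algebra \<open>H\<close> of the right
  module \<open>X\<close> (with action \<open>ract x h\<close>) and the left module \<open>M\<close> (with action \<open>act h m\<close>).
\<close>

definition balanced_rels ::
  "'k ring \<Rightarrow> ('k, 'h) module \<Rightarrow> ('k, 'x) module \<Rightarrow> ('x \<Rightarrow> 'h \<Rightarrow> 'x) \<Rightarrow>
   ('k, 'm) module \<Rightarrow> ('h \<Rightarrow> 'm \<Rightarrow> 'm) \<Rightarrow> ('x \<times> 'm \<Rightarrow> 'k) set" where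
  "balanced_rels K H X ract M act = bilinear_rels K X M \<union>
     {basis_vec K (ract x h, m) \<ominus>\<^bsub>free_module K (carrier X \<times> carrier M)\<^esub> basis_vec K (x, act h m) | x h m.
        x \<in> carrier X \<and> h \<in> carrier H \<and> m \<in> carrier M}"

definition tensor_over ::
  "'k ring \<Rightarrow> ('k, 'h) module \<Rightarrow> ('k, 'x) module \<Rightarrow> ('x \<Rightarrow> 'h \<Rightarrow> 'x) \<Rightarrow>
   ('k, 'm) module \<Rightarrow> ('h \<Rightarrow> 'm \<Rightarrow> 'm) \<Rightarrow> ('k, ('x \<times> 'm \<Rightarrow> 'k) set) module" where
  "tensor_over K H X ract M act =
     presented_module K (carrier X \<times> carrier M) (balanced_rels K H X ract M act)"

definition tens_over ::
  "'k ring \<Rightarrow> ('k, 'h) module \<Rightarrow> ('k, 'x) module \<Rightarrow> ('x \<Rightarrow> 'h \<Rightarrow> 'x) \<Rightarrow>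
   ('k, 'm) module \<Rightarrow> ('h \<Rightarrow> 'm \<Rightarrow> 'm) \<Rightarrow> 'x \<Rightarrow> 'm \<Rightarrow> ('x \<times> 'm \<Rightarrow> 'k) set" where
  "tens_over K H X ract M act x m =
     presented_gen K (carrier X \<times> carrier M) (balanced_rels K H X ract M act) (x, m)"

text \<open>
  The tensor power \<open>V\<^sup>\<otimes>\<^sup>n\<close>, with the list \<open>[v\<^sub>0, \<dots>, v\<^sub>n\<^sub>-\<^sub>1]\<close> standing for the pure tensor
  \<open>v\<^sub>0 \<otimes> \<dots> \<otimes> v\<^sub>n\<^sub>-\<^sub>1\<close>.
\<close>

definition words :: "('k, 'v) module \<Rightarrow> nat \<Rightarrow> 'v list set" where
  "words V n = {l. length l = n \<and> set l \<subseteq> carrier V}"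

definition multilinear_rels ::
  "'k ring \<Rightarrow> ('k, 'v) module \<Rightarrow> nat \<Rightarrow> ('v list \<Rightarrow> 'k) set" where
  "multilinear_rels K V n = (let F = free_module K (words V n); e = basis_vec K in
     {e (l[i := v \<oplus>\<^bsub>V\<^esub> w]) \<ominus>\<^bsub>F\<^esub> (e (l[i := v]) \<oplus>\<^bsub>F\<^esub> e (l[i := w])) | l i v w.
        l \<in> words V n \<and> i < n \<and> v \<in> carrier V \<and> w \<in> carrier V} \<union>
     {e (l[i := c \<odot>\<^bsub>V\<^esub> v]) \<ominus>\<^bsub>F\<^esub> c \<odot>\<^bsub>F\<^esub> e (l[i := v]) | l i c v.
        l \<in> words V n \<and> i < n \<and> c \<in> carrier K \<and> v \<in> carrier V})"

definition tensor_power ::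
  "'k ring \<Rightarrow> ('k, 'v) module \<Rightarrow> nat \<Rightarrow> ('k, ('v list \<Rightarrow> 'k) set) module" where
  "tensor_power K V n = presented_module K (words V n) (multilinear_rels K V n)"

definition pure :: "'k ring \<Rightarrow> ('k, 'v) module \<Rightarrow> 'v list \<Rightarrow> ('v list \<Rightarrow> 'k) set" where
  "pure K V l = presented_gen K (words V (length l)) (multilinear_rels K V (length l)) l"


section \<open>Hopf algebras and crossed modules\<close>

locale assoc_algebra = K?: field K + H?: ring H + module K H
  for K :: "'k ring" and H :: "('k, 'h) module" +
  assumes smult_mult_left: "\<lbrakk>c \<in> carrier K; x \<in> carrier H; y \<in> carrier H\<rbrakk> \<Longrightarrow>
      (c \<odot>\<^bsub>H\<^esub> x) \<otimes>\<^bsub>H\<^esub> y = c \<odot>\<^bsub>H\<^esub> (x \<otimes>\<^bsub>H\<^esub> y)"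
    and smult_mult_right: "\<lbrakk>c \<in> carrier K; x \<in> carrier H; y \<in> carrier H\<rbrakk> \<Longrightarrow>
      x \<otimes>\<^bsub>H\<^esub> (c \<odot>\<^bsub>H\<^esub> y) = c \<odot>\<^bsub>H\<^esub> (x \<otimes>\<^bsub>H\<^esub> y)"

text \<open>Coassociativity is stated in \<open>(H \<otimes> H) \<otimes> H\<close>; \<open>comult_mult\<close> and \<open>comult_one\<close> together with
  \<open>counit_hom\<close> say that \<open>\<Delta>\<close> and \<open>\<epsilon>\<close> are algebra maps.\<close>

locale hopf_algebra = assoc_algebra K H
  for K :: "'k ring" and H :: "('k, 'h) module" +
  fixes \<Delta> :: "'h \<Rightarrow> ('h \<times> 'h \<Rightarrow> 'k) set" and \<epsilon> :: "'h \<Rightarrow> 'k" and S :: "'h \<Rightarrow> 'h"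
  assumes comult_linear: "\<Delta> \<in> linear_maps K H (tensor K H H)"
    and coassoc: "h \<in> carrier H \<Longrightarrow>
      tlift K (tensor K (tensor K H H) H) (\<lambda>(a, b). tens K (tensor K H H) H (\<Delta> a) b) (\<Delta> h) =
      tlift K (tensor K (tensor K H H) H)
        (\<lambda>(a, b). tlift K (tensor K (tensor K H H) H)
          (\<lambda>(b', b''). tens K (tensor K H H) H (tens K H H a b') b'') (\<Delta> b)) (\<Delta> h)"
    and counit_hom: "\<epsilon> \<in> ring_hom H K"
    and counit_smult: "\<lbrakk>c \<in> carrier K; h \<in> carrier H\<rbrakk> \<Longrightarrow> \<epsilon> (c \<odot>\<^bsub>H\<^esub> h) = c \<otimes>\<^bsub>K\<^esub> \<epsilon> h"
    and counit_left: "h \<in> carrier H \<Longrightarrow> tlift K H (\<lambda>(a, b). \<epsilon> a \<odot>\<^bsub>H\<^esub> b) (\<Delta> h) = h"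
    and counit_right: "h \<in> carrier H \<Longrightarrow> tlift K H (\<lambda>(a, b). \<epsilon> b \<odot>\<^bsub>H\<^esub> a) (\<Delta> h) = h"
    and comult_mult: "\<lbrakk>g \<in> carrier H; h \<in> carrier H\<rbrakk> \<Longrightarrow>
      \<Delta> (g \<otimes>\<^bsub>H\<^esub> h) =
      tlift K (tensor K H H)
        (\<lambda>(a, b). tlift K (tensor K H H)
          (\<lambda>(a', b'). tens K H H (a \<otimes>\<^bsub>H\<^esub> a') (b \<otimes>\<^bsub>H\<^esub> b')) (\<Delta> h)) (\<Delta> g)"
    and comult_one: "\<Delta> \<one>\<^bsub>H\<^esub> = tens K H H \<one>\<^bsub>H\<^esub> \<one>\<^bsub>H\<^esub>"
    and antipode_linear: "S \<in> linear_maps K H H"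
    and antipode_left: "h \<in> carrier H \<Longrightarrow>
      tlift K H (\<lambda>(a, b). S a \<otimes>\<^bsub>H\<^esub> b) (\<Delta> h) = \<epsilon> h \<odot>\<^bsub>H\<^esub> \<one>\<^bsub>H\<^esub>"
    and antipode_right: "h \<in> carrier H \<Longrightarrow>
      tlift K H (\<lambda>(a, b). a \<otimes>\<^bsub>H\<^esub> S b) (\<Delta> h) = \<epsilon> h \<odot>\<^bsub>H\<^esub> \<one>\<^bsub>H\<^esub>"

text \<open>\<open>iterated_comult K H \<Delta> n h\<close> is \<open>\<Sum> h\<^sub>(\<^sub>1\<^sub>) \<otimes> \<dots> \<otimes> h\<^sub>(\<^sub>n\<^sub>+\<^sub>1\<^sub>)\<close> in \<open>H\<^sup>\<otimes>\<^sup>(\<^sup>n\<^sup>+\<^sup>1\<^sup>)\<close>.\<close>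

primrec iterated_comult ::
  "'k ring \<Rightarrow> ('k, 'h) module \<Rightarrow> ('h \<Rightarrow> ('h \<times> 'h \<Rightarrow> 'k) set) \<Rightarrow> nat \<Rightarrow> 'h \<Rightarrow> ('h list \<Rightarrow> 'k) set" where
  "iterated_comult K H \<Delta> 0 h = pure K H [h]"
| "iterated_comult K H \<Delta> (Suc n) h =
     tlift K (tensor_power K H (n + 2))
       (\<lambda>(a, b). tlift K (tensor_power K H (n + 2)) (\<lambda>l. pure K H (a # l))
                   (iterated_comult K H \<Delta> n b)) (\<Delta> h)"

locale hopf_module = hopf_algebra K H \<Delta> \<epsilon> S + M?: module K M
  for K :: "'k ring" and H :: "('k, 'h) module" and \<Delta> \<epsilon> S and M :: "('k, 'm) module" +
  fixes act :: "'h \<Rightarrow> 'm \<Rightarrow> 'm"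
  assumes act_linear: "h \<in> carrier H \<Longrightarrow> act h \<in> linear_maps K M M"
    and act_linear': "m \<in> carrier M \<Longrightarrow> (\<lambda>h. act h m) \<in> linear_maps K H M"
    and act_one: "m \<in> carrier M \<Longrightarrow> act \<one>\<^bsub>H\<^esub> m = m"
    and act_mult: "\<lbrakk>g \<in> carrier H; h \<in> carrier H; m \<in> carrier M\<rbrakk> \<Longrightarrow>
      act (g \<otimes>\<^bsub>H\<^esub> h) m = act g (act h m)"

locale crossed_module = hopf_module K H \<Delta> \<epsilon> S M act
  for K :: "'k ring" and H :: "('k, 'h) module" and \<Delta> \<epsilon> S and M :: "('k, 'm) module" and act +
  fixes \<rho> :: "'m \<Rightarrow> ('m \<times> 'h \<Rightarrow> 'k) set"
  assumes coact_linear: "\<rho> \<in> linear_maps K M (tensor K M H)"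
    and coact_coassoc: "m \<in> carrier M \<Longrightarrow>
      tlift K (tensor K (tensor K M H) H) (\<lambda>(m', a). tens K (tensor K M H) H (\<rho> m') a) (\<rho> m) =
      tlift K (tensor K (tensor K M H) H)
        (\<lambda>(m', a). tlift K (tensor K (tensor K M H) H)
          (\<lambda>(a', a''). tens K (tensor K M H) H (tens K M H m' a') a'') (\<Delta> a)) (\<rho> m)"
    and coact_counit: "m \<in> carrier M \<Longrightarrow> tlift K M (\<lambda>(m', a). \<epsilon> a \<odot>\<^bsub>M\<^esub> m') (\<rho> m) = m"
    and coact_act: "\<lbrakk>h \<in> carrier H; m \<in> carrier M\<rbrakk> \<Longrightarrow>
      \<rho> (act h m) =
      tlift K (tensor K M H)
        (\<lambda>g. tlift K (tensor K M H)
          (\<lambda>(m', a). tens K M H (act (g!1) m') (g!2 \<otimes>\<^bsub>H\<^esub> a \<otimes>\<^bsub>H\<^esub> S (g!0))) (\<rho> m))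
        (iterated_comult K H \<Delta> 2 h)"

locale modular_crossed_module = crossed_module K H \<Delta> \<epsilon> S M act \<rho>
  for K :: "'k ring" and H :: "('k, 'h) module" and \<Delta> \<epsilon> S and M :: "('k, 'm) module" and act \<rho> +
  assumes modular: "m \<in> carrier M \<Longrightarrow> tlift K M (\<lambda>(m', a). act a m') (\<rho> m) = m"


section \<open>Cyclic modules\<close>

text \<open>Cyclic objects in the category of \<open>K\<close>-modules, with \<open>\<delta> n i : Z\<^sub>n \<rightarrow> Z\<^sub>n\<^sub>-\<^sub>1\<close> (for \<open>n \<ge> 1\<close>) and
  \<open>\<sigma> n i : Z\<^sub>n \<rightarrow> Z\<^sub>n\<^sub>+\<^sub>1\<close>.\<close>

locale simplicial_module =
  fixes K :: "'k ring" and Z :: "nat \<Rightarrow> ('k, 'z) module"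
    and \<delta> \<sigma> :: "nat \<Rightarrow> nat \<Rightarrow> 'z \<Rightarrow> 'z"
  assumes module: "module K (Z n)"
    and face_linear: "\<lbrakk>1 \<le> n; i \<le> n\<rbrakk> \<Longrightarrow> \<delta> n i \<in> linear_maps K (Z n) (Z (n - 1))"
    and degen_linear: "i \<le> n \<Longrightarrow> \<sigma> n i \<in> linear_maps K (Z n) (Z (n + 1))"
    and face_face: "\<lbrakk>i < j; j \<le> n; 2 \<le> n; z \<in> carrier (Z n)\<rbrakk> \<Longrightarrow>
      \<delta> (n - 1) i (\<delta> n j z) = \<delta> (n - 1) (j - 1) (\<delta> n i z)"
    and degen_degen: "\<lbrakk>i \<le> j; j \<le> n; z \<in> carrier (Z n)\<rbrakk> \<Longrightarrow>
      \<sigma> (n + 1) i (\<sigma> n j z) = \<sigma> (n + 1) (j + 1) (\<sigma> n i z)"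
    and face_degen_less: "\<lbrakk>i < j; j \<le> n; z \<in> carrier (Z n)\<rbrakk> \<Longrightarrow>
      \<delta> (n + 1) i (\<sigma> n j z) = \<sigma> (n - 1) (j - 1) (\<delta> n i z)"
    and face_degen_same: "\<lbrakk>j \<le> n; z \<in> carrier (Z n)\<rbrakk> \<Longrightarrow> \<delta> (n + 1) j (\<sigma> n j z) = z"
    and face_degen_Suc: "\<lbrakk>j \<le> n; z \<in> carrier (Z n)\<rbrakk> \<Longrightarrow> \<delta> (n + 1) (j + 1) (\<sigma> n j z) = z"
    and face_degen_greater: "\<lbrakk>j + 1 < i; i \<le> n + 1; z \<in> carrier (Z n)\<rbrakk> \<Longrightarrow>
      \<delta> (n + 1) i (\<sigma> n j z) = \<sigma> (n - 1) j (\<delta> n (i - 1) z)"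

locale cyclic_module = simplicial_module K Z \<delta> \<sigma>
  for K :: "'k ring" and Z :: "nat \<Rightarrow> ('k, 'z) module" and \<delta> \<sigma> +
  fixes \<tau> :: "nat \<Rightarrow> 'z \<Rightarrow> 'z"
  assumes cyclic_linear: "\<tau> n \<in> linear_maps K (Z n) (Z n)"
    and face_cyclic: "\<lbrakk>0 < i; i \<le> n; z \<in> carrier (Z n)\<rbrakk> \<Longrightarrow>
      \<delta> n i (\<tau> n z) = \<tau> (n - 1) (\<delta> n (i - 1) z)"
    and degen_cyclic: "\<lbrakk>0 < i; i \<le> n; z \<in> carrier (Z n)\<rbrakk> \<Longrightarrow>
      \<sigma> n i (\<tau> n z) = \<tau> (n + 1) (\<sigma> n (i - 1) z)"
    and face_zero_cyclic: "\<lbrakk>1 \<le> n; z \<in> carrier (Z n)\<rbrakk> \<Longrightarrow> \<delta> n 0 (\<tau> n z) = \<delta> n n z"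
    and degen_zero_cyclic: "z \<in> carrier (Z n) \<Longrightarrow>
      \<sigma> n 0 (\<tau> n z) = \<tau> (n + 1) (\<tau> (n + 1) (\<sigma> n n z))"
    and cyclic_order: "z \<in> carrier (Z n) \<Longrightarrow> (\<tau> n ^^ (n + 1)) z = z"


section \<open>The modules \<open>Z\<^sub>n(H, M)\<close> and their operators\<close>

definition diag_act ::
  "'k ring \<Rightarrow> ('k, 'h) module \<Rightarrow> ('h \<Rightarrow> ('h \<times> 'h \<Rightarrow> 'k) set) \<Rightarrow> nat \<Rightarrow>
   ('h list \<Rightarrow> 'k) set \<Rightarrow> 'h \<Rightarrow> ('h list \<Rightarrow> 'k) set" where
  "diag_act K H \<Delta> n x h =
     tlift K (tensor_power K H (n + 1))
       (\<lambda>l. tlift K (tensor_power K H (n + 1)) (\<lambda>g. pure K H (map2 (\<otimes>\<^bsub>H\<^esub>) l g))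
              (iterated_comult K H \<Delta> n h)) x"

definition Z_HM ::
  "'k ring \<Rightarrow> ('k, 'h) module \<Rightarrow> ('h \<Rightarrow> ('h \<times> 'h \<Rightarrow> 'k) set) \<Rightarrow>
   ('k, 'm) module \<Rightarrow> ('h \<Rightarrow> 'm \<Rightarrow> 'm) \<Rightarrow> nat \<Rightarrow>
   ('k, (('h list \<Rightarrow> 'k) set \<times> 'm \<Rightarrow> 'k) set) module" where
  "Z_HM K H \<Delta> M act n =
     tensor_over K H (tensor_power K H (n + 1)) (diag_act K H \<Delta> n) M act"

definition Z_tens ::
  "'k ring \<Rightarrow> ('k, 'h) module \<Rightarrow> ('h \<Rightarrow> ('h \<times> 'h \<Rightarrow> 'k) set) \<Rightarrow>
   ('k, 'm) module \<Rightarrow> ('h \<Rightarrow> 'm \<Rightarrow> 'm) \<Rightarrow> nat \<Rightarrow>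
   ('h list \<Rightarrow> 'k) set \<Rightarrow> 'm \<Rightarrow> (('h list \<Rightarrow> 'k) set \<times> 'm \<Rightarrow> 'k) set" where
  "Z_tens K H \<Delta> M act n =
     tens_over K H (tensor_power K H (n + 1)) (diag_act K H \<Delta> n) M act"

text \<open>
  \<open>K\<close>-linear families \<open>\<delta>\<close>, \<open>\<sigma>\<close>, \<open>\<tau>\<close> given by the stated formulas on all elements
  \<open>(h\<^sup>0, \<dots>, h\<^sup>n) \<otimes>\<^sub>H m\<close>, where \<open>l = [h\<^sup>0, \<dots>, h\<^sup>n]\<close>.  These elements span, so the formulas
  determine each operator on the carrier of \<open>Z\<^sub>n\<close>.
\<close>

locale hopf_cyclic_operators =
  fixes K :: "'k ring" and H :: "('k, 'h) module" and \<Delta> :: "'h \<Rightarrow> ('h \<times> 'h \<Rightarrow> 'k) set"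
    and \<epsilon> :: "'h \<Rightarrow> 'k" and M :: "('k, 'm) module" and act :: "'h \<Rightarrow> 'm \<Rightarrow> 'm"
    and \<rho> :: "'m \<Rightarrow> ('m \<times> 'h \<Rightarrow> 'k) set"
    and \<delta> \<sigma> :: "nat \<Rightarrow> nat \<Rightarrow> (('h list \<Rightarrow> 'k) set \<times> 'm \<Rightarrow> 'k) set \<Rightarrow>
                      (('h list \<Rightarrow> 'k) set \<times> 'm \<Rightarrow> 'k) set"
    and \<tau> :: "nat \<Rightarrow> (('h list \<Rightarrow> 'k) set \<times> 'm \<Rightarrow> 'k) set \<Rightarrow>
                  (('h list \<Rightarrow> 'k) set \<times> 'm \<Rightarrow> 'k) set"
  assumes face_linear: "\<lbrakk>1 \<le> n; i \<le> n\<rbrakk> \<Longrightarrow>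
      \<delta> n i \<in> linear_maps K (Z_HM K H \<Delta> M act n) (Z_HM K H \<Delta> M act (n - 1))"
    and degen_linear: "i \<le> n \<Longrightarrow>
      \<sigma> n i \<in> linear_maps K (Z_HM K H \<Delta> M act n) (Z_HM K H \<Delta> M act (n + 1))"
    and cyclic_linear: "\<tau> n \<in> linear_maps K (Z_HM K H \<Delta> M act n) (Z_HM K H \<Delta> M act n)"
    and face: "\<lbrakk>1 \<le> n; i \<le> n; l \<in> words H (n + 1); m \<in> carrier M\<rbrakk> \<Longrightarrow>
      \<delta> n i (Z_tens K H \<Delta> M act n (pure K H l) m) =
      \<epsilon> (l!i) \<odot>\<^bsub>Z_HM K H \<Delta> M act (n - 1)\<^esub>
        Z_tens K H \<Delta> M act (n - 1) (pure K H (take i l @ drop (i + 1) l)) m"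
    and degen: "\<lbrakk>i \<le> n; l \<in> words H (n + 1); m \<in> carrier M\<rbrakk> \<Longrightarrow>
      \<sigma> n i (Z_tens K H \<Delta> M act n (pure K H l) m) =
      Z_tens K H \<Delta> M act (n + 1)
        (tlift K (tensor_power K H (n + 2))
          (\<lambda>(a, b). pure K H (take i l @ [a, b] @ drop (i + 1) l)) (\<Delta> (l!i))) m"
    and cyclic: "\<lbrakk>l \<in> words H (n + 1); m \<in> carrier M\<rbrakk> \<Longrightarrow>
      \<tau> n (Z_tens K H \<Delta> M act n (pure K H l) m) =
      tlift K (Z_HM K H \<Delta> M act n)
        (\<lambda>(m', a). Z_tens K H \<Delta> M act n (pure K H ((l!n \<otimes>\<^bsub>H\<^esub> a) # take n l)) m') (\<rho> m)"

end

theory Submission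
  imports Defs
begin

text \<open>
  An operator given on the elements \<open>(h\<^sup>0, \<dots>, h\<^sup>n) \<otimes>\<^sub>H m\<close> extends to \<open>Z\<^sub>n\<close> as soon as its formula is multilinear
  and balanced over \<open>H\<close>.  Balancedness of the faces is the counit axiom and that of the degeneracies is
  coassociativity, both applied in one position of the iterated comultiplication.  For \<open>\<tau>\<^sub>n\<close> it is
  the crossed module condition: moving \<open>h\<close> across \<open>\<otimes>\<^sub>H\<close> produces \<open>h\<^sub>(\<^sub>3\<^sub>) m\<^sub>\<langle>\<^sub>1\<^sub>\<rangle> S(h\<^sub>(\<^sub>1\<^sub>))\<close> in the first
  position, and moving \<open>h\<^sub>(\<^sub>2\<^sub>)\<close> back multiplies this position by the first component of \<open>h\<^sub>(\<^sub>2\<^sub>)\<close>, so that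
  the antipode cancels.  The identities need to be checked only on the spanning elements.  There
  \<open>\<tau>\<^sub>n\<^sup>n\<^sup>+\<^sup>1\<close> multiplies \<open>(h\<^sup>0, \<dots>, h\<^sup>n)\<close> by the iterated comultiplication of \<open>m\<^sub>\<langle>\<^sub>1\<^sub>\<rangle>\<close>; moving \<open>m\<^sub>\<langle>\<^sub>1\<^sub>\<rangle>\<close> across
  \<open>\<otimes>\<^sub>H\<close> turns it into \<open>\<Sum> (h\<^sup>0, \<dots>, h\<^sup>n) \<otimes>\<^sub>H m\<^sub>\<langle>\<^sub>1\<^sub>\<rangle> m\<^sub>\<langle>\<^sub>0\<^sub>\<rangle>\<close>, and modularity finishes.
\<close>

section \<open>Linear maps\<close>

text \<open>The Sweedler sums of the definitions are values of \<open>tlift\<close>, meaningful only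
  for maps that respect the relations, so nesting or exchanging them would need a check at every
  level. Fixing a list of pure tensors for each \<open>\<Delta> h\<close> and
  \<open>\<rho> m\<close> avoids this: list sums may be rearranged freely. The price is that the
  chosen lists are not additive, so linearity in the decomposed element must be drawn from
  \<open>tlift\<close>. The iterated coproduct splits only its last factor, whereas the operators
  touch arbitrary positions; hence the axioms of \<open>H\<close> are first carried to every
  position of a word. Besides the counit and coassociativity axioms, multiplicativity of \<epsilon>
  and \<Delta> is essential: a face or degeneracy after the diagonal action meets a product of two
  entries. With the comodule axioms of \<open>M\<close> it also gives \<delta>_0 \<tau>_n =
  \<delta>_n and \<sigma>_0 \<tau>_n = \<tau>_(n+1)^2 \<sigma>_n, where the front entry is h^n
  m_<1>. In \<tau>_n^(n+1) each application takes a fresh coaction, and coassociativity of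
  \<open>\<rho>\<close> puts the newest component first, which is the order of the diagonal
  action.\<close>

locale scalars = cring K for K :: "'k ring"
begin

lemma linear_mapsI:
  assumes "\<And>x. x \<in> carrier V \<Longrightarrow> f x \<in> carrier W"
    and "\<And>x y. \<lbrakk>x \<in> carrier V; y \<in> carrier V\<rbrakk> \<Longrightarrow> f (x \<oplus>\<^bsub>V\<^esub> y) = f x \<oplus>\<^bsub>W\<^esub> f y"
    and "\<And>c x. \<lbrakk>c \<in> carrier K; x \<in> carrier V\<rbrakk> \<Longrightarrow> f (c \<odot>\<^bsub>V\<^esub> x) = c \<odot>\<^bsub>W\<^esub> f x"
  shows "f \<in> linear_maps K V W"
  using assms by (auto simp: linear_maps_def)

lemma linear_closed: "\<lbrakk>f \<in> linear_maps K V W; x \<in> carrier V\<rbrakk> \<Longrightarrow> f x \<in> carrier W"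
  by (auto simp: linear_maps_def)

lemma linear_add:
  "\<lbrakk>f \<in> linear_maps K V W; x \<in> carrier V; y \<in> carrier V\<rbrakk> \<Longrightarrow> f (x \<oplus>\<^bsub>V\<^esub> y) = f x \<oplus>\<^bsub>W\<^esub> f y"
  by (auto simp: linear_maps_def)

lemma linear_smult:
  "\<lbrakk>f \<in> linear_maps K V W; c \<in> carrier K; x \<in> carrier V\<rbrakk> \<Longrightarrow> f (c \<odot>\<^bsub>V\<^esub> x) = c \<odot>\<^bsub>W\<^esub> f x"
  by (auto simp: linear_maps_def)

lemma linear_zero:
  assumes "module K V" "module K W" "f \<in> linear_maps K V W"
  shows "f \<zero>\<^bsub>V\<^esub> = \<zero>\<^bsub>W\<^esub>"
proof -
  interpret V: module K V by fact
  interpret W: module K W by fact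
  have "f (\<zero>\<^bsub>K\<^esub> \<odot>\<^bsub>V\<^esub> \<zero>\<^bsub>V\<^esub>) = \<zero>\<^bsub>K\<^esub> \<odot>\<^bsub>W\<^esub> f \<zero>\<^bsub>V\<^esub>"
    by (rule linear_smult [OF assms(3)]) auto
  then show ?thesis using linear_closed [OF assms(3)] by simp
qed

lemma linear_neg:
  assumes "module K V" "module K W" "f \<in> linear_maps K V W" "x \<in> carrier V"
  shows "f (\<ominus>\<^bsub>V\<^esub> x) = \<ominus>\<^bsub>W\<^esub> f x"
proof -
  interpret V: module K V by fact
  interpret W: module K W by fact
  have "f (\<ominus>\<^bsub>V\<^esub> x) \<oplus>\<^bsub>W\<^esub> f x = f (\<ominus>\<^bsub>V\<^esub> x \<oplus>\<^bsub>V\<^esub> x)"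
    using assms by (simp add: linear_add)
  also have "\<dots> = \<zero>\<^bsub>W\<^esub>"
    using assms linear_zero [OF assms(1-3)] by (simp add: V.l_neg)
  finally show ?thesis
    using assms by (simp add: W.minus_equality linear_closed)
qed

lemma linear_diff:
  assumes "module K V" "module K W" "f \<in> linear_maps K V W" "x \<in> carrier V" "y \<in> carrier V"
  shows "f (x \<ominus>\<^bsub>V\<^esub> y) = f x \<ominus>\<^bsub>W\<^esub> f y"
proof -
  interpret V: module K V by fact
  interpret W: module K W by fact
  show ?thesis
    using assms by (simp add: a_minus_def linear_add linear_neg)
qed

lemma linear_comp:
  "\<lbrakk>f \<in> linear_maps K U V; g \<in> linear_maps K V W\<rbrakk> \<Longrightarrow> (\<lambda>x. g (f x)) \<in> linear_maps K U W"
  by (intro linear_mapsI) (simp_all add: linear_closed linear_add linear_smult)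

lemma linear_id: "(\<lambda>x. x) \<in> linear_maps K V V"
  by (auto simp: linear_maps_def)

lemma linear_cong:
  assumes "module K V" "f \<in> linear_maps K V W" "\<And>x. x \<in> carrier V \<Longrightarrow> f x = g x"
  shows "g \<in> linear_maps K V W"
proof -
  interpret V: module K V by fact
  show ?thesis
    using assms(2)
    by (intro linear_mapsI)
       (simp_all add: linear_closed linear_add linear_smult assms(3) [symmetric])
qed

lemma linear_scale:
  assumes "module K W" "f \<in> linear_maps K V W" "c \<in> carrier K"
  shows "(\<lambda>x. c \<odot>\<^bsub>W\<^esub> f x) \<in> linear_maps K V W"
proof -
  interpret W: module K W by fact
  show ?thesis
    using assms(2,3)
    by (intro linear_mapsI)
       (simp_all add: linear_closed linear_add linear_smult W.smult_r_distr m_comm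
         W.smult_assoc1 [symmetric])
qed

subsection \<open>Sums over lists\<close>

text \<open>Lists index the sums because a decomposition into pure tensors may repeat a pair, which
  a sum over a set of pairs would count once.\<close>

primrec lsum :: "('k, 'w) module \<Rightarrow> ('x \<Rightarrow> 'w) \<Rightarrow> 'x list \<Rightarrow> 'w" where
  "lsum W f [] = \<zero>\<^bsub>W\<^esub>"
| "lsum W f (x # xs) = f x \<oplus>\<^bsub>W\<^esub> lsum W f xs"

lemma lsum_closed:
  assumes "module K W" "\<And>x. x \<in> set xs \<Longrightarrow> f x \<in> carrier W"
  shows "lsum W f xs \<in> carrier W"
proof -
  interpret W: module K W by fact
  show ?thesis using assms(2) by (induction xs) auto
qed

lemma lsum_cong:
  "(\<And>x. x \<in> set xs \<Longrightarrow> f x = g x) \<Longrightarrow> lsum W f xs = lsum W g xs"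
  by (induction xs) auto

lemma lsum_zero:
  assumes "module K W"
  shows "lsum W (\<lambda>x. \<zero>\<^bsub>W\<^esub>) xs = \<zero>\<^bsub>W\<^esub>"
proof -
  interpret W: module K W by fact
  show ?thesis by (induction xs) auto
qed

lemma lsum_add:
  assumes "module K W" "\<And>x. x \<in> set xs \<Longrightarrow> f x \<in> carrier W" "\<And>x. x \<in> set xs \<Longrightarrow> g x \<in> carrier W"
  shows "lsum W (\<lambda>x. f x \<oplus>\<^bsub>W\<^esub> g x) xs = lsum W f xs \<oplus>\<^bsub>W\<^esub> lsum W g xs"
proof -
  interpret W: module K W by fact
  show ?thesis using assms(2,3)
  proof (induction xs)
    case (Cons a xs)
    then show ?case
      using lsum_closed [OF assms(1), of xs f] lsum_closed [OF assms(1), of xs g]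
      by (simp add: W.a_ac)
  qed auto
qed

lemma lsum_append:
  assumes "module K W" "\<And>x. x \<in> set xs \<union> set ys \<Longrightarrow> f x \<in> carrier W"
  shows "lsum W f (xs @ ys) = lsum W f xs \<oplus>\<^bsub>W\<^esub> lsum W f ys"
proof -
  interpret W: module K W by fact
  have "lsum W f ys \<in> carrier W" by (rule lsum_closed [OF assms(1)]) (simp add: assms)
  with assms(2) show ?thesis
  proof (induction xs)
    case (Cons a xs)
    then show ?case
      using lsum_closed [OF assms(1), of xs f] by (simp add: W.a_ac)
  qed auto
qed

lemma linear_lsum:
  assumes "module K V" "module K W" "f \<in> linear_maps K V W"
    "\<And>x. x \<in> set xs \<Longrightarrow> F x \<in> carrier V"
  shows "f (lsum V F xs) = lsum W (\<lambda>x. f (F x)) xs"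
  using assms(4)
proof (induction xs)
  case (Cons a xs)
  then show ?case
    using lsum_closed [OF assms(1), of xs F] by (simp add: linear_add [OF assms(3)])
qed (simp add: linear_zero [OF assms(1-3)])

lemma smult_lsum:
  assumes "module K W" "c \<in> carrier K" "\<And>x. x \<in> set xs \<Longrightarrow> F x \<in> carrier W"
  shows "c \<odot>\<^bsub>W\<^esub> lsum W F xs = lsum W (\<lambda>x. c \<odot>\<^bsub>W\<^esub> F x) xs"
  using linear_lsum [OF assms(1,1) linear_scale [OF assms(1) linear_id assms(2)]] assms(3) by blast

text \<open>Sweedler sums over unrelated lists, such as those of a coaction and of a coproduct, are
  exchanged by this alone; no linearity in the indices is involved.\<close>

lemma lsum_swap:
  assumes "module K W" "\<And>x y. \<lbrakk>x \<in> set xs; y \<in> set ys\<rbrakk> \<Longrightarrow> F x y \<in> carrier W"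
  shows "lsum W (\<lambda>x. lsum W (F x) ys) xs = lsum W (\<lambda>y. lsum W (\<lambda>x. F x y) xs) ys"
  using assms(2)
proof (induction xs)
  case Nil
  then show ?case by (simp add: lsum_zero [OF assms(1)])
next
  case (Cons a xs)
  have "lsum W (\<lambda>y. F a y \<oplus>\<^bsub>W\<^esub> lsum W (\<lambda>x. F x y) xs) ys =
    lsum W (F a) ys \<oplus>\<^bsub>W\<^esub> lsum W (\<lambda>y. lsum W (\<lambda>x. F x y) xs) ys"
    by (rule lsum_add [OF assms(1)]) (auto intro!: lsum_closed [OF assms(1)] Cons.prems)
  with Cons show ?case by simp
qed

text \<open>The list is held fixed while \<open>v\<close> varies. For sums whose list depends on the
  argument, as with \<open>cop\<close> below, linearity needs a different source.\<close>

lemma linear_lsum_pointwise: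
  assumes "module K W" "\<And>x. x \<in> set xs \<Longrightarrow> (\<lambda>v. F v x) \<in> linear_maps K V W"
  shows "(\<lambda>v. lsum W (F v) xs) \<in> linear_maps K V W"
proof (rule linear_mapsI)
  interpret W: module K W by fact
  show "lsum W (F v) xs \<in> carrier W" if "v \<in> carrier V" for v
    by (rule lsum_closed [OF assms(1)]) (rule linear_closed [OF assms(2) that])
  show "lsum W (F (u \<oplus>\<^bsub>V\<^esub> v)) xs = lsum W (F u) xs \<oplus>\<^bsub>W\<^esub> lsum W (F v) xs"
    if "u \<in> carrier V" "v \<in> carrier V" for u v
    using that
    by (subst lsum_add [OF assms(1), symmetric])
       (auto intro!: lsum_cong linear_closed [OF assms(2)] linear_add [OF assms(2)])
  show "lsum W (F (c \<odot>\<^bsub>V\<^esub> v)) xs = c \<odot>\<^bsub>W\<^esub> lsum W (F v) xs"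
    if "c \<in> carrier K" "v \<in> carrier V" for c v
    using that
    by (subst smult_lsum [OF assms(1)])
       (auto intro!: lsum_cong linear_closed [OF assms(2)] linear_smult [OF assms(2)])
qed

section \<open>Presented modules\<close>

abbreviation "supp r \<equiv> {x. r x \<noteq> \<zero>\<^bsub>K\<^esub>}"

lemma free_carrier:
  "f \<in> carrier (free_module K X) \<longleftrightarrow>
     (\<forall>x. f x \<in> carrier K) \<and> finite (supp f) \<and> supp f \<subseteq> X"
  by (auto simp: free_module_def)

lemma free_simps:
  "\<zero>\<^bsub>free_module K X\<^esub> = (\<lambda>x. \<zero>\<^bsub>K\<^esub>)"
  "f \<oplus>\<^bsub>free_module K X\<^esub> g = (\<lambda>x. f x \<oplus>\<^bsub>K\<^esub> g x)"
  "c \<odot>\<^bsub>free_module K X\<^esub> f = (\<lambda>x. c \<otimes>\<^bsub>K\<^esub> f x)"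
  by (auto simp: free_module_def)

lemma free_carrierI:
  "\<lbrakk>\<And>x. f x \<in> carrier K; finite A; supp f \<subseteq> A; A \<subseteq> X\<rbrakk> \<Longrightarrow> f \<in> carrier (free_module K X)"
  unfolding free_carrier by (meson finite_subset order_trans)

lemma free_add_closed:
  assumes "f \<in> carrier (free_module K X)" "g \<in> carrier (free_module K X)"
  shows "(\<lambda>x. f x \<oplus>\<^bsub>K\<^esub> g x) \<in> carrier (free_module K X)"
proof (rule free_carrierI [of _ "supp f \<union> supp g"])
  show "supp (\<lambda>x. f x \<oplus>\<^bsub>K\<^esub> g x) \<subseteq> supp f \<union> supp g" by auto
qed (use assms in \<open>simp_all add: free_carrier\<close>)

lemma free_smult_closed:
  assumes "f \<in> carrier (free_module K X)" "c \<in> carrier K"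
  shows "(\<lambda>x. c \<otimes>\<^bsub>K\<^esub> f x) \<in> carrier (free_module K X)"
proof (rule free_carrierI [of _ "supp f"])
  show "supp (\<lambda>x. c \<otimes>\<^bsub>K\<^esub> f x) \<subseteq> supp f" using assms(2) by auto
qed (use assms in \<open>simp_all add: free_carrier\<close>)

lemma free_neg_closed:
  assumes "f \<in> carrier (free_module K X)"
  shows "(\<lambda>x. \<ominus>\<^bsub>K\<^esub> f x) \<in> carrier (free_module K X)"
proof (rule free_carrierI [of _ "supp f"])
  show "supp (\<lambda>x. \<ominus>\<^bsub>K\<^esub> f x) \<subseteq> supp f" by auto
qed (use assms in \<open>simp_all add: free_carrier\<close>)

lemma free_value_closed: "f \<in> carrier (free_module K X) \<Longrightarrow> f x \<in> carrier K"
  by (simp add: free_carrier)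

lemma free_module_is_module: "module K (free_module K X)"
proof (rule moduleI)
  note val = free_value_closed [of _ X]
  show "cring K" by (rule cring_axioms)
  show "abelian_group (free_module K X)"
  proof (rule abelian_groupI)
    fix f assume f: "f \<in> carrier (free_module K X)"
    show "\<exists>g\<in>carrier (free_module K X). g \<oplus>\<^bsub>free_module K X\<^esub> f = \<zero>\<^bsub>free_module K X\<^esub>"
      by (intro bexI [OF _ free_neg_closed [OF f]]) (simp add: free_simps val [OF f] l_neg)
    show "\<zero>\<^bsub>free_module K X\<^esub> \<oplus>\<^bsub>free_module K X\<^esub> f = f"
      by (simp add: free_simps val [OF f])
    fix g assume g: "g \<in> carrier (free_module K X)"
    show "f \<oplus>\<^bsub>free_module K X\<^esub> g \<in> carrier (free_module K X)"
      unfolding free_simps by (rule free_add_closed [OF f g])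
    show "f \<oplus>\<^bsub>free_module K X\<^esub> g = g \<oplus>\<^bsub>free_module K X\<^esub> f"
      by (simp add: free_simps val [OF f] val [OF g] a_comm)
    fix h assume h: "h \<in> carrier (free_module K X)"
    show "f \<oplus>\<^bsub>free_module K X\<^esub> g \<oplus>\<^bsub>free_module K X\<^esub> h =
        f \<oplus>\<^bsub>free_module K X\<^esub> (g \<oplus>\<^bsub>free_module K X\<^esub> h)"
      by (simp add: free_simps val [OF f] val [OF g] val [OF h] a_assoc)
  qed (simp add: free_simps free_carrier)
  fix c f assume c: "c \<in> carrier K" and f: "f \<in> carrier (free_module K X)"
  show "c \<odot>\<^bsub>free_module K X\<^esub> f \<in> carrier (free_module K X)"
    unfolding free_simps by (rule free_smult_closed [OF f c])
  fix d assume d: "d \<in> carrier K"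
  show "(c \<oplus>\<^bsub>K\<^esub> d) \<odot>\<^bsub>free_module K X\<^esub> f =
      c \<odot>\<^bsub>free_module K X\<^esub> f \<oplus>\<^bsub>free_module K X\<^esub> d \<odot>\<^bsub>free_module K X\<^esub> f"
    by (simp add: free_simps val [OF f] c d l_distr)
  show "(c \<otimes>\<^bsub>K\<^esub> d) \<odot>\<^bsub>free_module K X\<^esub> f = c \<odot>\<^bsub>free_module K X\<^esub> (d \<odot>\<^bsub>free_module K X\<^esub> f)"
    by (simp add: free_simps val [OF f] c d m_assoc)
next
  note val = free_value_closed [of _ X]
  fix c f g assume c: "c \<in> carrier K" and f: "f \<in> carrier (free_module K X)"
    and g: "g \<in> carrier (free_module K X)"
  show "c \<odot>\<^bsub>free_module K X\<^esub> (f \<oplus>\<^bsub>free_module K X\<^esub> g) =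
      c \<odot>\<^bsub>free_module K X\<^esub> f \<oplus>\<^bsub>free_module K X\<^esub> c \<odot>\<^bsub>free_module K X\<^esub> g"
    by (simp add: free_simps val [OF f] val [OF g] c r_distr)
next
  fix f assume f: "f \<in> carrier (free_module K X)"
  show "\<one>\<^bsub>K\<^esub> \<odot>\<^bsub>free_module K X\<^esub> f = f"
    by (simp add: free_simps free_value_closed [OF f])
qed

lemma basis_vec_closed: "x \<in> X \<Longrightarrow> basis_vec K x \<in> carrier (free_module K X)"
proof -
  have "supp (basis_vec K x) \<subseteq> {x}" by (auto simp: basis_vec_def)
  then have "finite (supp (basis_vec K x))" by (rule finite_subset) simp
  then show "x \<in> X \<Longrightarrow> ?thesis" by (auto simp: free_carrier basis_vec_def)
qed

text \<open>This is the map whose values \<open>tlift\<close> collects on a coset, so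
  \<open>tlift\<close> is the induced map on the quotient as soon as this one kills the
  relations.\<close>

definition linear_extension :: "('k, 'w) module \<Rightarrow> ('x \<Rightarrow> 'w) \<Rightarrow> ('x \<Rightarrow> 'k) \<Rightarrow> 'w" where
  "linear_extension W F r = (\<Oplus>\<^bsub>W\<^esub>x\<in>supp r. r x \<odot>\<^bsub>W\<^esub> F x)"

text \<open>Terms outside the support have coefficient zero. The supports of \<open>r\<close>,
  \<open>s\<close> and their sum differ, so linearity is proved over a common finite index
  set.\<close>

lemma linear_extension_superset:
  assumes "module K W" "F \<in> X \<rightarrow> carrier W" "r \<in> carrier (free_module K X)"
    "finite A" "supp r \<subseteq> A" "A \<subseteq> X"
  shows "linear_extension W F r = (\<Oplus>\<^bsub>W\<^esub>x\<in>A. r x \<odot>\<^bsub>W\<^esub> F x)"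
proof -
  interpret W: module K W by fact
  show ?thesis unfolding linear_extension_def
    by (rule W.add.finprod_mono_neutral_cong_left) (use assms in \<open>auto simp: free_carrier Pi_def\<close>)
qed

lemma linear_extension_linear:
  assumes "module K W" "F \<in> X \<rightarrow> carrier W"
  shows "linear_extension W F \<in> linear_maps K (free_module K X) W"
proof (rule linear_mapsI)
  interpret W: module K W by fact
  have F: "F x \<in> carrier W" if "x \<in> X" for x using assms(2) that by auto
  fix r assume r: "r \<in> carrier (free_module K X)"
  show "linear_extension W F r \<in> carrier W" unfolding linear_extension_def
    using assms r by (intro W.finsum_closed) (auto simp: free_carrier Pi_def)
  {
    fix s assume s: "s \<in> carrier (free_module K X)"
    let ?A = "supp r \<union> supp s"
    have A: "finite ?A" "?A \<subseteq> X" using r s by (auto simp: free_carrier)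
    have t: "supp (\<lambda>x. r x \<oplus>\<^bsub>K\<^esub> s x) \<subseteq> ?A"
      using r s by (auto simp: free_carrier)
    have c: "(\<lambda>x. r x \<odot>\<^bsub>W\<^esub> F x) \<in> ?A \<rightarrow> carrier W" "(\<lambda>x. s x \<odot>\<^bsub>W\<^esub> F x) \<in> ?A \<rightarrow> carrier W"
      using F A(2) free_value_closed [OF r] free_value_closed [OF s] by auto
    show "linear_extension W F (r \<oplus>\<^bsub>free_module K X\<^esub> s) =
      linear_extension W F r \<oplus>\<^bsub>W\<^esub> linear_extension W F s"
      apply (subst free_simps(2))
      apply (subst linear_extension_superset [OF assms free_add_closed [OF r s] A(1) t A(2)])
      apply (subst linear_extension_superset [OF assms r A(1) _ A(2)], blast)
      apply (subst linear_extension_superset [OF assms s A(1) _ A(2)], blast)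
      apply (subst W.finsum_addf [symmetric, OF c])
      apply (rule W.finsum_cong [OF refl])
      using F A(2) free_value_closed [OF r] free_value_closed [OF s]
      by (auto simp: subset_iff W.smult_l_distr simp_implies_def)
  }
  fix c assume k: "c \<in> carrier K"
  have A: "finite (supp r)" "supp r \<subseteq> X" using r by (auto simp: free_carrier)
  have t: "supp (\<lambda>x. c \<otimes>\<^bsub>K\<^esub> r x) \<subseteq> supp r"
    using r k by (auto simp: free_carrier)
  have e: "(\<lambda>x. r x \<odot>\<^bsub>W\<^esub> F x) \<in> supp r \<rightarrow> carrier W"
    using F A(2) free_value_closed [OF r] by auto
  show "linear_extension W F (c \<odot>\<^bsub>free_module K X\<^esub> r) = c \<odot>\<^bsub>W\<^esub> linear_extension W F r"
    apply (subst free_simps(3))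
    apply (subst linear_extension_superset [OF assms free_smult_closed [OF r k] A(1) t A(2)])
    apply (subst linear_extension_superset [OF assms r A(1) subset_refl A(2)])
    apply (subst W.finsum_smult_ldistr [OF A(1) k e])
    apply (rule W.finsum_cong [OF refl])
    using F A(2) free_value_closed [OF r] k
    by (auto simp: subset_iff W.smult_assoc1 simp_implies_def)
qed

lemma linear_extension_basis_vec:
  assumes "module K W" "F \<in> X \<rightarrow> carrier W" "x \<in> X"
  shows "linear_extension W F (basis_vec K x) = F x"
proof -
  interpret W: module K W by fact
  have "linear_extension W F (basis_vec K x) = (\<Oplus>\<^bsub>W\<^esub>y\<in>{x}. basis_vec K x y \<odot>\<^bsub>W\<^esub> F y)"
    by (rule linear_extension_superset [OF assms(1,2) basis_vec_closed [OF assms(3)]])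
       (use assms in \<open>auto simp: basis_vec_def\<close>)
  also have "\<dots> = F x"
    using assms by (simp add: basis_vec_def Pi_def)
  finally show ?thesis .
qed

text \<open>The induction runs over a finite set containing the support rather than over the support
  itself, so that the hypothesis applies as soon as one coefficient is erased.\<close>

lemma free_induct [consumes 1, case_names zero step]:
  assumes r: "r \<in> carrier (free_module K X)"
    and zero: "Q (\<lambda>x. \<zero>\<^bsub>K\<^esub>)"
    and step: "\<And>c x r. \<lbrakk>c \<in> carrier K; x \<in> X; r \<in> carrier (free_module K X); Q r\<rbrakk> \<Longrightarrow>
      Q ((c \<odot>\<^bsub>free_module K X\<^esub> basis_vec K x) \<oplus>\<^bsub>free_module K X\<^esub> r)"
  shows "Q r"
proof -
  have "Q r" if "finite A" "supp r \<subseteq> A" "r \<in> carrier (free_module K X)" for A r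
    using that
  proof (induction A arbitrary: r rule: finite_induct)
    case empty
    then have "r = (\<lambda>x. \<zero>\<^bsub>K\<^esub>)" by auto
    then show ?case using zero by simp
  next
    case (insert x A)
    show ?case
    proof (cases "x \<in> supp r")
      case True
      let ?s = "r(x := \<zero>\<^bsub>K\<^esub>)"
      have sup: "supp ?s \<subseteq> A" "supp ?s \<subseteq> supp r" using insert.prems by auto
      have s: "?s \<in> carrier (free_module K X)"
        using insert.prems sup finite_subset [OF sup(2)] by (auto simp: free_carrier)
      have "Q ((r x \<odot>\<^bsub>free_module K X\<^esub> basis_vec K x) \<oplus>\<^bsub>free_module K X\<^esub> ?s)"
        using insert.prems True
        by (intro step insert.IH [OF sup(1) s] s) (auto simp: free_carrier)
      also have "(r x \<odot>\<^bsub>free_module K X\<^esub> basis_vec K x) \<oplus>\<^bsub>free_module K X\<^esub> ?s = r"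
        using free_value_closed [OF insert.prems(2)] by (auto simp: free_simps basis_vec_def)
      finally show ?thesis .
    next
      case False
      then show ?thesis using insert by blast
    qed
  qed
  then show ?thesis using r by (auto simp: free_carrier)
qed

text \<open>Lets a linear map that kills \<open>R\<close> be compared with the least submodule
  containing \<open>R\<close>.\<close>

lemma kernel_submodule:
  assumes "module K V" "module K W" "f \<in> linear_maps K V W"
  shows "submodule {x \<in> carrier V. f x = \<zero>\<^bsub>W\<^esub>} K V"
proof -
  interpret V: module K V by fact
  interpret W: module K W by fact
  show ?thesis
    by (rule V.submoduleI)
       (use assms in \<open>auto simp: linear_zero linear_neg linear_add linear_smult\<close>)
qed

text \<open>The whole carrier belongs to the family being intersected, so the intersection stays
  inside the module.\<close>

lemma generated_submodule_submodule:
  assumes "module K V" "R \<subseteq> carrier V"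
  shows "submodule (generated_submodule K V R) K V"
proof -
  interpret V: module K V by fact
  have zero: "\<zero>\<^bsub>V\<^esub> \<in> N" if "submodule N K V" for N
    using subgroup.one_closed [OF submodule.axioms(1) [OF that]] by simp
  show ?thesis
    by (rule V.submoduleI)
       (use V.carrier_is_submodule assms(2) in \<open>auto simp: generated_submodule_def
          intro: zero V.submoduleE(3-5)\<close>)
qed

lemma generated_submodule_superset: "R \<subseteq> generated_submodule K V R"
  by (auto simp: generated_submodule_def)

lemma generated_submodule_least:
  "\<lbrakk>submodule N K V; R \<subseteq> N\<rbrakk> \<Longrightarrow> generated_submodule K V R \<subseteq> N"
  by (auto simp: generated_submodule_def)

lemma submodule_abelian_subgroup:
  assumes "module K V" "submodule N K V"
  shows "abelian_subgroup N V"
proof -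
  interpret V: module K V by fact
  show ?thesis
    by (rule abelian_subgroupI3 [OF additive_subgroup.intro [OF submodule.axioms(1) [OF assms(2)]]])
       (rule V.abelian_group_axioms)
qed

lemma quotient_coset_linear:
  assumes "module K V" "submodule N K V"
  shows "module K (quotient_module V N)"
    and "(\<lambda>v. N +>\<^bsub>V\<^esub> v) \<in> linear_maps K V (quotient_module V N)"
proof -
  interpret V: module K V by fact
  interpret N: abelian_subgroup N V by (rule submodule_abelian_subgroup) fact+
  let ?Q = "quotient_module V N"
  have carr: "carrier ?Q = (\<lambda>v. N +>\<^bsub>V\<^esub> v) ` carrier V"
    by (auto simp: quotient_module_def A_RCOSETS_def')
  have add: "(N +>\<^bsub>V\<^esub> v) \<oplus>\<^bsub>?Q\<^esub> (N +>\<^bsub>V\<^esub> w) = N +>\<^bsub>V\<^esub> (v \<oplus>\<^bsub>V\<^esub> w)"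
    if "v \<in> carrier V" "w \<in> carrier V" for v w
    using that by (simp add: quotient_module_def N.a_rcos_sum)
  have zero: "\<zero>\<^bsub>?Q\<^esub> = N +>\<^bsub>V\<^esub> \<zero>\<^bsub>V\<^esub>"
    using V.a_coset_add_zero [OF N.a_subset] by (simp add: quotient_module_def)
  have eq: "X \<in> carrier ?Q \<Longrightarrow> \<exists>v\<in>carrier V. X = N +>\<^bsub>V\<^esub> v" for X
    unfolding carr by auto
  have closed: "N +>\<^bsub>V\<^esub> v \<in> carrier ?Q" if "v \<in> carrier V" for v
    using that carr by auto
  have ag: "abelian_group ?Q"
  proof (rule abelian_groupI)
    show "\<exists>Y\<in>carrier ?Q. Y \<oplus>\<^bsub>?Q\<^esub> X = \<zero>\<^bsub>?Q\<^esub>" if X: "X \<in> carrier ?Q" for X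
    proof -
      obtain v where v: "v \<in> carrier V" "X = N +>\<^bsub>V\<^esub> v" using eq [OF X] by auto
      then show ?thesis
        by (intro bexI [OF _ closed [of "\<ominus>\<^bsub>V\<^esub> v"]]) (simp_all add: add zero V.l_neg)
    qed
  qed (auto dest!: eq simp: add zero V.a_ac closed)
  have smult: "c \<odot>\<^bsub>?Q\<^esub> (N +>\<^bsub>V\<^esub> v) = N +>\<^bsub>V\<^esub> (c \<odot>\<^bsub>V\<^esub> v)"
    if c: "c \<in> carrier K" and v: "v \<in> carrier V" for c v
  proof -
    \<comment> \<open>The scalar action on cosets is a union over all representatives; it is a
      single coset because the scaled representatives all differ by elements of
      \<open>N\<close>.\<close>
    have *: "N +>\<^bsub>V\<^esub> (c \<odot>\<^bsub>V\<^esub> x) = N +>\<^bsub>V\<^esub> (c \<odot>\<^bsub>V\<^esub> v)" if x: "x \<in> N +>\<^bsub>V\<^esub> v" for x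
    proof -
      obtain n where n: "n \<in> N" "x = n \<oplus>\<^bsub>V\<^esub> v" using x by (auto simp: a_r_coset_def')
      have "c \<odot>\<^bsub>V\<^esub> x = c \<odot>\<^bsub>V\<^esub> n \<oplus>\<^bsub>V\<^esub> c \<odot>\<^bsub>V\<^esub> v"
        using n c v N.a_subset by (auto simp: V.smult_r_distr)
      moreover have "c \<odot>\<^bsub>V\<^esub> n \<in> N" using submodule.smult_closed [OF assms(2) c n(1)] .
      ultimately have "c \<odot>\<^bsub>V\<^esub> x \<in> N +>\<^bsub>V\<^esub> (c \<odot>\<^bsub>V\<^esub> v)" by (auto simp: a_r_coset_def')
      then show ?thesis
        using N.a_repr_independence' c v by auto
    qed
    have "(\<Union>x\<in>N +>\<^bsub>V\<^esub> v. N +>\<^bsub>V\<^esub> (c \<odot>\<^bsub>V\<^esub> x)) = N +>\<^bsub>V\<^esub> (c \<odot>\<^bsub>V\<^esub> v)"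
      by (rule UN_constant_eq [OF N.a_rcos_self [OF v]]) (use * in blast)
    then show ?thesis by (simp add: quotient_module_def)
  qed
  show "module K ?Q"
    by (rule moduleI [OF cring_axioms ag])
       (auto dest!: eq simp: closed smult add V.smult_l_distr V.smult_r_distr V.smult_assoc1)
  show "(\<lambda>v. N +>\<^bsub>V\<^esub> v) \<in> linear_maps K V ?Q"
    by (rule linear_mapsI) (auto simp: carr add smult)
qed

lemma quotient_carrier: "carrier (quotient_module V N) = (\<lambda>v. N +>\<^bsub>V\<^esub> v) ` carrier V"
  by (auto simp: quotient_module_def A_RCOSETS_def')

context
  fixes X :: "'x set" and R :: "('x \<Rightarrow> 'k) set"
  assumes rels: "R \<subseteq> carrier (free_module K X)"
begin

abbreviation (input) "rel_module \<equiv> generated_submodule K (free_module K X) R"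

lemma presented_is_module: "module K (presented_module K X R)"
  unfolding presented_module_def
  by (rule quotient_coset_linear(1)
      [OF free_module_is_module generated_submodule_submodule [OF free_module_is_module rels]])

lemma coset_linear:
  "(\<lambda>r. rel_module +>\<^bsub>free_module K X\<^esub> r) \<in> linear_maps K (free_module K X) (presented_module K X R)"
  unfolding presented_module_def
  by (rule quotient_coset_linear(2)
      [OF free_module_is_module generated_submodule_submodule [OF free_module_is_module rels]])

lemma presented_gen_closed: "x \<in> X \<Longrightarrow> presented_gen K X R x \<in> carrier (presented_module K X R)"
  unfolding presented_gen_def by (rule linear_closed [OF coset_linear basis_vec_closed])

lemma presented_induct [consumes 1, case_names zero step]:
  assumes t: "t \<in> carrier (presented_module K X R)"
    and zero: "Q \<zero>\<^bsub>presented_module K X R\<^esub>"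
    and step: "\<And>c x t. \<lbrakk>c \<in> carrier K; x \<in> X; t \<in> carrier (presented_module K X R); Q t\<rbrakk> \<Longrightarrow>
      Q ((c \<odot>\<^bsub>presented_module K X R\<^esub> presented_gen K X R x) \<oplus>\<^bsub>presented_module K X R\<^esub> t)"
  shows "Q t"
proof -
  interpret F: module K "free_module K X" by (rule free_module_is_module)
  interpret P: module K "presented_module K X R" by (rule presented_is_module)
  let ?c = "\<lambda>r. rel_module +>\<^bsub>free_module K X\<^esub> r"
  obtain r where r: "r \<in> carrier (free_module K X)" "t = ?c r"
    using t unfolding presented_module_def quotient_carrier by auto
  have "Q (?c r)" using r(1)
  proof (induction rule: free_induct)
    case zero
    show ?case
      using linear_zero [OF F.module_axioms P.module_axioms coset_linear] assms(2)
      by (simp add: free_simps)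
  next
    case (step c x r)
    then show ?case
      using assms(3) [of c x "?c r"] coset_linear basis_vec_closed [of x X]
      by (simp add: linear_add linear_smult linear_closed presented_gen_def)
  qed
  then show ?thesis using r by simp
qed

lemma presented_linear_eq:
  assumes W: "module K W"
    and f: "f \<in> linear_maps K (presented_module K X R) W"
    and g: "g \<in> linear_maps K (presented_module K X R) W"
    and eq: "\<And>x. x \<in> X \<Longrightarrow> f (presented_gen K X R x) = g (presented_gen K X R x)"
    and t: "t \<in> carrier (presented_module K X R)"
  shows "f t = g t"
proof -
  interpret P: module K "presented_module K X R" by (rule presented_is_module)
  show ?thesis using t
  proof (induction rule: presented_induct)
    case zero
    show ?case using linear_zero [OF P.module_axioms W] f g by metis
  next
    case (step c x t)
    then show ?case using eq f g by (simp add: presented_gen_closed linear_add linear_smult)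
  qed
qed

text \<open>Once the linear extension of \<open>F\<close> kills \<open>R\<close>, it kills the
  submodule generated by \<open>R\<close> and is constant on each coset. This is what gives the
  \<open>the_elem\<close> in \<open>tlift\<close> its meaning.\<close>

lemma presented_lift:
  assumes W: "module K W" and F: "F \<in> X \<rightarrow> carrier W"
    and R0: "\<And>r. r \<in> R \<Longrightarrow> linear_extension W F r = \<zero>\<^bsub>W\<^esub>"
  shows "tlift K W F \<in> linear_maps K (presented_module K X R) W"
    and "x \<in> X \<Longrightarrow> tlift K W F (presented_gen K X R x) = F x"
proof -
  interpret F: module K "free_module K X" by (rule free_module_is_module)
  interpret W: module K W by (rule W)
  interpret P: module K "presented_module K X R" by (rule presented_is_module)
  let ?c = "\<lambda>r. rel_module +>\<^bsub>free_module K X\<^esub> r"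
  let ?L = "linear_extension W F"
  have L: "?L \<in> linear_maps K (free_module K X) W"
    by (rule linear_extension_linear [OF W F])
  have sub: "rel_module \<subseteq> {r \<in> carrier (free_module K X). ?L r = \<zero>\<^bsub>W\<^esub>}"
    by (rule generated_submodule_least [OF kernel_submodule [OF F.module_axioms W L]])
       (use rels R0 in auto)
  have N: "abelian_subgroup rel_module (free_module K X)"
    by (rule submodule_abelian_subgroup
      [OF F.module_axioms generated_submodule_submodule [OF F.module_axioms rels]])
  have lift: "tlift K W F (?c r) = ?L r" if r: "r \<in> carrier (free_module K X)" for r
  proof -
    have "?L s = ?L r" if s: "s \<in> ?c r" for s
    proof -
      obtain n where n: "n \<in> rel_module" "s = n \<oplus>\<^bsub>free_module K X\<^esub> r"
        using s by (auto simp: a_r_coset_def')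
      have "?L s = \<zero>\<^bsub>W\<^esub> \<oplus>\<^bsub>W\<^esub> ?L r"
        unfolding n(2) by (subst linear_add [OF L]) (use n r sub in auto)
      then show ?thesis using linear_closed [OF L r] by simp
    qed
    \<comment> \<open>Constancy alone would allow an empty image; a representative makes it a
      singleton.\<close>
    moreover have "r \<in> ?c r" by (rule abelian_subgroup.a_rcos_self [OF N r])
    ultimately have "?L ` ?c r = {?L r}" by blast
    moreover have "tlift K W F (?c r) = the_elem (?L ` ?c r)"
      unfolding tlift_def image_def linear_extension_def ..
    ultimately show ?thesis by simp
  qed
  have rep: "\<exists>r\<in>carrier (free_module K X). t = ?c r" if "t \<in> carrier (presented_module K X R)" for t
    using that unfolding presented_module_def quotient_carrier by auto
  show "tlift K W F \<in> linear_maps K (presented_module K X R) W"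
  proof (rule linear_mapsI)
    fix t assume "t \<in> carrier (presented_module K X R)"
    then obtain r where r: "r \<in> carrier (free_module K X)" "t = ?c r" using rep by auto
    then show "tlift K W F t \<in> carrier W" using lift linear_closed [OF L] by simp
    {
      fix u assume "u \<in> carrier (presented_module K X R)"
      then obtain s where s: "s \<in> carrier (free_module K X)" "u = ?c s" using rep by auto
      show "tlift K W F (t \<oplus>\<^bsub>presented_module K X R\<^esub> u) = tlift K W F t \<oplus>\<^bsub>W\<^esub> tlift K W F u"
        unfolding r(2) s(2) linear_add [OF coset_linear r(1) s(1), symmetric]
        using r(1) s(1) by (simp add: lift linear_add [OF L])
    }
    fix c assume c: "c \<in> carrier K"
    show "tlift K W F (c \<odot>\<^bsub>presented_module K X R\<^esub> t) = c \<odot>\<^bsub>W\<^esub> tlift K W F t"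
      unfolding r(2) linear_smult [OF coset_linear c r(1), symmetric]
      using r(1) c by (simp add: lift linear_smult [OF L])
  qed
  show "tlift K W F (presented_gen K X R x) = F x" if "x \<in> X"
    using lift [OF basis_vec_closed [OF that]] linear_extension_basis_vec [OF W F that]
    by (simp add: presented_gen_def)
qed

end

end

section \<open>Relations between generators and their linear extensions\<close>

context scalars
begin

lemma presented_rel_eq:
  assumes rels: "R \<subseteq> carrier (free_module K X)"
    and x: "x \<in> carrier (free_module K X)" and y: "y \<in> carrier (free_module K X)"
    and xy: "x \<ominus>\<^bsub>free_module K X\<^esub> y \<in> R"
  shows "generated_submodule K (free_module K X) R +>\<^bsub>free_module K X\<^esub> x =
         generated_submodule K (free_module K X) R +>\<^bsub>free_module K X\<^esub> y"
proof -
  interpret F: module K "free_module K X" by (rule free_module_is_module)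
  let ?N = "generated_submodule K (free_module K X) R"
  interpret N: abelian_subgroup ?N "free_module K X"
    by (rule submodule_abelian_subgroup
      [OF F.module_axioms generated_submodule_submodule [OF F.module_axioms rels]])
  have "x = (x \<ominus>\<^bsub>free_module K X\<^esub> y) \<oplus>\<^bsub>free_module K X\<^esub> y"
    using x y by (simp add: a_minus_def F.a_assoc F.l_neg)
  then have "x \<in> ?N +>\<^bsub>free_module K X\<^esub> y"
    using xy generated_submodule_superset [of R "free_module K X"] unfolding a_r_coset_def' by auto
  then show ?thesis
    using N.a_repr_independence' y by metis
qed

lemma linear_extension_diff_zero:
  assumes "module K W" "F \<in> X \<rightarrow> carrier W"
    "x \<in> carrier (free_module K X)" "y \<in> carrier (free_module K X)"
    "linear_extension W F x = linear_extension W F y"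
  shows "linear_extension W F (x \<ominus>\<^bsub>free_module K X\<^esub> y) = \<zero>\<^bsub>W\<^esub>"
proof -
  interpret W: module K W by fact
  note L = linear_extension_linear [OF assms(1,2)]
  show ?thesis
    using linear_diff [OF free_module_is_module assms(1) L assms(3,4)] assms(5)
      linear_closed [OF L assms(4)] by (simp add: a_minus_def W.r_neg)
qed

lemma presented_gen_add:
  assumes "R \<subseteq> carrier (free_module K X)" "x \<in> X" "y \<in> X" "z \<in> X"
    "basis_vec K x \<ominus>\<^bsub>free_module K X\<^esub> (basis_vec K y \<oplus>\<^bsub>free_module K X\<^esub> basis_vec K z) \<in> R"
  shows "presented_gen K X R x =
    presented_gen K X R y \<oplus>\<^bsub>presented_module K X R\<^esub> presented_gen K X R z"
proof -
  interpret F: module K "free_module K X" by (rule free_module_is_module)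
  show ?thesis
    unfolding presented_gen_def
      linear_add [OF coset_linear basis_vec_closed basis_vec_closed, OF assms(1,3,4), symmetric]
    by (intro presented_rel_eq assms F.a_closed basis_vec_closed)
qed

lemma presented_gen_smult:
  assumes "R \<subseteq> carrier (free_module K X)" "x \<in> X" "y \<in> X" "c \<in> carrier K"
    "basis_vec K x \<ominus>\<^bsub>free_module K X\<^esub> c \<odot>\<^bsub>free_module K X\<^esub> basis_vec K y \<in> R"
  shows "presented_gen K X R x = c \<odot>\<^bsub>presented_module K X R\<^esub> presented_gen K X R y"
proof -
  interpret F: module K "free_module K X" by (rule free_module_is_module)
  show ?thesis
    unfolding presented_gen_def
      linear_smult [OF coset_linear _ basis_vec_closed, OF assms(1,4,3), symmetric]
    by (intro presented_rel_eq assms F.smult_closed basis_vec_closed)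
qed

lemma presented_gen_eq:
  assumes "R \<subseteq> carrier (free_module K X)" "x \<in> X" "y \<in> X"
    "basis_vec K x \<ominus>\<^bsub>free_module K X\<^esub> basis_vec K y \<in> R"
  shows "presented_gen K X R x = presented_gen K X R y"
  unfolding presented_gen_def by (intro presented_rel_eq assms basis_vec_closed)

lemma linear_extension_add_rel:
  assumes "module K W" "F \<in> X \<rightarrow> carrier W" "x \<in> X" "y \<in> X" "z \<in> X" "F x = F y \<oplus>\<^bsub>W\<^esub> F z"
  shows "linear_extension W F (basis_vec K x \<ominus>\<^bsub>free_module K X\<^esub>
    (basis_vec K y \<oplus>\<^bsub>free_module K X\<^esub> basis_vec K z)) = \<zero>\<^bsub>W\<^esub>"
proof -
  interpret F: module K "free_module K X" by (rule free_module_is_module)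
  show ?thesis
    by (intro linear_extension_diff_zero assms F.a_closed basis_vec_closed)
       (simp add: linear_add [OF linear_extension_linear [OF assms(1,2)]] basis_vec_closed
          linear_extension_basis_vec [OF assms(1,2)] assms)
qed

lemma linear_extension_smult_rel:
  assumes "module K W" "F \<in> X \<rightarrow> carrier W" "x \<in> X" "y \<in> X" "c \<in> carrier K" "F x = c \<odot>\<^bsub>W\<^esub> F y"
  shows "linear_extension W F (basis_vec K x \<ominus>\<^bsub>free_module K X\<^esub>
    c \<odot>\<^bsub>free_module K X\<^esub> basis_vec K y) = \<zero>\<^bsub>W\<^esub>"
proof -
  interpret F: module K "free_module K X" by (rule free_module_is_module)
  show ?thesis
    by (intro linear_extension_diff_zero assms F.smult_closed basis_vec_closed)
       (simp add: linear_smult [OF linear_extension_linear [OF assms(1,2)]] basis_vec_closed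
          linear_extension_basis_vec [OF assms(1,2)] assms)
qed

lemma linear_extension_eq_rel:
  assumes "module K W" "F \<in> X \<rightarrow> carrier W" "x \<in> X" "y \<in> X" "F x = F y"
  shows "linear_extension W F (basis_vec K x \<ominus>\<^bsub>free_module K X\<^esub> basis_vec K y) = \<zero>\<^bsub>W\<^esub>"
  by (intro linear_extension_diff_zero assms basis_vec_closed)
     (simp add: linear_extension_basis_vec [OF assms(1,2)] assms)

section \<open>Tensor products\<close>

definition bilin where
  "bilin V W U F \<longleftrightarrow>
     (\<forall>w\<in>carrier W. (\<lambda>v. F v w) \<in> linear_maps K V U) \<and>
     (\<forall>v\<in>carrier V. (\<lambda>w. F v w) \<in> linear_maps K W U)"

lemma bilinI:
  "\<lbrakk>\<And>w. w \<in> carrier W \<Longrightarrow> (\<lambda>v. F v w) \<in> linear_maps K V U;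
    \<And>v. v \<in> carrier V \<Longrightarrow> (\<lambda>w. F v w) \<in> linear_maps K W U\<rbrakk> \<Longrightarrow> bilin V W U F"
  by (simp add: bilin_def)

lemma bilin_left: "\<lbrakk>bilin V W U F; w \<in> carrier W\<rbrakk> \<Longrightarrow> (\<lambda>v. F v w) \<in> linear_maps K V U"
  by (simp add: bilin_def)

lemma bilin_right: "\<lbrakk>bilin V W U F; v \<in> carrier V\<rbrakk> \<Longrightarrow> (\<lambda>w. F v w) \<in> linear_maps K W U"
  by (simp add: bilin_def)

lemma bilin_closed: "\<lbrakk>bilin V W U F; v \<in> carrier V; w \<in> carrier W\<rbrakk> \<Longrightarrow> F v w \<in> carrier U"
  by (blast dest: bilin_left linear_closed)

context
  fixes V :: "('k, 'v) module" and W :: "('k, 'w) module"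
  assumes V: "module K V" and W: "module K W"
begin

abbreviation (input) "F2 \<equiv> free_module K (carrier V \<times> carrier W)"

lemma bilinear_rels_closed: "bilinear_rels K V W \<subseteq> carrier F2"
proof -
  interpret V: module K V by (rule V)
  interpret W: module K W by (rule W)
  interpret F: module K F2 by (rule free_module_is_module)
  show ?thesis
    by (auto simp: bilinear_rels_def Let_def intro!: F.minus_closed basis_vec_closed F.a_closed
        F.smult_closed)
qed

context
  fixes R
  assumes bil: "bilinear_rels K V W \<subseteq> R" and R: "R \<subseteq> carrier F2"
begin

abbreviation (input) "P2 \<equiv> presented_module K (carrier V \<times> carrier W) R"
abbreviation (input) "g2 v w \<equiv> presented_gen K (carrier V \<times> carrier W) R (v, w)"

text \<open>\<open>R\<close> is any set of relations containing the bilinear ones, so the same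
  argument serves the tensor product over \<open>K\<close> and the one over
  \<open>H\<close>.\<close>

lemma gen_bilin: "bilin V W P2 g2"
proof -
  interpret V: module K V by (rule V)
  interpret W: module K W by (rule W)
  interpret F: module K F2 by (rule free_module_is_module)
  show ?thesis
  proof (rule bilinI; rule linear_mapsI)
    fix v v' w assume "w \<in> carrier W" "v \<in> carrier V" "v' \<in> carrier V"
    then show "g2 (v \<oplus>\<^bsub>V\<^esub> v') w = g2 v w \<oplus>\<^bsub>P2\<^esub> g2 v' w"
      by (intro presented_gen_add [OF R] subsetD [OF bil]) (auto simp: bilinear_rels_def Let_def)
  next
    fix v w w' assume "v \<in> carrier V" "w \<in> carrier W" "w' \<in> carrier W"
    then show "g2 v (w \<oplus>\<^bsub>W\<^esub> w') = g2 v w \<oplus>\<^bsub>P2\<^esub> g2 v w'"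
      by (intro presented_gen_add [OF R] subsetD [OF bil]) (auto simp: bilinear_rels_def Let_def)
  next
    fix k v w assume "w \<in> carrier W" "k \<in> carrier K" "v \<in> carrier V"
    then show "g2 (k \<odot>\<^bsub>V\<^esub> v) w = k \<odot>\<^bsub>P2\<^esub> g2 v w"
      by (intro presented_gen_smult [OF R] subsetD [OF bil]) (auto simp: bilinear_rels_def Let_def)
  next
    fix k v w assume "v \<in> carrier V" "k \<in> carrier K" "w \<in> carrier W"
    then show "g2 v (k \<odot>\<^bsub>W\<^esub> w) = k \<odot>\<^bsub>P2\<^esub> g2 v w"
      by (intro presented_gen_smult [OF R] subsetD [OF bil]) (auto simp: bilinear_rels_def Let_def)
  qed (auto intro: presented_gen_closed [OF R])
qed

text \<open>Bilinearity of \<open>F\<close> disposes of the bilinear relations, so \<open>R0\<close>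
  asks only about the additional ones: none over \<open>K\<close>, the balancing relations over
  \<open>H\<close>.\<close>

lemma gen_lift:
  assumes U: "module K U" and F: "bilin V W U F"
    and R0: "\<And>r. r \<in> R - bilinear_rels K V W \<Longrightarrow> linear_extension U (\<lambda>(v, w). F v w) r = \<zero>\<^bsub>U\<^esub>"
  shows "tlift K U (\<lambda>(v, w). F v w) \<in> linear_maps K P2 U" (is "?L \<in> _")
    and "\<lbrakk>v \<in> carrier V; w \<in> carrier W\<rbrakk> \<Longrightarrow> tlift K U (\<lambda>(v, w). F v w) (g2 v w) = F v w"
proof -
  interpret V: module K V by (rule V)
  interpret W: module K W by (rule W)
  interpret F: module K F2 by (rule free_module_is_module)
  interpret U: module K U by (rule U)
  have FC: "(\<lambda>(v, w). F v w) \<in> carrier V \<times> carrier W \<rightarrow> carrier U"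
    using bilin_closed [OF F] by auto
  have "linear_extension U (\<lambda>(v, w). F v w) r = \<zero>\<^bsub>U\<^esub>" if "r \<in> bilinear_rels K V W" for r
    using that unfolding bilinear_rels_def Let_def
    by (auto intro!: linear_extension_add_rel [OF U FC] linear_extension_smult_rel [OF U FC]
        intro: linear_add [OF bilin_left [OF F]] linear_add [OF bilin_right [OF F]]
          linear_smult [OF bilin_left [OF F]] linear_smult [OF bilin_right [OF F]])
  then have "linear_extension U (\<lambda>(v, w). F v w) r = \<zero>\<^bsub>U\<^esub>" if "r \<in> R" for r
    using R0 that by blast
  note L = presented_lift [OF R U FC this]
  show "?L \<in> linear_maps K P2 U" by (rule L(1))
  show "\<lbrakk>v \<in> carrier V; w \<in> carrier W\<rbrakk> \<Longrightarrow> ?L (g2 v w) = F v w"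
    using L(2) [of "(v, w)"] by auto
qed

text \<open>A scalar coefficient can be absorbed into the left factor, so a list of pairs without
  coefficients suffices.\<close>

lemma gen_sum:
  assumes "t \<in> carrier P2"
  shows "\<exists>xs. set xs \<subseteq> carrier V \<times> carrier W \<and> t = lsum P2 (\<lambda>(v, w). g2 v w) xs"
  using assms
proof (induction rule: presented_induct [OF R, consumes 1, case_names zero step])
  case zero
  show ?case by (intro exI [of _ "[]"]) auto
next
  case (step c x t)
  interpret V: module K V by (rule V)
  obtain v w where x: "x = (v, w)" "v \<in> carrier V" "w \<in> carrier W" using step by auto
  obtain xs where xs: "set xs \<subseteq> carrier V \<times> carrier W" "t = lsum P2 (\<lambda>(v, w). g2 v w) xs"
    using step by auto
  show ?case
    using x xs step(1) linear_smult [OF bilin_left [OF gen_bilin x(3)] step(1) x(2)]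
    by (intro exI [of _ "(c \<odot>\<^bsub>V\<^esub> v, w) # xs"]) auto
qed

end

lemma tensor_module: "module K (tensor K V W)"
  unfolding tensor_def by (rule presented_is_module [OF bilinear_rels_closed])

lemma tens_bilin: "bilin V W (tensor K V W) (tens K V W)"
  unfolding tensor_def tens_def by (rule gen_bilin [OF subset_refl bilinear_rels_closed])

lemma tensor_lift:
  assumes "module K U" "bilin V W U F"
  shows "tlift K U (\<lambda>(v, w). F v w) \<in> linear_maps K (tensor K V W) U"
    and "\<lbrakk>v \<in> carrier V; w \<in> carrier W\<rbrakk> \<Longrightarrow> tlift K U (\<lambda>(v, w). F v w) (tens K V W v w) = F v w"
  unfolding tensor_def tens_def
  using gen_lift [OF subset_refl bilinear_rels_closed assms] by auto

lemma tensor_sum: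
  assumes "t \<in> carrier (tensor K V W)"
  shows "\<exists>xs. set xs \<subseteq> carrier V \<times> carrier W \<and> t = lsum (tensor K V W) (\<lambda>(v, w). tens K V W v w) xs"
  using gen_sum [OF subset_refl bilinear_rels_closed] assms unfolding tensor_def tens_def by auto

lemma tens_closed: "\<lbrakk>v \<in> carrier V; w \<in> carrier W\<rbrakk> \<Longrightarrow> tens K V W v w \<in> carrier (tensor K V W)"
  by (rule bilin_closed [OF tens_bilin])

text \<open>The bridge from \<open>tlift\<close> to list sums: bilinearity is spent here, and any
  decomposition of the tensor gives the same value.\<close>

lemma tensor_lift_lsum:
  assumes "module K U" "bilin V W U F" "set xs \<subseteq> carrier V \<times> carrier W"
  shows "tlift K U (\<lambda>(v, w). F v w) (lsum (tensor K V W) (\<lambda>(v, w). tens K V W v w) xs) =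
    lsum U (\<lambda>(v, w). F v w) xs"
proof -
  have "tlift K U (\<lambda>(v, w). F v w) (lsum (tensor K V W) (\<lambda>(v, w). tens K V W v w) xs) =
    lsum U (\<lambda>x. tlift K U (\<lambda>(v, w). F v w) (case x of (v, w) \<Rightarrow> tens K V W v w)) xs"
    using assms(3)
    by (intro linear_lsum [OF tensor_module assms(1) tensor_lift(1) [OF assms(1,2)]])
       (auto simp: tens_closed)
  also have "\<dots> = lsum U (\<lambda>(v, w). F v w) xs"
    using assms(3) tensor_lift(2) [OF assms(1,2)] by (intro lsum_cong) auto
  finally show ?thesis .
qed

end

section \<open>Multilinear functions of lists\<close>

text \<open>Slots are described by splittings \<open>xs @ v # ys\<close> instead of list updates,
  which fits the operators: they insert, delete and move entries. The first clause is the only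
  content for \<open>n = 0\<close>, where no slot exists.\<close>

definition multilin where
  "multilin V W n F \<longleftrightarrow> (\<forall>l\<in>words V n. F l \<in> carrier W) \<and>
     (\<forall>xs ys. set xs \<subseteq> carrier V \<longrightarrow> set ys \<subseteq> carrier V \<longrightarrow> length xs + length ys + 1 = n \<longrightarrow>
        (\<lambda>v. F (xs @ v # ys)) \<in> linear_maps K V W)"

lemma multilinI:
  assumes "n = 0 \<Longrightarrow> F [] \<in> carrier W"
    "\<And>xs ys. \<lbrakk>set xs \<subseteq> carrier V; set ys \<subseteq> carrier V; length xs + length ys + 1 = n\<rbrakk> \<Longrightarrow>
        (\<lambda>v. F (xs @ v # ys)) \<in> linear_maps K V W"
  shows "multilin V W n F"
  unfolding multilin_def
proof (intro conjI ballI allI impI)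
  fix l assume l: "l \<in> words V n"
  show "F l \<in> carrier W"
  proof (cases l)
    case Nil
    then show ?thesis using assms(1) l by (simp add: words_def)
  next
    case (Cons a l')
    then show ?thesis
      using linear_closed [OF assms(2) [of "[]" l'], of a] l by (auto simp: words_def)
  qed
qed (rule assms(2))

lemma multilin_closed: "\<lbrakk>multilin V W n F; length l = n; set l \<subseteq> carrier V\<rbrakk> \<Longrightarrow> F l \<in> carrier W"
  by (simp add: multilin_def words_def)

lemma multilin_slot:
  "\<lbrakk>multilin V W n F; set xs \<subseteq> carrier V; set ys \<subseteq> carrier V; length xs + length ys + 1 = n\<rbrakk> \<Longrightarrow>
   (\<lambda>v. F (xs @ v # ys)) \<in> linear_maps K V W"
  by (simp add: multilin_def)

text \<open>Freezing the outer entries is how statements about a block of entries are applied inside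
  a longer word.\<close>

lemma multilin_context:
  assumes F: "multilin V W n F" and "set xs \<subseteq> carrier V" "set ys \<subseteq> carrier V"
    "length xs + p + length ys = n"
  shows "multilin V W p (\<lambda>l. F (xs @ l @ ys))"
proof (rule multilinI)
  fix xs' ys' assume "set xs' \<subseteq> carrier V" "set ys' \<subseteq> carrier V" "length xs' + length ys' + 1 = p"
  then show "(\<lambda>v. F (xs @ (xs' @ v # ys') @ ys)) \<in> linear_maps K V W"
    using multilin_slot [OF F, of "xs @ xs'" "ys' @ ys"] assms by simp
qed (use multilin_closed [OF F, of "xs @ ys"] assms in auto)

lemma multilin_comp:
  assumes F: "multilin V W n F" and f: "f \<in> linear_maps K W U"
  shows "multilin V U n (\<lambda>l. f (F l))"
  by (intro multilinI linear_closed [OF f] linear_comp [OF multilin_slot [OF F] f]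
      multilin_closed [OF F]) auto

lemma multilin_lsum:
  assumes "module K W" "\<And>x. x \<in> set xs \<Longrightarrow> multilin V W n (F x)"
  shows "multilin V W n (\<lambda>l. lsum W (\<lambda>x. F x l) xs)"
  by (rule multilinI)
     (auto intro!: lsum_closed linear_lsum_pointwise assms(1)
        intro: multilin_closed [OF assms(2)] multilin_slot [OF assms(2)])

context
  fixes V :: "('k, 'v) module" and n :: nat
  assumes V: "module K V"
begin

abbreviation (input) "Fw \<equiv> free_module K (words V n)"

lemma words_update: "\<lbrakk>l \<in> words V n; v \<in> carrier V\<rbrakk> \<Longrightarrow> l[i := v] \<in> words V n"
  using set_update_subset_insert [of l i v] by (auto simp: words_def)

lemma multilinear_rels_cases:
  assumes "r \<in> multilinear_rels K V n"
  obtains (add) l i v w where "l \<in> words V n" "i < n" "v \<in> carrier V" "w \<in> carrier V"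
      "r = basis_vec K (l[i := v \<oplus>\<^bsub>V\<^esub> w]) \<ominus>\<^bsub>Fw\<^esub>
        (basis_vec K (l[i := v]) \<oplus>\<^bsub>Fw\<^esub> basis_vec K (l[i := w]))"
    | (smult) l i c v where "l \<in> words V n" "i < n" "c \<in> carrier K" "v \<in> carrier V"
      "r = basis_vec K (l[i := c \<odot>\<^bsub>V\<^esub> v]) \<ominus>\<^bsub>Fw\<^esub> c \<odot>\<^bsub>Fw\<^esub> basis_vec K (l[i := v])"
  using assms unfolding multilinear_rels_def Let_def by blast

lemma multilinear_rels_closed: "multilinear_rels K V n \<subseteq> carrier Fw"
proof -
  interpret V: module K V by (rule V)
  interpret F: module K Fw by (rule free_module_is_module)
  show ?thesis
  proof
    fix r assume "r \<in> multilinear_rels K V n"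
    then show "r \<in> carrier Fw"
      by (cases rule: multilinear_rels_cases)
         (simp_all add: F.minus_closed basis_vec_closed words_update)
  qed
qed

lemma tensor_power_module: "module K (tensor_power K V n)"
  unfolding tensor_power_def by (rule presented_is_module [OF multilinear_rels_closed])

lemma pure_multilin: "multilin V (tensor_power K V n) n (pure K V)"
proof -
  interpret V: module K V by (rule V)
  interpret F: module K Fw by (rule free_module_is_module)
  note R = multilinear_rels_closed
  let ?T = "tensor_power K V n"
  have p: "pure K V l = presented_gen K (words V n) (multilinear_rels K V n) l"
    if "length l = n" for l
    using that by (simp add: pure_def)
  have closed': "pure K V l \<in> carrier ?T" if "l \<in> words V n" for l
    unfolding tensor_power_def using that presented_gen_closed [OF R that]
    by (simp add: p words_def)
  show ?thesis
  proof (rule multilinI)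
    show "pure K V [] \<in> carrier ?T" if "n = 0"
      using that by (intro closed') (simp add: words_def)
  next
    fix xs ys assume l: "set xs \<subseteq> carrier V" "set ys \<subseteq> carrier V" "length xs + length ys + 1 = n"
    have w: "xs @ v # ys \<in> words V n" if "v \<in> carrier V" for v
      using l that by (simp add: words_def)
    \<comment> \<open>The relations are phrased by list updates; updating at position
      \<open>length xs\<close> translates them to splittings.\<close>
    have upd: "(xs @ u # ys)[length xs := v] = xs @ v # ys" for u v
      by simp
    show "(\<lambda>v. pure K V (xs @ v # ys)) \<in> linear_maps K V ?T"
    proof (rule linear_mapsI)
      fix u v assume uv: "u \<in> carrier V" "v \<in> carrier V"
      have "basis_vec K ((xs @ u # ys)[length xs := u \<oplus>\<^bsub>V\<^esub> v]) \<ominus>\<^bsub>Fw\<^esub>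
        (basis_vec K ((xs @ u # ys)[length xs := u]) \<oplus>\<^bsub>Fw\<^esub> basis_vec K ((xs @ u # ys)[length xs := v]))
        \<in> multilinear_rels K V n"
        unfolding multilinear_rels_def Let_def
        by (rule UnI1, rule CollectI, intro exI conjI, rule refl) (use w uv l(3) in auto)
      note r = this [unfolded upd]
      show "pure K V (xs @ (u \<oplus>\<^bsub>V\<^esub> v) # ys) = pure K V (xs @ u # ys) \<oplus>\<^bsub>?T\<^esub> pure K V (xs @ v # ys)"
        using presented_gen_add [OF R _ _ _ r] l(3) uv w by (simp add: tensor_power_def p)
    next
      fix k v assume kv: "k \<in> carrier K" "v \<in> carrier V"
      have "basis_vec K ((xs @ v # ys)[length xs := k \<odot>\<^bsub>V\<^esub> v]) \<ominus>\<^bsub>Fw\<^esub>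
        (k \<odot>\<^bsub>Fw\<^esub> basis_vec K ((xs @ v # ys)[length xs := v]))
        \<in> multilinear_rels K V n"
        unfolding multilinear_rels_def Let_def
        by (rule UnI2, rule CollectI, intro exI conjI, rule refl) (use w kv l(3) in auto)
      note r = this [unfolded upd]
      show "pure K V (xs @ (k \<odot>\<^bsub>V\<^esub> v) # ys) = k \<odot>\<^bsub>?T\<^esub> pure K V (xs @ v # ys)"
        using presented_gen_smult [OF R _ _ kv(1) r] l(3) kv w by (simp add: tensor_power_def p)
    qed (simp add: closed' w)
  qed
qed

lemma pure_closed: "l \<in> words V n \<Longrightarrow> pure K V l \<in> carrier (tensor_power K V n)"
  using pure_multilin by (simp add: multilin_def)

lemma tensor_power_lift:
  assumes U: "module K U" and F: "multilin V U n F"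
  shows "tlift K U F \<in> linear_maps K (tensor_power K V n) U"
    and "l \<in> words V n \<Longrightarrow> tlift K U F (pure K V l) = F l"
proof -
  interpret V: module K V by (rule V)
  interpret F: module K Fw by (rule free_module_is_module)
  interpret U: module K U by (rule U)
  have FC: "F \<in> words V n \<rightarrow> carrier U"
    using F by (auto simp: multilin_def)
  \<comment> \<open>The converse translation, from splittings to the list updates in the
    relations.\<close>
  have upd: "(\<lambda>v. F (l[i := v])) \<in> linear_maps K V U" if "l \<in> words V n" "i < n" for l i
  proof -
    have "(\<lambda>v. F (take i l @ v # drop (Suc i) l)) \<in> linear_maps K V U"
      using that by (intro multilin_slot [OF F]) (auto simp: words_def dest: in_set_takeD in_set_dropD)
    then show ?thesis using that by (simp add: words_def upd_conv_take_nth_drop)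
  qed
  have "linear_extension U F r = \<zero>\<^bsub>U\<^esub>" if "r \<in> multilinear_rels K V n" for r
    using that
  proof (cases rule: multilinear_rels_cases)
    case (add l i v w)
    then show ?thesis
      by (auto intro!: linear_extension_add_rel [OF U FC] words_update linear_add [OF upd])
  next
    case (smult l i c v)
    then show ?thesis
      by (auto intro!: linear_extension_smult_rel [OF U FC] words_update linear_smult [OF upd])
  qed
  note L = presented_lift [OF multilinear_rels_closed U FC this]
  show "tlift K U F \<in> linear_maps K (tensor_power K V n) U"
    unfolding tensor_power_def by (rule L(1))
  show "l \<in> words V n \<Longrightarrow> tlift K U F (pure K V l) = F l"
    using L(2) [of l] by (simp add: pure_def words_def)
qed

lemma tensor_power_linear_eq:
  assumes "module K U" "f \<in> linear_maps K (tensor_power K V n) U" "g \<in> linear_maps K (tensor_power K V n) U"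
    "\<And>l. l \<in> words V n \<Longrightarrow> f (pure K V l) = g (pure K V l)" "t \<in> carrier (tensor_power K V n)"
  shows "f t = g t"
  by (rule presented_linear_eq [OF multilinear_rels_closed assms(1-3)[unfolded tensor_power_def]])
     (use assms(4,5) in \<open>auto simp: pure_def words_def tensor_power_def\<close>)

end

end

section \<open>Lifts from triple tensor products and substitution into words\<close>

context scalars
begin

lemma bilin_cong:
  assumes "module K V" "module K W" "bilin V W U F"
    "\<And>v w. \<lbrakk>v \<in> carrier V; w \<in> carrier W\<rbrakk> \<Longrightarrow> F v w = G v w"
  shows "bilin V W U G"
  by (rule bilinI)
     (auto intro: linear_cong [OF assms(1) bilin_left [OF assms(3)]]
        linear_cong [OF assms(2) bilin_right [OF assms(3)]] assms(4))

lemma multilin_cong: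
  assumes "module K V" "multilin V W n F" "\<And>l. \<lbrakk>length l = n; set l \<subseteq> carrier V\<rbrakk> \<Longrightarrow> F l = G l"
  shows "multilin V W n G"
proof (rule multilinI)
  show "G [] \<in> carrier W" if "n = 0"
    using multilin_closed [OF assms(2), of "[]"] assms(3) [of "[]"] that by simp
  show "(\<lambda>v. G (xs @ v # ys)) \<in> linear_maps K V W"
    if "set xs \<subseteq> carrier V" "set ys \<subseteq> carrier V" "length xs + length ys + 1 = n" for xs ys
    by (rule linear_cong [OF assms(1) multilin_slot [OF assms(2) that]], rule assms(3))
       (use that in simp_all)
qed

lemma lsum_map: "lsum W f (map g xs) = lsum W (\<lambda>x. f (g x)) xs"
  by (induction xs) auto

lemma lsum_concat:
  assumes "module K W" "\<And>ys y. \<lbrakk>ys \<in> set xss; y \<in> set ys\<rbrakk> \<Longrightarrow> f y \<in> carrier W"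
  shows "lsum W f (concat xss) = lsum W (lsum W f) xss"
  using assms(2)
proof (induction xss)
  case (Cons ys xss)
  have "lsum W f (concat (ys # xss)) = lsum W f ys \<oplus>\<^bsub>W\<^esub> lsum W f (concat xss)"
    unfolding concat.simps by (rule lsum_append [OF assms(1)]) (use Cons.prems in auto)
  moreover have "lsum W f (concat xss) = lsum W (lsum W f) xss"
    by (rule Cons.IH) (use Cons.prems in auto)
  ultimately show ?case by simp
qed simp

lemma lsum_single:
  assumes "module K W" "f x \<in> carrier W"
  shows "lsum W f [x] = f x"
proof -
  interpret W: module K W by fact
  show ?thesis using assms by simp
qed

definition trilin where
  "trilin A B C W G \<longleftrightarrow> (\<forall>c\<in>carrier C. bilin A B W (\<lambda>a b. G a b c)) \<and>
     (\<forall>a\<in>carrier A. \<forall>b\<in>carrier B. G a b \<in> linear_maps K C W)"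

text \<open>The source is left-nested because coassociativity is stated in such a module. The first
  two arguments of \<open>G\<close> are lifted for each fixed \<open>c\<close>, then the result is
  lifted in the remaining pair.\<close>

lemma triple_tensor_lift:
  assumes A: "module K A" and B: "module K B" and C: "module K C" and W: "module K W"
    and G: "trilin A B C W G"
  defines "L \<equiv> tlift K W (\<lambda>(t, c). tlift K W (\<lambda>(a, b). G a b c) t)"
  shows "L \<in> linear_maps K (tensor K (tensor K A B) C) W"
    and "\<lbrakk>t \<in> carrier (tensor K A B); c \<in> carrier C\<rbrakk> \<Longrightarrow>
      L (tens K (tensor K A B) C t c) = tlift K W (\<lambda>(a, b). G a b c) t"
proof -
  have bil: "bilin A B W (\<lambda>a b. G a b c)" if "c \<in> carrier C" for c
    using G that by (simp add: trilin_def)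
  have "bilin (tensor K A B) C W (\<lambda>t c. tlift K W (\<lambda>(a, b). G a b c) t)"
  proof (rule bilinI)
    show "tlift K W (\<lambda>(a, b). G a b c) \<in> linear_maps K (tensor K A B) W" if "c \<in> carrier C" for c
      by (rule tensor_lift(1) [OF A B W bil [OF that]])
  next
    fix t assume "t \<in> carrier (tensor K A B)"
    then obtain xs where xs: "set xs \<subseteq> carrier A \<times> carrier B"
      "t = lsum (tensor K A B) (\<lambda>(a, b). tens K A B a b) xs"
      using tensor_sum [OF A B] by blast
    \<comment> \<open>For a general \<open>t\<close>, linearity in \<open>c\<close> is not visible
      from \<open>tlift\<close>; on a decomposition of \<open>t\<close>, fixed while
      \<open>c\<close> varies, it is a finite sum of linear maps.\<close>
    have "(\<lambda>c. lsum W (\<lambda>(a, b). G a b c) xs) \<in> linear_maps K C W"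
      using G xs(1) by (intro linear_lsum_pointwise [OF W]) (auto simp: trilin_def)
    then show "(\<lambda>c. tlift K W (\<lambda>(a, b). G a b c) t) \<in> linear_maps K C W"
      by (rule linear_cong [OF C])
         (simp add: xs(2) tensor_lift_lsum [OF A B W bil xs(1)])
  qed
  note L = tensor_lift [OF tensor_module [OF A B] C W this]
  show "L \<in> linear_maps K (tensor K (tensor K A B) C) W"
    unfolding L_def by (rule L(1))
  show "\<lbrakk>t \<in> carrier (tensor K A B); c \<in> carrier C\<rbrakk> \<Longrightarrow>
      L (tens K (tensor K A B) C t c) = tlift K W (\<lambda>(a, b). G a b c) t"
    unfolding L_def by (rule L(2))
qed

text \<open>\<open>\<Phi> G x\<close> is a combination of values of \<open>G\<close> on lists of length \<open>p\<close> that depends linearly on \<open>x\<close>: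
  a Sweedler sum, or for \<open>p = 0\<close> the deletion of an entry weighted by the counit.\<close>

lemma multilin_subst:
  assumes V: "module K V" and F: "multilin V W (n + p) F" and i: "i \<le> n"
    and \<Phi>: "\<And>G. multilin V W p G \<Longrightarrow> \<Phi> G \<in> linear_maps K V W"
    and \<Phi>': "\<And>G x. \<lbrakk>\<And>l. \<lbrakk>length l = p; set l \<subseteq> carrier V\<rbrakk> \<Longrightarrow> (\<lambda>v. G v l) \<in> linear_maps K V W;
      x \<in> carrier V\<rbrakk> \<Longrightarrow> (\<lambda>v. \<Phi> (G v) x) \<in> linear_maps K V W"
  shows "multilin V W (Suc n) (\<lambda>l. \<Phi> (\<lambda>k. F (take i l @ k @ drop (Suc i) l)) (l ! i))"
proof (rule multilinI)
  fix xs ys assume l: "set xs \<subseteq> carrier V" "set ys \<subseteq> carrier V" "length xs + length ys + 1 = Suc n"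
  let ?F = "\<lambda>l. \<Phi> (\<lambda>k. F (take i l @ k @ drop (Suc i) l)) (l ! i)"
  \<comment> \<open>The varying entry lies to the right of the substituted one, coincides with it,
    or lies to its left. Linearity of \<open>\<Phi> G\<close> enters only in the middle case;
    otherwise the dependence is through \<open>G\<close>.\<close>
  consider "i < length xs" | "i = length xs" | "length xs < i" by linarith
  then show "(\<lambda>v. ?F (xs @ v # ys)) \<in> linear_maps K V W"
  proof cases
    case 1
    then obtain q x r where x: "xs = q @ x # r" "length q = i"
      using id_take_nth_drop by force
    have "(\<lambda>v. \<Phi> (\<lambda>k. F (q @ k @ r @ v # ys)) x) \<in> linear_maps K V W"
    proof (rule \<Phi>')
      show "(\<lambda>v. F (q @ k @ r @ v # ys)) \<in> linear_maps K V W"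
        if "length k = p" "set k \<subseteq> carrier V" for k
        using multilin_slot [OF F, of "q @ k @ r" ys] l x that by simp
    qed (use l x in simp)
    then show ?thesis using x by (simp add: nth_append)
  next
    case 2
    have "\<Phi> (\<lambda>k. F (xs @ k @ ys)) \<in> linear_maps K V W"
      by (rule \<Phi>, rule multilin_context [OF F]) (use l in auto)
    then show ?thesis using 2 by simp
  next
    case 3
    then obtain j where j: "i = Suc (length xs + j)" using less_imp_Suc_add by blast
    then obtain q x r where x: "ys = q @ x # r" "length q = j"
      using id_take_nth_drop [of j ys] i l by force
    have "(\<lambda>v. \<Phi> (\<lambda>k. F (xs @ v # q @ k @ r)) x) \<in> linear_maps K V W"
    proof (rule \<Phi>')
      show "(\<lambda>v. F (xs @ v # q @ k @ r)) \<in> linear_maps K V W"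
        if "length k = p" "set k \<subseteq> carrier V" for k
        using multilin_slot [OF F, of xs "q @ k @ r"] l x that by simp
    qed (use l x in simp)
    then show ?thesis using x j by (simp add: nth_append)
  qed
qed simp

end

sublocale hopf_algebra \<subseteq> scalars K
  by unfold_locales

context hopf_algebra
begin

section \<open>Sweedler sums\<close>

abbreviation (input) hmult (infixl "\<cdot>" 70) where "hmult \<equiv> mult H"

lemma H_module: "module K H"
  by unfold_locales

text \<open>A fixed decomposition of \<open>\<Delta> h\<close> into pure tensors: Sweedler sums become list sums, which commute
  with linear maps and with each other without any multilinearity condition.\<close>

definition cop :: "'h \<Rightarrow> ('h \<times> 'h) list" where
  "cop h = (SOME xs. set xs \<subseteq> carrier H \<times> carrier H \<and>
     \<Delta> h = lsum (tensor K H H) (\<lambda>(a, b). tens K H H a b) xs)"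

lemma cop:
  assumes "h \<in> carrier H"
  shows "set (cop h) \<subseteq> carrier H \<times> carrier H"
    and "\<Delta> h = lsum (tensor K H H) (\<lambda>(a, b). tens K H H a b) (cop h)"
proof -
  have "\<Delta> h \<in> carrier (tensor K H H)"
    by (rule linear_closed [OF comult_linear assms])
  note someI_ex [OF tensor_sum [OF H_module H_module this], folded cop_def]
  then show "set (cop h) \<subseteq> carrier H \<times> carrier H"
    "\<Delta> h = lsum (tensor K H H) (\<lambda>(a, b). tens K H H a b) (cop h)" by blast+
qed

lemma cop_closed:
  assumes "h \<in> carrier H" "(a, b) \<in> set (cop h)"
  shows "a \<in> carrier H" "b \<in> carrier H"
  using cop(1) [OF assms(1)] assms(2) by auto

lemma sweedler:
  assumes "module K W" "bilin H H W F" "h \<in> carrier H"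
  shows "tlift K W (\<lambda>(a, b). F a b) (\<Delta> h) = lsum W (\<lambda>(a, b). F a b) (cop h)"
  using tensor_lift_lsum [OF H_module H_module assms(1,2) cop(1)] cop(2) assms(3) by simp

text \<open>The choice \<open>cop\<close> is not additive in \<open>h\<close>, so linearity is
  obtained from that of \<open>\<Delta>\<close> and of the lifted map.\<close>

lemma sweedler_linear:
  assumes "module K W" "bilin H H W F"
  shows "(\<lambda>h. lsum W (\<lambda>(a, b). F a b) (cop h)) \<in> linear_maps K H W"
  by (rule linear_cong [OF H_module
        linear_comp [OF comult_linear tensor_lift(1) [OF H_module H_module assms]]])
     (rule sweedler [OF assms])

lemma sweedler_closed:
  assumes "module K W" "h \<in> carrier H"
    "\<And>a b. \<lbrakk>a \<in> carrier H; b \<in> carrier H\<rbrakk> \<Longrightarrow> F a b \<in> carrier W"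
  shows "lsum W (\<lambda>(a, b). F a b) (cop h) \<in> carrier W"
  using cop(1) [OF assms(2)] by (intro lsum_closed [OF assms(1)]) (auto intro: assms(3))

lemma sweedler_cong:
  assumes "h \<in> carrier H" "\<And>a b. \<lbrakk>a \<in> carrier H; b \<in> carrier H\<rbrakk> \<Longrightarrow> F a b = G a b"
  shows "lsum W (\<lambda>(a, b). F a b) (cop h) = lsum W (\<lambda>(a, b). G a b) (cop h)"
  using cop(1) [OF assms(1)] by (intro lsum_cong) (auto intro: assms(2))

lemma counit_closed: "h \<in> carrier H \<Longrightarrow> \<epsilon> h \<in> carrier K"
  using counit_hom by (auto simp: ring_hom_def)

lemma counit_mult: "\<lbrakk>g \<in> carrier H; h \<in> carrier H\<rbrakk> \<Longrightarrow> \<epsilon> (g \<cdot> h) = \<epsilon> g \<otimes>\<^bsub>K\<^esub> \<epsilon> h"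
  using counit_hom by (auto simp: ring_hom_def)

lemma counit_scale_linear:
  assumes "module K W" "w \<in> carrier W"
  shows "(\<lambda>h. \<epsilon> h \<odot>\<^bsub>W\<^esub> w) \<in> linear_maps K H W"
proof -
  interpret W: module K W by fact
  show ?thesis
    using assms(2) counit_hom
    by (intro linear_mapsI)
       (auto simp: counit_closed ring_hom_def counit_smult W.smult_l_distr W.smult_assoc1)
qed

lemma mult_left_linear: "g \<in> carrier H \<Longrightarrow> (\<lambda>h. g \<cdot> h) \<in> linear_maps K H H"
  by (rule linear_mapsI) (auto simp: H.r_distr smult_mult_right)

lemma mult_right_linear: "g \<in> carrier H \<Longrightarrow> (\<lambda>h. h \<cdot> g) \<in> linear_maps K H H"
  by (rule linear_mapsI) (auto simp: H.l_distr smult_mult_left)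

lemma antipode_closed: "h \<in> carrier H \<Longrightarrow> S h \<in> carrier H"
  by (rule linear_closed [OF antipode_linear])

text \<open>The counit and antipode axioms are identities in \<open>H\<close>; applying a linear
  \<open>f\<close> turns them into identities of list sums with values in any module, as needed
  inside words.\<close>

lemma linear_sweedler:
  assumes V: "module K V" and W: "module K W" and B: "bilin H H V B"
    and f: "f \<in> linear_maps K V W" and h: "h \<in> carrier H"
  shows "f (tlift K V (\<lambda>(a, b). B a b) (\<Delta> h)) = lsum W (\<lambda>(a, b). f (B a b)) (cop h)"
proof -
  have "f (tlift K V (\<lambda>(a, b). B a b) (\<Delta> h)) = lsum W (\<lambda>p. f (case p of (a, b) \<Rightarrow> B a b)) (cop h)"
    unfolding sweedler [OF V B h] using cop_closed [OF h] bilin_closed [OF B]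
    by (intro linear_lsum [OF V W f]) auto
  then show ?thesis by (simp add: case_prod_unfold)
qed

lemma sweedler_counit_left:
  assumes W: "module K W" and f: "f \<in> linear_maps K H W" and h: "h \<in> carrier H"
  shows "lsum W (\<lambda>(a, b). \<epsilon> a \<odot>\<^bsub>W\<^esub> f b) (cop h) = f h"
proof -
  have B: "bilin H H H (\<lambda>a b. \<epsilon> a \<odot>\<^bsub>H\<^esub> b)"
    by (intro bilinI counit_scale_linear H_module linear_scale linear_id) (auto simp: counit_closed)
  have "lsum W (\<lambda>(a, b). \<epsilon> a \<odot>\<^bsub>W\<^esub> f b) (cop h) = lsum W (\<lambda>(a, b). f (\<epsilon> a \<odot>\<^bsub>H\<^esub> b)) (cop h)"
    by (rule sweedler_cong [OF h]) (simp add: linear_smult [OF f] counit_closed)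
  then show ?thesis
    using linear_sweedler [OF H_module W B f h] counit_left [OF h] by simp
qed

lemma sweedler_counit_right:
  assumes W: "module K W" and f: "f \<in> linear_maps K H W" and h: "h \<in> carrier H"
  shows "lsum W (\<lambda>(a, b). \<epsilon> b \<odot>\<^bsub>W\<^esub> f a) (cop h) = f h"
proof -
  have B: "bilin H H H (\<lambda>a b. \<epsilon> b \<odot>\<^bsub>H\<^esub> a)"
    by (intro bilinI counit_scale_linear H_module linear_scale linear_id) (auto simp: counit_closed)
  have "lsum W (\<lambda>(a, b). \<epsilon> b \<odot>\<^bsub>W\<^esub> f a) (cop h) = lsum W (\<lambda>(a, b). f (\<epsilon> b \<odot>\<^bsub>H\<^esub> a)) (cop h)"
    by (rule sweedler_cong [OF h]) (simp add: linear_smult [OF f] counit_closed)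
  then show ?thesis
    using linear_sweedler [OF H_module W B f h] counit_right [OF h] by simp
qed

lemma sweedler_antipode:
  assumes W: "module K W" and f: "f \<in> linear_maps K H W" and h: "h \<in> carrier H"
  shows "lsum W (\<lambda>(a, b). f (S a \<cdot> b)) (cop h) = \<epsilon> h \<odot>\<^bsub>W\<^esub> f \<one>\<^bsub>H\<^esub>"
proof -
  have B: "bilin H H H (\<lambda>a b. S a \<cdot> b)"
    by (intro bilinI mult_left_linear linear_comp [OF antipode_linear mult_right_linear])
       (auto simp: antipode_closed)
  show ?thesis
    using linear_sweedler [OF H_module W B f h] antipode_left [OF h]
    by (simp add: linear_smult [OF f] counit_closed h)
qed

text \<open>Multiplicativity of \<open>\<Delta>\<close> is an identity in the tensor square of
  \<open>H\<close>; the linear map induced by \<open>F\<close> carries it to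
  \<open>W\<close>.\<close>

lemma sweedler_mult:
  assumes W: "module K W" and F: "bilin H H W F" and gh: "g \<in> carrier H" "h \<in> carrier H"
  shows "lsum W (\<lambda>(a, b). F a b) (cop (g \<cdot> h)) =
    lsum W (\<lambda>(a, b). lsum W (\<lambda>(a', b'). F (a \<cdot> a') (b \<cdot> b')) (cop h)) (cop g)"
proof -
  let ?T = "tensor K H H"
  have T: "module K ?T" by (rule tensor_module [OF H_module H_module])
  note tb = tens_bilin [OF H_module H_module]
  have c: "tens K H H a b \<in> carrier ?T" if "a \<in> carrier H" "b \<in> carrier H" for a b
    using that by (rule tens_closed [OF H_module H_module])
  have b1: "bilin H H ?T (\<lambda>a' b'. tens K H H (a \<cdot> a') (b \<cdot> b'))"
    if "a \<in> carrier H" "b \<in> carrier H" for a b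
    using that
    by (intro bilinI linear_comp [OF mult_left_linear bilin_left [OF tb]]
        linear_comp [OF mult_left_linear bilin_right [OF tb]]) auto
  let ?G = "\<lambda>a b. tlift K ?T (\<lambda>(a', b'). tens K H H (a \<cdot> a') (b \<cdot> b')) (\<Delta> h)"
  let ?G' = "\<lambda>a b. lsum ?T (\<lambda>(a', b'). tens K H H (a \<cdot> a') (b \<cdot> b')) (cop h)"
  have G: "?G a b = ?G' a b" if "a \<in> carrier H" "b \<in> carrier H" for a b
    by (rule sweedler [OF T b1 gh(2)]) (use that in auto)
  \<comment> \<open>The outer \<open>tlift\<close> of the axiom may be evaluated only if the inner
    one is bilinear in \<open>a\<close> and \<open>b\<close>, which is read off its list
    form.\<close>
  have "bilin H H ?T ?G'"
    using cop_closed [OF gh(2)]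
    by (intro bilinI linear_lsum_pointwise [OF T]; clarify)
       (auto intro!: linear_comp [OF mult_right_linear bilin_left [OF tb]]
        linear_comp [OF mult_right_linear bilin_right [OF tb]])
  then have b2: "bilin H H ?T ?G"
    by (rule bilin_cong [OF H_module H_module]) (simp add: G)
  have "\<Delta> (g \<cdot> h) = lsum ?T (\<lambda>(a, b). ?G a b) (cop g)"
    unfolding comult_mult [OF gh] by (rule sweedler [OF T b2 gh(1)])
  also have "\<dots> = lsum ?T (\<lambda>(a, b). ?G' a b) (cop g)"
    by (rule sweedler_cong [OF gh(1) G])
  finally have eq: "\<Delta> (g \<cdot> h) = lsum ?T (\<lambda>(a, b). ?G' a b) (cop g)" .
  let ?L = "tlift K W (\<lambda>(a, b). F a b)"
  note L = tensor_lift [OF H_module H_module W F]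
  have "lsum W (\<lambda>(a, b). F a b) (cop (g \<cdot> h)) = ?L (\<Delta> (g \<cdot> h))"
    by (rule sweedler [OF W F, symmetric]) (use gh in auto)
  also have "\<dots> = lsum W (\<lambda>x. ?L (case x of (a, b) \<Rightarrow> ?G' a b)) (cop g)"
    unfolding eq using cop_closed [OF gh(1)]
    by (intro linear_lsum [OF T W L(1)]) (auto intro!: sweedler_closed [OF T gh(2)] c)
  also have "\<dots> = lsum W (\<lambda>(a, b). lsum W (\<lambda>x. ?L (case x of (a', b') \<Rightarrow>
      tens K H H (a \<cdot> a') (b \<cdot> b'))) (cop h)) (cop g)"
    using cop_closed [OF gh(1)] cop_closed [OF gh(2)]
    by (intro lsum_cong) (auto intro!: linear_lsum [OF T W L(1)] c)
  also have "\<dots> = lsum W (\<lambda>(a, b). lsum W (\<lambda>(a', b'). F (a \<cdot> a') (b \<cdot> b')) (cop h)) (cop g)"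
    using cop_closed [OF gh(1)] cop_closed [OF gh(2)]
    by (intro lsum_cong) (auto intro!: lsum_cong L(2))
  finally show ?thesis .
qed

text \<open>The coaction \<open>r\<close> with its decompositions \<open>d\<close> is \<open>\<Delta>\<close> on \<open>H\<close> or \<open>\<rho>\<close> on a crossed module.\<close>

lemma comodule_coassoc:
  assumes V: "module K V" and r: "r \<in> linear_maps K V (tensor K V H)"
    and d: "\<And>v. v \<in> carrier V \<Longrightarrow> set (d v) \<subseteq> carrier V \<times> carrier H \<and>
      r v = lsum (tensor K V H) (\<lambda>(v', a). tens K V H v' a) (d v)"
    and W: "module K W" and G: "trilin V H H W G" and m: "m \<in> carrier V"
    and ax: "tlift K (tensor K (tensor K V H) H) (\<lambda>(v, a). tens K (tensor K V H) H (r v) a) (r m) =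
      tlift K (tensor K (tensor K V H) H)
        (\<lambda>(v, a). tlift K (tensor K (tensor K V H) H)
          (\<lambda>(a', a''). tens K (tensor K V H) H (tens K V H v a') a'') (\<Delta> a)) (r m)"
  shows "lsum W (\<lambda>(v, a). lsum W (\<lambda>(v', b). G v' b a) (d v)) (d m) =
    lsum W (\<lambda>(v, a). lsum W (\<lambda>(a', a''). G v a' a'') (cop a)) (d m)"
proof -
  let ?T = "tensor K V H" and ?T3 = "tensor K (tensor K V H) H"
  have T: "module K ?T" by (rule tensor_module [OF V H_module])
  have T3: "module K ?T3" by (rule tensor_module [OF T H_module])
  note tb = tens_bilin [OF V H_module] and tb3 = tens_bilin [OF T H_module]
  note c = tens_closed [OF V H_module] and c3 = tens_closed [OF T H_module]
  note L = triple_tensor_lift [OF V H_module H_module W G]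
  let ?L = "tlift K W (\<lambda>(t, c). tlift K W (\<lambda>(a, b). G a b c) t)"
  have bG: "bilin V H W (\<lambda>a b. G a b c)" if "c \<in> carrier H" for c
    using G that by (simp add: trilin_def)
  have D: "r v \<in> carrier ?T" if "v \<in> carrier V" for v by (rule linear_closed [OF r that])
  have dc: "a \<in> carrier V" "b \<in> carrier H" if "(a, b) \<in> set (d v)" "v \<in> carrier V" for a b v
    using d that by auto
  have sum: "tlift K U (\<lambda>(v, a). F v a) (r v) = lsum U (\<lambda>(v, a). F v a) (d v)"
    if "module K U" "bilin V H U F" "v \<in> carrier V" for U :: "('k, 'u) module" and F v
    using tensor_lift_lsum [OF V H_module that(1,2), of "d v"] d [OF that(3)] by simp
  have "bilin V H ?T3 (\<lambda>a b. tens K ?T H (r a) b)"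
    by (intro bilinI linear_comp [OF r bilin_left [OF tb3]] bilin_right [OF tb3] D)
  note lhs = sum [OF T3 this m]
  let ?G = "\<lambda>a b. tlift K ?T3 (\<lambda>(b', b''). tens K ?T H (tens K V H a b') b'') (\<Delta> b)"
  let ?G' = "\<lambda>a b. lsum ?T3 (\<lambda>(b', b''). tens K ?T H (tens K V H a b') b'') (cop b)"
  have b1: "bilin H H ?T3 (\<lambda>b' b''. tens K ?T H (tens K V H a b') b'')" if "a \<in> carrier V" for a
    using that
    by (intro bilinI linear_comp [OF bilin_right [OF tb] bilin_left [OF tb3]]
        bilin_right [OF tb3] c) auto
  have eqG: "?G a b = ?G' a b" if "a \<in> carrier V" "b \<in> carrier H" for a b
    by (rule sweedler [OF T3 b1]) (use that in auto)
  have "bilin V H ?T3 ?G'"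
  proof (rule bilinI)
    show "?G' a \<in> linear_maps K H ?T3" if "a \<in> carrier V" for a
      by (rule sweedler_linear [OF T3 b1 [OF that]])
    show "(\<lambda>a. ?G' a b) \<in> linear_maps K V ?T3" if b: "b \<in> carrier H" for b
      using cop_closed [OF b]
      by (intro linear_lsum_pointwise [OF T3])
         (auto intro!: linear_comp [OF bilin_left [OF tb] bilin_left [OF tb3]])
  qed
  then have bG': "bilin V H ?T3 ?G"
    by (rule bilin_cong [OF V H_module]) (simp add: eqG)
  \<comment> \<open>The axiom now compares two list sums in the triple tensor product; the rest
    applies to both of them the linear map \<open>?L\<close> induced by \<open>G\<close>.\<close>
  have "lsum ?T3 (\<lambda>(a, b). tens K ?T H (r a) b) (d m) = lsum ?T3 (\<lambda>(a, b). ?G a b) (d m)"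
    using ax unfolding lhs sum [OF T3 bG' m] .
  also have "\<dots> = lsum ?T3 (\<lambda>(a, b). ?G' a b) (d m)"
    by (rule lsum_cong) (use dc m in \<open>auto intro!: eqG\<close>)
  finally have eq: "lsum ?T3 (\<lambda>(a, b). tens K ?T H (r a) b) (d m) = lsum ?T3 (\<lambda>(a, b). ?G' a b) (d m)" .
  have LG: "?L (?G' a b) = lsum W (\<lambda>(b', b''). G a b' b'') (cop b)"
    if a: "a \<in> carrier V" and b: "b \<in> carrier H" for a b
  proof -
    have "?L (?G' a b) =
        lsum W (\<lambda>x. ?L (case x of (b', b'') \<Rightarrow> tens K ?T H (tens K V H a b') b'')) (cop b)"
      using cop_closed [OF b] a by (intro linear_lsum [OF T3 W L(1)]) (auto intro!: c3 c)
    also have "\<dots> = lsum W (\<lambda>(b', b''). G a b' b'') (cop b)"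
      using cop_closed [OF b] a
      by (intro lsum_cong) (auto simp: L(2) c tensor_lift(2) [OF V H_module W bG])
    finally show ?thesis .
  qed
  have G'c: "?G' a b \<in> carrier ?T3" if "a \<in> carrier V" "b \<in> carrier H" for a b
    by (rule sweedler_closed [OF T3 that(2)]) (intro c3 c that)
  have "lsum W (\<lambda>(v, a). lsum W (\<lambda>(v', b). G v' b a) (d v)) (d m) =
      lsum W (\<lambda>x. ?L (case x of (a, b) \<Rightarrow> tens K ?T H (r a) b)) (d m)"
    using dc [OF _ m] by (intro lsum_cong) (auto simp: L(2) D intro!: sum [OF W bG, symmetric])
  also have "\<dots> = ?L (lsum ?T3 (\<lambda>(a, b). tens K ?T H (r a) b) (d m))"
    using dc [OF _ m] by (intro linear_lsum [OF T3 W L(1), symmetric]) (auto intro!: c3 D)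
  also have "\<dots> = lsum W (\<lambda>x. ?L (case x of (a, b) \<Rightarrow> ?G' a b)) (d m)"
    unfolding eq using dc [OF _ m] by (intro linear_lsum [OF T3 W L(1)]) (auto intro!: G'c)
  also have "\<dots> = lsum W (\<lambda>(a, b). lsum W (\<lambda>(b', b''). G a b' b'') (cop b)) (d m)"
    using dc [OF _ m] by (intro lsum_cong) (auto simp: LG)
  finally show ?thesis .
qed

lemma sweedler_coassoc:
  assumes W: "module K W" and G: "trilin H H H W G" and h: "h \<in> carrier H"
  shows "lsum W (\<lambda>(a, b). lsum W (\<lambda>(a', a''). G a' a'' b) (cop a)) (cop h) =
    lsum W (\<lambda>(a, b). lsum W (\<lambda>(b', b''). G a b' b'') (cop b)) (cop h)"
  by (rule comodule_coassoc [OF H_module comult_linear conjI [OF cop] W G h coassoc [OF h]])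

end

context hopf_algebra
begin

lemma set_take_le: "set l \<subseteq> A \<Longrightarrow> set (take i l) \<subseteq> A"
  using set_take_subset by fast

lemma set_drop_le: "set l \<subseteq> A \<Longrightarrow> set (drop i l) \<subseteq> A"
  using set_drop_subset by fast

text \<open>\<open>iter n h\<close> lists the words \<open>[h\<^sub>(\<^sub>1\<^sub>), \<dots>, h\<^sub>(\<^sub>n\<^sub>+\<^sub>1\<^sub>)]\<close>.\<close>

primrec iter :: "nat \<Rightarrow> 'h \<Rightarrow> 'h list list" where
  "iter 0 h = [[h]]"
| "iter (Suc n) h = concat (map (\<lambda>(a, b). map ((#) a) (iter n b)) (cop h))"

lemma iter_closed:
  assumes "h \<in> carrier H" "l \<in> set (iter n h)"
  shows "length l = Suc n" "set l \<subseteq> carrier H"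
proof -
  have "length l = Suc n \<and> set l \<subseteq> carrier H"
    using assms
  proof (induction n arbitrary: h l)
    case (Suc n)
    then obtain a b k where k: "(a, b) \<in> set (cop h)" "k \<in> set (iter n b)" "l = a # k" by auto
    then show ?case
      using Suc.IH [OF cop_closed(2) [OF Suc.prems(1) k(1)] k(2)] cop_closed(1) [OF Suc.prems(1) k(1)]
      by simp
  qed simp
  then show "length l = Suc n" "set l \<subseteq> carrier H" by auto
qed

lemma lsum_iter_Suc:
  assumes W: "module K W" and h: "h \<in> carrier H"
    and F: "\<And>l. \<lbrakk>length l = Suc (Suc n); set l \<subseteq> carrier H\<rbrakk> \<Longrightarrow> F l \<in> carrier W"
  shows "lsum W F (iter (Suc n) h) = lsum W (\<lambda>(a, b). lsum W (\<lambda>l. F (a # l)) (iter n b)) (cop h)"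
proof -
  have "lsum W F (iter (Suc n) h) =
      lsum W (lsum W F) (map (\<lambda>(a, b). map ((#) a) (iter n b)) (cop h))"
    unfolding iter.simps
  proof (rule lsum_concat [OF W])
    fix ys y assume "ys \<in> set (map (\<lambda>(a, b). map ((#) a) (iter n b)) (cop h))" "y \<in> set ys"
    then obtain a b k where "(a, b) \<in> set (cop h)" "k \<in> set (iter n b)" "y = a # k" by auto
    then show "F y \<in> carrier W"
      using F [of y] iter_closed [OF cop_closed(2) [OF h]] cop_closed(1) [OF h] by simp
  qed
  also have "\<dots> = lsum W (\<lambda>(a, b). lsum W (\<lambda>l. F (a # l)) (iter n b)) (cop h)"
    unfolding lsum_map by (rule lsum_cong) (auto simp: lsum_map)
  finally show ?thesis .
qed

lemma lsum_iter_cong: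
  assumes "h \<in> carrier H" "\<And>l. \<lbrakk>length l = Suc n; set l \<subseteq> carrier H\<rbrakk> \<Longrightarrow> F l = G l"
  shows "lsum W F (iter n h) = lsum W G (iter n h)"
  by (intro lsum_cong assms(2)) (use iter_closed [OF assms(1)] in auto)

lemma lsum_iter_closed:
  assumes "module K W" "h \<in> carrier H"
    "\<And>l. \<lbrakk>length l = Suc n; set l \<subseteq> carrier H\<rbrakk> \<Longrightarrow> F l \<in> carrier W"
  shows "lsum W F (iter n h) \<in> carrier W"
  by (intro lsum_closed [OF assms(1)] assms(3)) (use iter_closed [OF assms(2)] in auto)

text \<open>The list \<open>iter n h\<close> is not additive in \<open>h\<close>. Its recursion
  exposes one coproduct whose integrand is bilinear by the induction hypothesis, so linearity again
  comes from \<open>\<Delta>\<close>.\<close>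

lemma lsum_iter_linear:
  assumes W: "module K W" and F: "multilin H W (Suc n) F"
  shows "(\<lambda>h. lsum W F (iter n h)) \<in> linear_maps K H W"
  using F
proof (induction n arbitrary: F)
  case 0
  show ?case
    by (rule linear_cong [OF H_module multilin_slot [OF 0, of "[]" "[]"]])
       (simp_all add: lsum_single [OF W] multilin_closed [OF 0] del: lsum.simps)
next
  case (Suc n)
  have c: "multilin H W (Suc n) (\<lambda>l. F (a # l))" if "a \<in> carrier H" for a
    using multilin_context [OF Suc.prems, of "[a]" "[]" "Suc n"] that by simp
  have s: "(\<lambda>a. F (a # l)) \<in> linear_maps K H W" if "length l = Suc n" "set l \<subseteq> carrier H" for l
    using multilin_slot [OF Suc.prems, of "[]" l] that by simp
  have "bilin H H W (\<lambda>a b. lsum W (\<lambda>l. F (a # l)) (iter n b))"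
    by (intro bilinI linear_lsum_pointwise [OF W] Suc.IH c s)
       (auto dest: iter_closed)
  then show ?case
    by (rule linear_cong [OF H_module sweedler_linear [OF W]])
       (use multilin_closed [OF Suc.prems] in \<open>auto intro!: lsum_iter_Suc [OF W, symmetric] simp del: iter.simps\<close>)
qed

text \<open>Both recursions split off the first component. The outer \<open>tlift\<close> can be
  evaluated on \<open>cop h\<close> only once its integrand is known to be bilinear, hence the
  detour through the list form \<open>?G\<close>.\<close>

lemma iterated_comult_iter:
  assumes "h \<in> carrier H"
  shows "iterated_comult K H \<Delta> n h = lsum (tensor_power K H (Suc n)) (pure K H) (iter n h)"
  using assms
proof (induction n arbitrary: h)
  case 0
  show ?case
    using pure_closed [OF H_module, of "[h]" "Suc 0"] 0
    by (simp add: lsum_single tensor_power_module H_module words_def del: lsum.simps)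
next
  case (Suc n)
  let ?T = "tensor_power K H (Suc n)" and ?T' = "tensor_power K H (Suc (Suc n))"
  note T = tensor_power_module [OF H_module, of "Suc n"]
  note T' = tensor_power_module [OF H_module, of "Suc (Suc n)"]
  note p' = pure_multilin [OF H_module, of "Suc (Suc n)"]
  let ?F = "\<lambda>a b. tlift K ?T' (\<lambda>l. pure K H (a # l)) (iterated_comult K H \<Delta> n b)"
  let ?G = "\<lambda>a b. lsum ?T' (\<lambda>l. pure K H (a # l)) (iter n b)"
  have c: "multilin H ?T' (Suc n) (\<lambda>l. pure K H (a # l))" if "a \<in> carrier H" for a
    using multilin_context [OF p', of "[a]" "[]" "Suc n"] that by simp
  have s: "(\<lambda>a. pure K H (a # l)) \<in> linear_maps K H ?T'" if "length l = Suc n" "set l \<subseteq> carrier H" for l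
    using multilin_slot [OF p', of "[]" l] that by simp
  have FG: "?F a b = ?G a b" if ab: "a \<in> carrier H" "b \<in> carrier H" for a b
  proof -
    note L = tensor_power_lift [OF H_module T' c [OF ab(1)]]
    have "?F a b = lsum ?T' (\<lambda>l. tlift K ?T' (\<lambda>l. pure K H (a # l)) (pure K H l)) (iter n b)"
      unfolding Suc.IH [OF ab(2)]
      by (rule linear_lsum [OF T T' L(1)])
         (use iter_closed [OF ab(2)] in \<open>auto intro!: pure_closed [OF H_module] simp: words_def\<close>)
    also have "\<dots> = ?G a b"
      by (intro lsum_iter_cong [OF ab(2)] L(2)) (simp add: words_def)
    finally show ?thesis .
  qed
  have "bilin H H ?T' ?G"
    by (intro bilinI linear_lsum_pointwise [OF T'] lsum_iter_linear [OF T'] c s)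
       (auto dest: iter_closed)
  then have b: "bilin H H ?T' ?F"
    by (rule bilin_cong [OF H_module H_module]) (simp add: FG)
  have "iterated_comult K H \<Delta> (Suc n) h = lsum ?T' (\<lambda>(a, b). ?F a b) (cop h)"
    using sweedler [OF T' b Suc.prems] by simp
  also have "\<dots> = lsum ?T' (\<lambda>(a, b). ?G a b) (cop h)"
    by (rule sweedler_cong [OF Suc.prems FG])
  also have "\<dots> = lsum ?T' (pure K H) (iter (Suc n) h)"
    by (rule lsum_iter_Suc [OF T' Suc.prems, symmetric]) (simp add: multilin_closed [OF p'])
  finally show ?case .
qed

lemma sweedler_iter:
  assumes W: "module K W" and F: "multilin H W (Suc n) F" and h: "h \<in> carrier H"
  shows "tlift K W F (iterated_comult K H \<Delta> n h) = lsum W F (iter n h)"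
proof -
  note L = tensor_power_lift [OF H_module W F]
  have "tlift K W F (iterated_comult K H \<Delta> n h) = lsum W (\<lambda>l. tlift K W F (pure K H l)) (iter n h)"
    unfolding iterated_comult_iter [OF h]
    by (rule linear_lsum [OF tensor_power_module [OF H_module] W L(1)])
       (use iter_closed [OF h] in \<open>auto intro!: pure_closed [OF H_module] simp: words_def\<close>)
  also have "\<dots> = lsum W F (iter n h)"
    by (intro lsum_iter_cong [OF h] L(2)) (simp add: words_def)
  finally show ?thesis .
qed

subsection \<open>Operations in one position of an iterated Sweedler sum\<close>

lemma multilin_Cons: "\<lbrakk>multilin H W (Suc n) F; a \<in> carrier H\<rbrakk> \<Longrightarrow> multilin H W n (\<lambda>l. F (a # l))"
  using multilin_context [of H W "Suc n" F "[a]" "[]" n] by simp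

lemma multilin_hd:
  "\<lbrakk>multilin H W (Suc n) F; length l = n; set l \<subseteq> carrier H\<rbrakk> \<Longrightarrow> (\<lambda>a. F (a # l)) \<in> linear_maps K H W"
  using multilin_slot [of H W "Suc n" F "[]" l] by simp

lemma expand_closed:
  assumes W: "module K W" and F: "multilin H W (Suc (Suc n)) F" and i: "i \<le> n"
    and l: "length l = Suc n" "set l \<subseteq> carrier H"
  shows "lsum W (\<lambda>(a, b). F (take i l @ [a, b] @ drop (Suc i) l)) (cop (l ! i)) \<in> carrier W"
proof -
  have "l ! i \<in> carrier H" using l i by (auto simp: subset_iff)
  then show ?thesis
    by (rule sweedler_closed [OF W])
       (use l i in \<open>simp add: multilin_closed [OF F] set_take_le set_drop_le\<close>)
qed

text \<open>Coassociativity in an arbitrary position. Since \<open>iter\<close> splits its last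
  factor, a one-letter word is expanded by definition and coassociativity is needed only for the
  first entry of a longer word; other positions are reached by stripping the head.\<close>

lemma iter_expand:
  assumes W: "module K W" and h: "h \<in> carrier H" and i: "i \<le> n" and F: "multilin H W (Suc (Suc n)) F"
  shows "lsum W (\<lambda>l. lsum W (\<lambda>(a, b). F (take i l @ [a, b] @ drop (Suc i) l)) (cop (l ! i))) (iter n h) =
    lsum W F (iter (Suc n) h)"
  using h i F
proof (induction i arbitrary: n h F)
  case 0
  note Fc = multilin_closed [OF 0(3)]
  show ?case
  proof (cases n)
    case n: 0
    have "lsum W (\<lambda>(a, b). F [a, b]) (cop h) \<in> carrier W"
      by (rule sweedler_closed [OF W 0(1)]) (simp add: Fc n)
    then have "lsum W (\<lambda>l. lsum W (\<lambda>(a, b). F (take 0 l @ [a, b] @ drop (Suc 0) l)) (cop (l ! 0))) (iter 0 h) =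
        lsum W (\<lambda>(a, b). F [a, b]) (cop h)"
      using lsum_single [OF W] by simp
    also have "\<dots> = lsum W (\<lambda>(a, b). lsum W (\<lambda>l. F (a # l)) (iter 0 b)) (cop h)"
      by (rule sweedler_cong [OF 0(1)]) (simp add: lsum_single [OF W] Fc n del: lsum.simps)
    also have "\<dots> = lsum W F (iter (Suc 0) h)"
      by (rule lsum_iter_Suc [OF W 0(1), symmetric]) (simp add: Fc n)
    finally show ?thesis unfolding n .
  next
    case (Suc m)
    \<comment> \<open>The tail of the word is produced from the third argument, so that the claim
      becomes coassociativity for three components.\<close>
    let ?G = "\<lambda>a b c. lsum W (\<lambda>l. F (a # b # l)) (iter m c)"
    have tri: "trilin H H H W ?G"
      unfolding trilin_def
    proof (intro conjI ballI bilinI)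
      fix c b assume "c \<in> carrier H" "b \<in> carrier H"
      then show "(\<lambda>a. ?G a b c) \<in> linear_maps K H W"
        by (intro linear_lsum_pointwise [OF W] multilin_hd [OF 0(3)])
           (use iter_closed in \<open>auto simp: Suc\<close>)
    next
      fix c a assume "c \<in> carrier H" "a \<in> carrier H"
      then show "(\<lambda>b. ?G a b c) \<in> linear_maps K H W"
        by (intro linear_lsum_pointwise [OF W] multilin_hd [OF multilin_Cons [OF 0(3)]])
           (use iter_closed in \<open>auto simp: Suc\<close>)
    next
      fix a b assume "a \<in> carrier H" "b \<in> carrier H"
      then show "?G a b \<in> linear_maps K H W"
        using 0(3) unfolding Suc by (intro lsum_iter_linear [OF W] multilin_Cons)
    qed
    have "lsum W (\<lambda>l. lsum W (\<lambda>(a, b). F (take 0 l @ [a, b] @ drop (Suc 0) l)) (cop (l ! 0))) (iter n h) =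
        lsum W (\<lambda>(a, b). lsum W (\<lambda>l. lsum W (\<lambda>(a', a''). F (a' # a'' # l)) (cop a)) (iter m b)) (cop h)"
      unfolding Suc using expand_closed [OF W 0(3), of 0] Suc
      by (subst lsum_iter_Suc [OF W 0(1)]) auto
    also have "\<dots> = lsum W (\<lambda>(a, b). lsum W (\<lambda>(a', a''). ?G a' a'' b) (cop a)) (cop h)"
    proof (rule sweedler_cong [OF 0(1)])
      fix a b assume ab: "a \<in> carrier H" "b \<in> carrier H"
      show "lsum W (\<lambda>l. lsum W (\<lambda>(a', a''). F (a' # a'' # l)) (cop a)) (iter m b) =
          lsum W (\<lambda>(a', a''). ?G a' a'' b) (cop a)"
        using cop_closed [OF ab(1)] iter_closed [OF ab(2)] Suc
        by (subst lsum_swap [OF W]) (auto simp: Fc intro!: lsum_cong)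
    qed
    also have "\<dots> = lsum W (\<lambda>(a, b). lsum W (\<lambda>(b', b''). ?G a b' b'') (cop b)) (cop h)"
      by (rule sweedler_coassoc [OF W tri 0(1)])
    also have "\<dots> = lsum W (\<lambda>(a, b). lsum W (\<lambda>l. F (a # l)) (iter (Suc m) b)) (cop h)"
      by (rule sweedler_cong [OF 0(1)], rule lsum_iter_Suc [OF W, symmetric]) (simp_all add: Fc Suc)
    also have "\<dots> = lsum W F (iter (Suc n) h)"
      unfolding Suc by (rule lsum_iter_Suc [OF W 0(1), symmetric]) (simp add: Fc Suc)
    finally show ?thesis .
  qed
next
  case (Suc i)
  then obtain m where n: "n = Suc m" by (cases n) auto
  have "lsum W (\<lambda>l. lsum W (\<lambda>(a, b). F (take (Suc i) l @ [a, b] @ drop (Suc (Suc i)) l)) (cop (l ! Suc i))) (iter n h) =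
      lsum W (\<lambda>(x, y). lsum W (\<lambda>l. lsum W (\<lambda>(a, b). F (x # take i l @ [a, b] @ drop (Suc i) l)) (cop (l ! i))) (iter m y)) (cop h)"
    unfolding n using expand_closed [OF W Suc.prems(3), of "Suc i"] Suc.prems(2) n
    by (subst lsum_iter_Suc [OF W Suc.prems(1)]) auto
  also have "\<dots> = lsum W (\<lambda>(x, y). lsum W (\<lambda>l. F (x # l)) (iter (Suc m) y)) (cop h)"
  proof (rule sweedler_cong [OF Suc.prems(1)])
    fix x y assume xy: "x \<in> carrier H" "y \<in> carrier H"
    have "multilin H W (Suc (Suc m)) (\<lambda>l. F (x # l))"
      using Suc.prems(3) xy(1) unfolding n by (rule multilin_Cons)
    then show "lsum W (\<lambda>l. lsum W (\<lambda>(a, b). F (x # take i l @ [a, b] @ drop (Suc i) l)) (cop (l ! i))) (iter m y) =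
        lsum W (\<lambda>l. F (x # l)) (iter (Suc m) y)"
      using Suc.prems(2) n by (intro Suc.IH [OF xy(2)]) auto
  qed
  also have "\<dots> = lsum W F (iter (Suc n) h)"
    unfolding n by (rule lsum_iter_Suc [OF W Suc.prems(1), symmetric])
      (simp add: multilin_closed [OF Suc.prems(3)] n)
  finally show ?case .
qed

text \<open>At the first entry this is the left counit axiom; later positions are reached by
  stripping the head, until the word has two letters.\<close>

lemma iter_counit:
  assumes W: "module K W" and h: "h \<in> carrier H" and i: "i \<le> Suc n" and F: "multilin H W (Suc n) F"
  shows "lsum W (\<lambda>l. \<epsilon> (l ! i) \<odot>\<^bsub>W\<^esub> F (take i l @ drop (Suc i) l)) (iter (Suc n) h) =
    lsum W F (iter n h)"
  using h i F
proof (induction i arbitrary: n h F)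
  case 0
  interpret W: module K W by (rule W)
  note Fc = multilin_closed [OF 0(3)]
  have "lsum W (\<lambda>l. \<epsilon> (l ! 0) \<odot>\<^bsub>W\<^esub> F (take 0 l @ drop (Suc 0) l)) (iter (Suc n) h) =
      lsum W (\<lambda>(a, b). lsum W (\<lambda>l. \<epsilon> a \<odot>\<^bsub>W\<^esub> F l) (iter n b)) (cop h)"
    by (subst lsum_iter_Suc [OF W 0(1)])
       (simp_all add: Fc counit_closed set_drop_le subsetD nth_mem)
  also have "\<dots> = lsum W (\<lambda>(a, b). \<epsilon> a \<odot>\<^bsub>W\<^esub> lsum W F (iter n b)) (cop h)"
    by (intro sweedler_cong [OF 0(1)] smult_lsum [OF W, symmetric] counit_closed)
       (auto intro!: Fc dest: iter_closed)
  also have "\<dots> = lsum W F (iter n h)"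
    by (rule sweedler_counit_left [OF W lsum_iter_linear [OF W 0(3)] 0(1)])
  finally show ?case .
next
  case (Suc i)
  interpret W: module K W by (rule W)
  note Fc = multilin_closed [OF Suc.prems(3)]
  have "lsum W (\<lambda>l. \<epsilon> (l ! Suc i) \<odot>\<^bsub>W\<^esub> F (take (Suc i) l @ drop (Suc (Suc i)) l)) (iter (Suc n) h) =
      lsum W (\<lambda>(a, b). lsum W (\<lambda>l. \<epsilon> (l ! i) \<odot>\<^bsub>W\<^esub> F (a # take i l @ drop (Suc i) l)) (iter n b)) (cop h)"
    using Suc.prems(2)
    by (subst lsum_iter_Suc [OF W Suc.prems(1)])
       (simp_all add: Fc counit_closed set_take_le set_drop_le subsetD nth_mem)
  also have "\<dots> = lsum W F (iter n h)"
  proof (cases n)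
    case 0
    \<comment> \<open>Here the word is \<open>[a, b]\<close> and its last entry is deleted, the one
      place where the right counit axiom enters.\<close>
    have l: "(\<lambda>a. F [a]) \<in> linear_maps K H W"
      using multilin_hd [OF Suc.prems(3), of "[]"] 0 by simp
    have "lsum W (\<lambda>(a, b). lsum W (\<lambda>l. \<epsilon> (l ! i) \<odot>\<^bsub>W\<^esub> F (a # take i l @ drop (Suc i) l)) (iter n b)) (cop h) =
        lsum W (\<lambda>(a, b). \<epsilon> b \<odot>\<^bsub>W\<^esub> F [a]) (cop h)"
      using Suc.prems(2) 0 by (intro sweedler_cong [OF Suc.prems(1)]) (auto simp: Fc counit_closed)
    also have "\<dots> = F [h]"
      by (rule sweedler_counit_right [OF W l Suc.prems(1)])
    finally show ?thesis using 0 Suc.prems(1) by (simp add: Fc)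
  next
    case (Suc m)
    have "lsum W (\<lambda>(a, b). lsum W (\<lambda>l. \<epsilon> (l ! i) \<odot>\<^bsub>W\<^esub> F (a # take i l @ drop (Suc i) l)) (iter n b)) (cop h) =
        lsum W (\<lambda>(a, b). lsum W (\<lambda>l. F (a # l)) (iter m b)) (cop h)"
    proof (rule sweedler_cong [OF Suc.prems(1)])
      fix a b assume ab: "a \<in> carrier H" "b \<in> carrier H"
      have "multilin H W (Suc m) (\<lambda>l. F (a # l))"
        using Suc.prems(3) ab(1) unfolding Suc by (rule multilin_Cons)
      then show "lsum W (\<lambda>l. \<epsilon> (l ! i) \<odot>\<^bsub>W\<^esub> F (a # take i l @ drop (Suc i) l)) (iter n b) =
          lsum W (\<lambda>l. F (a # l)) (iter m b)"
        using Suc.prems(2) unfolding Suc by (intro Suc.IH [OF ab(2)]) auto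
    qed
    also have "\<dots> = lsum W F (iter n h)"
      unfolding Suc by (rule lsum_iter_Suc [OF W Suc.prems(1), symmetric]) (simp add: Fc Suc)
    finally show ?thesis .
  qed
  finally show ?case .
qed

text \<open>Guarantees that an integrand with one entry already expanded into a block can be
  expanded again.\<close>

lemma multilin_iter_subst:
  assumes W: "module K W" and F: "multilin H W (p + Suc n) F" and i: "i \<le> p"
  shows "multilin H W (Suc p) (\<lambda>l. lsum W (\<lambda>k. F (take i l @ k @ drop (Suc i) l)) (iter n (l ! i)))"
  by (rule multilin_subst [OF H_module F i, where \<Phi> = "\<lambda>G x. lsum W G (iter n x)"])
     (auto intro!: lsum_iter_linear [OF W] linear_lsum_pointwise [OF W] dest: iter_closed)

text \<open>\<open>iter (Suc n)\<close> is one coproduct followed by \<open>iter n\<close> on its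
  second component. So the entry is split in two by \<open>iter_expand\<close>, and the induction
  hypothesis handles the new entry at \<open>Suc i\<close>.\<close>

lemma iter_block:
  assumes W: "module K W" and h: "h \<in> carrier H" and i: "i \<le> p" and F: "multilin H W (p + Suc n) F"
  shows "lsum W (\<lambda>l. lsum W (\<lambda>k. F (take i l @ k @ drop (Suc i) l)) (iter n (l ! i))) (iter p h) =
    lsum W F (iter (p + n) h)"
  using i F
proof (induction n arbitrary: p i F)
  case 0
  have *: "lsum W (\<lambda>k. F (take i l @ k @ drop (Suc i) l)) (iter 0 (l ! i)) = F l"
    if l: "length l = Suc p" "set l \<subseteq> carrier H" for l
  proof -
    have "take i l @ [l ! i] @ drop (Suc i) l = l"
      using l(1) 0(1) id_take_nth_drop [of i l] by (metis append_Cons append_Nil le_imp_less_Suc)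
    moreover have "F l \<in> carrier W"
      by (rule multilin_closed [OF 0(2)]) (use l in auto)
    ultimately show ?thesis
      unfolding iter.simps using lsum_single [OF W, of "\<lambda>k. F (take i l @ k @ drop (Suc i) l)" "[l ! i]"] by metis
  qed
  show ?case
    unfolding add_0_right by (rule lsum_iter_cong [OF h *])
next
  case (Suc n)
  let ?G = "\<lambda>g. lsum W (\<lambda>k. F (take (Suc i) g @ k @ drop (Suc (Suc i)) g)) (iter n (g ! Suc i))"
  have G: "multilin H W (Suc (Suc p)) ?G"
    using Suc.prems by (intro multilin_iter_subst [OF W]) auto
  have "lsum W (\<lambda>l. lsum W (\<lambda>k. F (take i l @ k @ drop (Suc i) l)) (iter (Suc n) (l ! i))) (iter p h) =
      lsum W (\<lambda>l. lsum W (\<lambda>(a, b). ?G (take i l @ [a, b] @ drop (Suc i) l)) (cop (l ! i))) (iter p h)"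
  proof (rule lsum_iter_cong [OF h])
    fix l assume l: "length l = Suc p" "set l \<subseteq> carrier H"
    then have x: "l ! i \<in> carrier H" using Suc.prems(1) by (auto simp: subset_iff)
    have "lsum W (\<lambda>k. F (take i l @ k @ drop (Suc i) l)) (iter (Suc n) (l ! i)) =
        lsum W (\<lambda>(a, b). lsum W (\<lambda>k. F (take i l @ (a # k) @ drop (Suc i) l)) (iter n b)) (cop (l ! i))"
      by (rule lsum_iter_Suc [OF W x])
         (use l Suc.prems(1) in \<open>simp add: multilin_closed [OF Suc.prems(2)] set_take_le set_drop_le\<close>)
    also have "\<dots> = lsum W (\<lambda>(a, b). ?G (take i l @ [a, b] @ drop (Suc i) l)) (cop (l ! i))"
    proof (rule sweedler_cong [OF x])
      fix a b
      have "length (take i l) = i" using l Suc.prems(1) by simp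
      then have "take (Suc i) (take i l @ [a, b] @ drop (Suc i) l) = take i l @ [a]"
        "drop (Suc (Suc i)) (take i l @ [a, b] @ drop (Suc i) l) = drop (Suc i) l"
        "(take i l @ [a, b] @ drop (Suc i) l) ! Suc i = b"
        by (simp_all del: length_take add: nth_append)
      then show "lsum W (\<lambda>k. F (take i l @ (a # k) @ drop (Suc i) l)) (iter n b) =
          ?G (take i l @ [a, b] @ drop (Suc i) l)"
        by simp
    qed
    finally show "lsum W (\<lambda>k. F (take i l @ k @ drop (Suc i) l)) (iter (Suc n) (l ! i)) =
        lsum W (\<lambda>(a, b). ?G (take i l @ [a, b] @ drop (Suc i) l)) (cop (l ! i))" .
  qed
  also have "\<dots> = lsum W ?G (iter (Suc p) h)"
    by (rule iter_expand [OF W h Suc.prems(1) G])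
  also have "\<dots> = lsum W F (iter (Suc p + n) h)"
    by (rule Suc.IH) (use Suc.prems in auto)
  finally show ?case by simp
qed

text \<open>The position lemmas apply only to functions multilinear in all entries, also where two
  entries enter jointly through a product with the antipode.\<close>

lemma multilin_antipode:
  assumes F: "multilin H W (Suc (Suc n)) F"
  shows "multilin H W (Suc (Suc (Suc n))) (\<lambda>l. F ((S (l ! 0) \<cdot> l ! 1) # drop 2 l))" (is "multilin H W _ ?G")
proof (rule multilinI)
  fix xs ys assume l: "set xs \<subseteq> carrier H" "set ys \<subseteq> carrier H" "length xs + length ys + 1 = Suc (Suc (Suc n))"
  consider "xs = []" | x where "xs = [x]" | x y zs where "xs = x # y # zs"
    by (metis neq_Nil_conv)
  then show "(\<lambda>v. ?G (xs @ v # ys)) \<in> linear_maps K H W"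
  proof cases
    case 1
    then obtain y zs where y: "ys = y # zs" using l by (cases ys) auto
    have "(\<lambda>v. F ((S v \<cdot> y) # zs)) \<in> linear_maps K H W"
      by (rule linear_comp [OF linear_comp [OF antipode_linear mult_right_linear] multilin_hd [OF F]])
         (use l y 1 in auto)
    then show ?thesis using 1 y by (simp add: numeral_2_eq_2)
  next
    case (2 x)
    have "(\<lambda>v. F ((S x \<cdot> v) # ys)) \<in> linear_maps K H W"
      by (rule linear_comp [OF mult_left_linear multilin_hd [OF F]])
         (use l 2 in \<open>auto simp: antipode_closed\<close>)
    then show ?thesis using 2 by (simp add: numeral_2_eq_2)
  next
    case (3 x y zs)
    have "(\<lambda>v. F (((S x \<cdot> y) # zs) @ v # ys)) \<in> linear_maps K H W"
      by (rule multilin_slot [OF F]) (use l 3 in \<open>auto simp: antipode_closed\<close>)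
    then show ?thesis using 3 by (simp add: numeral_2_eq_2)
  qed
qed simp

text \<open>The first two components come from splitting one. The antipode axiom turns them into the
  counit of that one times the unit, and the counit then removes it, so two components
  disappear.\<close>

lemma iter_antipode:
  assumes W: "module K W" and h: "h \<in> carrier H" and F: "multilin H W (Suc (Suc n)) F"
  shows "lsum W (\<lambda>l. F ((S (l ! 0) \<cdot> l ! 1) # drop 2 l)) (iter (Suc (Suc n)) h) =
    lsum W (\<lambda>l. F (\<one>\<^bsub>H\<^esub> # l)) (iter n h)"
proof -
  let ?G = "\<lambda>l. F ((S (l ! 0) \<cdot> l ! 1) # drop 2 l)"
  note G = multilin_antipode [OF F]
  have "lsum W ?G (iter (Suc (Suc n)) h) =
      lsum W (\<lambda>l. lsum W (\<lambda>(a, b). ?G (take 0 l @ [a, b] @ drop (Suc 0) l)) (cop (l ! 0))) (iter (Suc n) h)"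
    by (rule iter_expand [OF W h _ G, symmetric]) simp
  also have "\<dots> = lsum W (\<lambda>l. \<epsilon> (l ! 0) \<odot>\<^bsub>W\<^esub> F (\<one>\<^bsub>H\<^esub> # take 0 l @ drop (Suc 0) l)) (iter (Suc n) h)"
  proof (rule lsum_iter_cong [OF h])
    fix l assume l: "length l = Suc (Suc n)" "set l \<subseteq> carrier H"
    then obtain x k where x: "l = x # k" by (cases l) auto
    have "lsum W (\<lambda>(a, b). F ((S a \<cdot> b) # k)) (cop x) = \<epsilon> x \<odot>\<^bsub>W\<^esub> F (\<one>\<^bsub>H\<^esub> # k)"
      by (rule sweedler_antipode [OF W multilin_hd [OF F]]) (use l x in auto)
    then show "lsum W (\<lambda>(a, b). ?G (take 0 l @ [a, b] @ drop (Suc 0) l)) (cop (l ! 0)) =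
        \<epsilon> (l ! 0) \<odot>\<^bsub>W\<^esub> F (\<one>\<^bsub>H\<^esub> # take 0 l @ drop (Suc 0) l)"
      using x by (simp add: numeral_2_eq_2)
  qed
  also have "\<dots> = lsum W (\<lambda>l. F (\<one>\<^bsub>H\<^esub> # l)) (iter n h)"
    by (rule iter_counit [OF W h]) (use F in \<open>auto intro: multilin_Cons\<close>)
  finally show ?thesis .
qed

end

section \<open>Decomposition into pure tensors and the diagonal action\<close>

context scalars
begin

text \<open>The exponent is positive so that a scalar coefficient can be absorbed into the first
  factor.\<close>

lemma tensor_power_sum:
  assumes V: "module K V" and "t \<in> carrier (tensor_power K V (Suc n))"
  shows "\<exists>xs. set xs \<subseteq> words V (Suc n) \<and> t = lsum (tensor_power K V (Suc n)) (pure K V) xs"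
  using assms(2) unfolding tensor_power_def
proof (induction rule: presented_induct [OF multilinear_rels_closed [OF V], consumes 1, case_names zero step])
  case zero
  show ?case by (intro exI [of _ "[]"]) auto
next
  case (step c x t)
  interpret V: module K V by (rule V)
  obtain v l where x: "x = v # l" "v \<in> carrier V" "set l \<subseteq> carrier V" "length l = n"
    using step(2) by (cases x) (auto simp: words_def)
  obtain xs where xs: "set xs \<subseteq> words V (Suc n)"
    "t = lsum (presented_module K (words V (Suc n)) (multilinear_rels K V (Suc n))) (pure K V) xs"
    using step(4) by auto
  have "pure K V (c \<odot>\<^bsub>V\<^esub> v # l) = c \<odot>\<^bsub>tensor_power K V (Suc n)\<^esub> pure K V (v # l)"
    using linear_smult [OF multilin_slot [OF pure_multilin [OF V], of "[]" l "Suc n"]] x step(1) by simp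
  moreover have "presented_gen K (words V (Suc n)) (multilinear_rels K V (Suc n)) x = pure K V (v # l)"
    using x by (simp add: pure_def)
  moreover have "c \<odot>\<^bsub>V\<^esub> v # l \<in> words V (Suc n)"
    using x step(1) by (simp add: words_def)
  ultimately show ?case
    using xs by (intro exI [of _ "(c \<odot>\<^bsub>V\<^esub> v # l) # xs"]) (simp add: tensor_power_def)
qed

end

context hopf_algebra
begin

lemma set_map2_mult:
  assumes "set l \<subseteq> carrier H" "set g \<subseteq> carrier H"
  shows "set (map2 (\<cdot>) l g) \<subseteq> carrier H"
proof
  fix x assume "x \<in> set (map2 (\<cdot>) l g)"
  then obtain a b where "(a, b) \<in> set (zip l g)" "x = a \<cdot> b" by auto
  then show "x \<in> carrier H"
    using set_zip_leftD [of a b l g] set_zip_rightD [of a b l g] assms by auto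
qed

text \<open>Entrywise multiplication by a fixed word keeps a formula multilinear in the components
  of \<open>h\<close>, as the position lemmas require.\<close>

lemma multilin_map2_right:
  assumes F: "multilin H W n F" and l: "length l = n" "set l \<subseteq> carrier H"
  shows "multilin H W n (\<lambda>g. F (map2 (\<cdot>) l g))"
proof (rule multilinI)
  fix xs ys assume g: "set xs \<subseteq> carrier H" "set ys \<subseteq> carrier H" "length xs + length ys + 1 = n"
  then obtain p y q where y: "l = p @ y # q" "length p = length xs"
    using id_take_nth_drop [of "length xs" l] l by force
  have "(\<lambda>v. F (map2 (\<cdot>) p xs @ (y \<cdot> v) # map2 (\<cdot>) q ys)) \<in> linear_maps K H W"
    by (rule linear_comp [OF mult_left_linear multilin_slot [OF F]])
       (use l g y in \<open>simp_all add: set_map2_mult del: set_map set_zip\<close>)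
  then show "(\<lambda>v. F (map2 (\<cdot>) l (xs @ v # ys))) \<in> linear_maps K H W"
    using y by simp
qed (use multilin_closed [OF F, of "[]"] l in simp)

lemma multilin_map2_left:
  assumes F: "multilin H W n F" and l: "length l = n" "set l \<subseteq> carrier H"
  shows "multilin H W n (\<lambda>g. F (map2 (\<cdot>) g l))"
proof (rule multilinI)
  fix xs ys assume g: "set xs \<subseteq> carrier H" "set ys \<subseteq> carrier H" "length xs + length ys + 1 = n"
  then obtain p y q where y: "l = p @ y # q" "length p = length xs"
    using id_take_nth_drop [of "length xs" l] l by force
  have "(\<lambda>v. F (map2 (\<cdot>) xs p @ (v \<cdot> y) # map2 (\<cdot>) ys q)) \<in> linear_maps K H W"
    by (rule linear_comp [OF mult_right_linear multilin_slot [OF F]])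
       (use l g y in \<open>simp_all add: set_map2_mult del: set_map set_zip\<close>)
  then show "(\<lambda>v. F (map2 (\<cdot>) (xs @ v # ys) l)) \<in> linear_maps K H W"
    using y by simp
qed (use multilin_closed [OF F, of "[]"] in simp)

abbreviation (input) "TP n \<equiv> tensor_power K H (Suc n)"

lemma TP_module: "module K (TP n)"
  by (rule tensor_power_module [OF H_module])

text \<open>The inner \<open>tlift\<close> of \<open>diag_act\<close> needs multilinearity in the
  coproduct word, the outer one in \<open>l\<close>; the latter is checked on the list form, where
  the coproduct words stay fixed.\<close>

lemma
  shows diag_act_pure: "\<lbrakk>h \<in> carrier H; length l = Suc n; set l \<subseteq> carrier H\<rbrakk> \<Longrightarrow> diag_act K H \<Delta> n (pure K H l) h = lsum (TP n) (\<lambda>g. pure K H (map2 (\<cdot>) l g)) (iter n h)"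
    and diag_act_linear: "h \<in> carrier H \<Longrightarrow> (\<lambda>x. diag_act K H \<Delta> n x h) \<in> linear_maps K (TP n) (TP n)"
proof -
  note p = pure_multilin [OF H_module, of "Suc n"]
  let ?F = "\<lambda>h l. tlift K (TP n) (\<lambda>g. pure K H (map2 (\<cdot>) l g)) (iterated_comult K H \<Delta> n h)"
  let ?G = "\<lambda>h l. lsum (TP n) (\<lambda>g. pure K H (map2 (\<cdot>) l g)) (iter n h)"
  have FG: "?F h l = ?G h l" if "length l = Suc n" "set l \<subseteq> carrier H" "h \<in> carrier H" for l h
    by (rule sweedler_iter [OF TP_module multilin_map2_right [OF p]]) (use that in auto)
  have G: "multilin H (TP n) (Suc n) (?G h)" if h: "h \<in> carrier H" for h
    by (intro multilin_lsum TP_module multilin_map2_left p) (use iter_closed [OF h] in auto)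
  have F: "multilin H (TP n) (Suc n) (?F h)" if h: "h \<in> carrier H" for h
    by (rule multilin_cong [OF H_module G [OF h]]) (simp add: FG h)
  note L = tensor_power_lift [OF H_module TP_module F]
  show "\<lbrakk>h \<in> carrier H; length l = Suc n; set l \<subseteq> carrier H\<rbrakk> \<Longrightarrow> diag_act K H \<Delta> n (pure K H l) h = ?G h l"
    unfolding diag_act_def using L(2) [of h l] FG [of l h] by (simp add: words_def)
  show "h \<in> carrier H \<Longrightarrow> (\<lambda>x. diag_act K H \<Delta> n x h) \<in> linear_maps K (TP n) (TP n)"
    unfolding diag_act_def using L(1) by simp
qed

end

section \<open>The modules \<open>Z\<^sub>n(H, M)\<close>\<close>

context hopf_module
begin

lemma M_module: "module K M"
  by unfold_locales

lemma act_closed: "\<lbrakk>h \<in> carrier H; m \<in> carrier M\<rbrakk> \<Longrightarrow> act h m \<in> carrier M"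
  by (rule linear_closed [OF act_linear])

abbreviation "Zn n \<equiv> Z_HM K H \<Delta> M act n"

abbreviation "zt n l m \<equiv> Z_tens K H \<Delta> M act n (pure K H l) m"

abbreviation (input) "brels n \<equiv> balanced_rels K H (TP n) (diag_act K H \<Delta> n) M act"

lemma Zn_eq: "Zn n = presented_module K (carrier (TP n) \<times> carrier M) (brels n)"
  by (simp add: Z_HM_def tensor_over_def)

lemma Z_tens_eq: "Z_tens K H \<Delta> M act n x m = presented_gen K (carrier (TP n) \<times> carrier M) (brels n) (x, m)"
  by (simp add: Z_tens_def tens_over_def)

lemma bilinear_brels: "bilinear_rels K (TP n) M \<subseteq> brels n"
  by (simp add: balanced_rels_def)

lemma brels_closed: "brels n \<subseteq> carrier (free_module K (carrier (TP n) \<times> carrier M))"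
proof -
  interpret F: module K "free_module K (carrier (TP n) \<times> carrier M)" by (rule free_module_is_module)
  show ?thesis
    unfolding balanced_rels_def
    using bilinear_rels_closed [OF TP_module M_module, of n]
    by (auto intro!: F.minus_closed basis_vec_closed linear_closed [OF diag_act_linear] act_closed)
qed

lemma Zn_module: "module K (Zn n)"
  unfolding Zn_eq by (rule presented_is_module [OF brels_closed])

lemma Z_tens_bilin: "bilin (TP n) M (Zn n) (Z_tens K H \<Delta> M act n)"
  unfolding Zn_eq Z_tens_eq by (rule gen_bilin [OF TP_module M_module bilinear_brels brels_closed])

lemma zt_multilin: "m \<in> carrier M \<Longrightarrow> multilin H (Zn n) (Suc n) (\<lambda>l. zt n l m)"
  by (rule multilin_comp [OF pure_multilin [OF H_module] bilin_left [OF Z_tens_bilin]])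

lemma zt_linear:
  "\<lbrakk>length l = Suc n; set l \<subseteq> carrier H\<rbrakk> \<Longrightarrow> (\<lambda>m. zt n l m) \<in> linear_maps K M (Zn n)"
  by (rule bilin_right [OF Z_tens_bilin]) (simp add: pure_closed [OF H_module] words_def)

lemma zt_closed:
  "\<lbrakk>length l = Suc n; set l \<subseteq> carrier H; m \<in> carrier M\<rbrakk> \<Longrightarrow> zt n l m \<in> carrier (Zn n)"
  by (rule linear_closed [OF zt_linear])

lemma Z_tens_balanced:
  assumes "x \<in> carrier (TP n)" "h \<in> carrier H" "m \<in> carrier M"
  shows "Z_tens K H \<Delta> M act n (diag_act K H \<Delta> n x h) m = Z_tens K H \<Delta> M act n x (act h m)"
  unfolding Z_tens_eq
  using assms
  by (intro presented_gen_eq [OF brels_closed])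
     (auto intro!: linear_closed [OF diag_act_linear] act_closed simp: balanced_rels_def)

text \<open>Linearity of \<open>Z_tens\<close> in its first argument takes the sum of the diagonal
  action out of the tensor over \<open>H\<close>, which is where computations with the operators
  meet it.\<close>

lemma zt_balanced:
  assumes l: "length l = Suc n" "set l \<subseteq> carrier H" and h: "h \<in> carrier H" and m: "m \<in> carrier M"
  shows "lsum (Zn n) (\<lambda>g. zt n (map2 (\<cdot>) l g) m) (iter n h) = zt n l (act h m)"
proof -
  have "zt n l (act h m) = Z_tens K H \<Delta> M act n (diag_act K H \<Delta> n (pure K H l) h) m"
    by (rule Z_tens_balanced [symmetric, OF _ h m])
       (simp add: pure_closed [OF H_module] words_def l)
  also have "\<dots> = lsum (Zn n) (\<lambda>g. zt n (map2 (\<cdot>) l g) m) (iter n h)"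
    unfolding diag_act_pure [OF h l]
    by (rule linear_lsum [OF TP_module Zn_module bilin_left [OF Z_tens_bilin m]])
       (use l iter_closed [OF h] in
        \<open>auto intro!: pure_closed [OF H_module] simp: words_def set_map2_mult simp del: set_map set_zip\<close>)
  finally show ?thesis by simp
qed

text \<open>Both sides of the balancing relation are linear in the tensor-power argument, so
  \<open>bal\<close> has to be supplied only on words. Together with linearity in the entries and in
  \<open>m\<close>, this is all that each operator must provide.\<close>

lemma Z_lift:
  assumes W: "module K W"
    and G: "\<And>m. m \<in> carrier M \<Longrightarrow> multilin H W (Suc n) (\<lambda>l. G l m)"
    and G': "\<And>l. \<lbrakk>length l = Suc n; set l \<subseteq> carrier H\<rbrakk> \<Longrightarrow> (\<lambda>m. G l m) \<in> linear_maps K M W"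
    and bal: "\<And>l h m. \<lbrakk>length l = Suc n; set l \<subseteq> carrier H; h \<in> carrier H; m \<in> carrier M\<rbrakk> \<Longrightarrow>
      lsum W (\<lambda>g. G (map2 (\<cdot>) l g) m) (iter n h) = G l (act h m)"
  shows "\<exists>\<phi>. \<phi> \<in> linear_maps K (Zn n) W \<and>
    (\<forall>l m. length l = Suc n \<longrightarrow> set l \<subseteq> carrier H \<longrightarrow> m \<in> carrier M \<longrightarrow> \<phi> (zt n l m) = G l m)"
proof -
  let ?F = "\<lambda>x m. tlift K W (\<lambda>l. G l m) x"
  note L = tensor_power_lift [OF H_module W G]
  have Lp: "?F (pure K H l) m = G l m" if "length l = Suc n" "set l \<subseteq> carrier H" "m \<in> carrier M" for l m
    using L(2) that by (simp add: words_def)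
  have F: "bilin (TP n) M W ?F"
  proof (rule bilinI)
    show "?F x \<in> linear_maps K M W" if x: "x \<in> carrier (TP n)" for x
    proof -
      obtain xs where xs: "set xs \<subseteq> words H (Suc n)" "x = lsum (TP n) (pure K H) xs"
        using tensor_power_sum [OF H_module x] by auto
      \<comment> \<open>Linearity in \<open>m\<close> at a general \<open>x\<close> is seen on a
        decomposition of \<open>x\<close> into pure tensors, fixed while \<open>m\<close>
        varies.\<close>
      have "(\<lambda>m. lsum W (\<lambda>l. G l m) xs) \<in> linear_maps K M W"
        using xs(1) by (intro linear_lsum_pointwise [OF W] G') (auto simp: words_def)
      then show ?thesis
      proof (rule linear_cong [OF M_module])
        fix m assume m: "m \<in> carrier M"
        have "?F x m = lsum W (\<lambda>l. ?F (pure K H l) m) xs"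
          unfolding xs(2) using xs(1)
          by (intro linear_lsum [OF TP_module W L(1) [OF m]]) (auto intro: pure_closed [OF H_module])
        also have "\<dots> = lsum W (\<lambda>l. G l m) xs"
          using xs(1) m by (intro lsum_cong Lp) (auto simp: words_def)
        finally show "lsum W (\<lambda>l. G l m) xs = ?F x m" by simp
      qed
    qed
  qed (rule L(1))
  have b: "?F (diag_act K H \<Delta> n x h) m = ?F x (act h m)"
    if x: "x \<in> carrier (TP n)" and h: "h \<in> carrier H" and m: "m \<in> carrier M" for x h m
  proof (rule tensor_power_linear_eq [OF H_module W _ _ _ x])
    show "(\<lambda>x. ?F (diag_act K H \<Delta> n x h) m) \<in> linear_maps K (TP n) W"
      by (rule linear_comp [OF diag_act_linear [OF h] L(1) [OF m]])
    show "(\<lambda>x. ?F x (act h m)) \<in> linear_maps K (TP n) W"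
      by (rule L(1) [OF act_closed [OF h m]])
    fix l assume "l \<in> words H (Suc n)"
    then have l: "length l = Suc n" "set l \<subseteq> carrier H" by (auto simp: words_def)
    have "?F (diag_act K H \<Delta> n (pure K H l) h) m =
        lsum W (\<lambda>g. ?F (pure K H (map2 (\<cdot>) l g)) m) (iter n h)"
      unfolding diag_act_pure [OF h l]
      by (rule linear_lsum [OF TP_module W L(1) [OF m]])
         (use l iter_closed [OF h] in
          \<open>auto intro!: pure_closed [OF H_module] simp: words_def set_map2_mult simp del: set_map set_zip\<close>)
    also have "\<dots> = lsum W (\<lambda>g. G (map2 (\<cdot>) l g) m) (iter n h)"
      by (intro lsum_iter_cong [OF h] Lp m) (use l in \<open>simp_all add: set_map2_mult del: set_map\<close>)
    also have "\<dots> = ?F (pure K H l) (act h m)"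
      unfolding Lp [OF l act_closed [OF h m]] by (rule bal [OF l h m])
    finally show "?F (diag_act K H \<Delta> n (pure K H l) h) m = ?F (pure K H l) (act h m)" .
  qed
  have "linear_extension W (\<lambda>(x, m). ?F x m) r = \<zero>\<^bsub>W\<^esub>"
    if rel: "r \<in> brels n - bilinear_rels K (TP n) M" for r
  proof -
    obtain x h m where r: "r = basis_vec K (diag_act K H \<Delta> n x h, m)
        \<ominus>\<^bsub>free_module K (carrier (TP n) \<times> carrier M)\<^esub> basis_vec K (x, act h m)"
      and xhm: "x \<in> carrier (TP n)" "h \<in> carrier H" "m \<in> carrier M"
      using rel unfolding balanced_rels_def by blast
    show ?thesis
      unfolding r using xhm
      by (intro linear_extension_eq_rel [OF W])
         (auto simp: b act_closed intro: bilin_closed [OF F] linear_closed [OF diag_act_linear])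
  qed
  note \<phi> = gen_lift [OF TP_module M_module bilinear_brels brels_closed W F this]
  show ?thesis
  proof (intro exI conjI allI impI)
    show "tlift K W (\<lambda>(x, m). ?F x m) \<in> linear_maps K (Zn n) W"
      unfolding Zn_eq by (rule \<phi>(1))
    show "tlift K W (\<lambda>(x, m). ?F x m) (zt n l m) = G l m"
      if l: "length l = Suc n" "set l \<subseteq> carrier H" and m: "m \<in> carrier M" for l m
    proof -
      have "pure K H l \<in> carrier (TP n)"
        using l by (intro pure_closed [OF H_module]) (simp add: words_def)
      then show ?thesis
        unfolding Z_tens_eq by (subst \<phi>(2)) (use m Lp [OF l m] in auto)
    qed
  qed
qed

text \<open>Two spanning arguments in a row: pairs generate the tensor product over
  \<open>H\<close>, and for fixed \<open>m\<close> pure tensors generate the tensor power. Every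
  operator identity is thereby reduced to words.\<close>

lemma Z_linear_eq:
  assumes W: "module K W" and f: "f \<in> linear_maps K (Zn n) W" and g: "g \<in> linear_maps K (Zn n) W"
    and eq: "\<And>l m. \<lbrakk>length l = Suc n; set l \<subseteq> carrier H; m \<in> carrier M\<rbrakk> \<Longrightarrow> f (zt n l m) = g (zt n l m)"
    and z: "z \<in> carrier (Zn n)"
  shows "f z = g z"
proof (rule presented_linear_eq [OF brels_closed [of n] W f[unfolded Zn_eq] g[unfolded Zn_eq] _ z[unfolded Zn_eq]])
  fix p assume "p \<in> carrier (TP n) \<times> carrier M"
  then obtain x m where p: "p = (x, m)" and x: "x \<in> carrier (TP n)" and m: "m \<in> carrier M" by auto
  have "f (Z_tens K H \<Delta> M act n x m) = g (Z_tens K H \<Delta> M act n x m)"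
    by (rule tensor_power_linear_eq [OF H_module W
          linear_comp [OF bilin_left [OF Z_tens_bilin m] f] linear_comp [OF bilin_left [OF Z_tens_bilin m] g] _ x])
       (auto simp: words_def intro: eq m)
  then show "f (presented_gen K (carrier (TP n) \<times> carrier M) (brels n) p) =
      g (presented_gen K (carrier (TP n) \<times> carrier M) (brels n) p)"
    by (simp add: p Z_tens_eq)
qed

end

section \<open>The coaction\<close>

context crossed_module
begin

definition coa :: "'m \<Rightarrow> ('m \<times> 'h) list" where
  "coa m = (SOME xs. set xs \<subseteq> carrier M \<times> carrier H \<and>
     \<rho> m = lsum (tensor K M H) (\<lambda>(m', a). tens K M H m' a) xs)"

lemma coa:
  assumes "m \<in> carrier M"
  shows "set (coa m) \<subseteq> carrier M \<times> carrier H"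
    and "\<rho> m = lsum (tensor K M H) (\<lambda>(m', a). tens K M H m' a) (coa m)"
proof -
  have "\<rho> m \<in> carrier (tensor K M H)"
    by (rule linear_closed [OF coact_linear assms])
  note someI_ex [OF tensor_sum [OF M_module H_module this], folded coa_def]
  then show "set (coa m) \<subseteq> carrier M \<times> carrier H"
    "\<rho> m = lsum (tensor K M H) (\<lambda>(m', a). tens K M H m' a) (coa m)" by blast+
qed

lemma coa_closed:
  assumes "m \<in> carrier M" "(m', a) \<in> set (coa m)"
  shows "m' \<in> carrier M" "a \<in> carrier H"
  using coa(1) [OF assms(1)] assms(2) by auto

lemma coaction:
  assumes "module K W" "bilin M H W F" "m \<in> carrier M"
  shows "tlift K W (\<lambda>(m', a). F m' a) (\<rho> m) = lsum W (\<lambda>(m', a). F m' a) (coa m)"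
  using tensor_lift_lsum [OF M_module H_module assms(1,2) coa(1)] coa(2) assms(3) by simp

lemma coaction_linear:
  assumes "module K W" "bilin M H W F"
  shows "(\<lambda>m. lsum W (\<lambda>(m', a). F m' a) (coa m)) \<in> linear_maps K M W"
  by (rule linear_cong [OF M_module
        linear_comp [OF coact_linear tensor_lift(1) [OF M_module H_module assms]]])
     (rule coaction [OF assms])

lemma coaction_closed:
  assumes "module K W" "m \<in> carrier M"
    "\<And>m' a. \<lbrakk>m' \<in> carrier M; a \<in> carrier H\<rbrakk> \<Longrightarrow> F m' a \<in> carrier W"
  shows "lsum W (\<lambda>(m', a). F m' a) (coa m) \<in> carrier W"
  using coa(1) [OF assms(2)] by (intro lsum_closed [OF assms(1)]) (auto intro: assms(3))

lemma coaction_cong: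
  assumes "m \<in> carrier M" "\<And>m' a. \<lbrakk>m' \<in> carrier M; a \<in> carrier H\<rbrakk> \<Longrightarrow> F m' a = G m' a"
  shows "lsum W (\<lambda>(m', a). F m' a) (coa m) = lsum W (\<lambda>(m', a). G m' a) (coa m)"
  using coa(1) [OF assms(1)] by (intro lsum_cong) (auto intro: assms(2))

lemma linear_coaction:
  assumes V: "module K V" and W: "module K W" and B: "bilin M H V B"
    and f: "f \<in> linear_maps K V W" and m: "m \<in> carrier M"
  shows "f (tlift K V (\<lambda>(m', a). B m' a) (\<rho> m)) = lsum W (\<lambda>(m', a). f (B m' a)) (coa m)"
proof -
  have "f (tlift K V (\<lambda>(m', a). B m' a) (\<rho> m)) = lsum W (\<lambda>p. f (case p of (m', a) \<Rightarrow> B m' a)) (coa m)"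
    unfolding coaction [OF V B m] using coa_closed [OF m] bilin_closed [OF B]
    by (intro linear_lsum [OF V W f]) auto
  then show ?thesis by (simp add: case_prod_unfold)
qed

lemma coaction_counit:
  assumes W: "module K W" and f: "f \<in> linear_maps K M W" and m: "m \<in> carrier M"
  shows "lsum W (\<lambda>(m', a). \<epsilon> a \<odot>\<^bsub>W\<^esub> f m') (coa m) = f m"
proof -
  have B: "bilin M H M (\<lambda>m' a. \<epsilon> a \<odot>\<^bsub>M\<^esub> m')"
    by (intro bilinI counit_scale_linear M_module linear_scale linear_id) (auto simp: counit_closed)
  have "lsum W (\<lambda>(m', a). \<epsilon> a \<odot>\<^bsub>W\<^esub> f m') (coa m) = lsum W (\<lambda>(m', a). f (\<epsilon> a \<odot>\<^bsub>M\<^esub> m')) (coa m)"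
    by (rule coaction_cong [OF m]) (simp add: linear_smult [OF f] counit_closed)
  then show ?thesis
    using linear_coaction [OF M_module W B f m] coact_counit [OF m] by simp
qed

lemma coaction_coassoc:
  assumes W: "module K W" and G: "trilin M H H W G" and m: "m \<in> carrier M"
  shows "lsum W (\<lambda>(m', a). lsum W (\<lambda>(m'', b). G m'' b a) (coa m')) (coa m) =
    lsum W (\<lambda>(m', a). lsum W (\<lambda>(a', a''). G m' a' a'') (cop a)) (coa m)"
  by (rule comodule_coassoc [OF M_module coact_linear conjI [OF coa] W G m coact_coassoc [OF m]])

text \<open>In a word \<open>g\<close> of \<open>iter 2 h\<close> the entries \<open>g ! 0\<close>,
  \<open>g ! 1\<close>, \<open>g ! 2\<close> are h_(1), h_(2), h_(3). The crossed module axiom lives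
  in the tensor product of \<open>M\<close> and \<open>H\<close>, and the map induced by
  \<open>F\<close> carries it to \<open>W\<close>.\<close>

lemma coaction_act:
  assumes W: "module K W" and F: "bilin M H W F" and h: "h \<in> carrier H" and m: "m \<in> carrier M"
  shows "lsum W (\<lambda>(m', a). F m' a) (coa (act h m)) =
    lsum W (\<lambda>g. lsum W (\<lambda>(m', a). F (act (g ! 1) m') (g ! 2 \<cdot> a \<cdot> S (g ! 0))) (coa m)) (iter 2 h)"
proof -
  let ?T = "tensor K M H"
  have T: "module K ?T" by (rule tensor_module [OF M_module H_module])
  note tb = tens_bilin [OF M_module H_module]
  note c = tens_closed [OF M_module H_module]
  let ?t = "\<lambda>g m' a. tens K M H (act (g ! 1) m') (g ! 2 \<cdot> a \<cdot> S (g ! 0))"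
  let ?F = "\<lambda>g. tlift K ?T (\<lambda>(m', a). ?t g m' a) (\<rho> m)"
  let ?G = "\<lambda>g. lsum ?T (\<lambda>(m', a). ?t g m' a) (coa m)"
  have len3: "\<exists>x y z. g = [x, y, z]" if "length g = Suc (Suc (Suc 0))" for g :: "'h list"
    using that by (auto simp: length_Suc_conv)
  have tc: "?t g m' a \<in> carrier ?T"
    if "length g = Suc (Suc (Suc 0))" "set g \<subseteq> carrier H" "m' \<in> carrier M" "a \<in> carrier H" for g m' a
    using that len3 [OF that(1)] by (auto intro!: c act_closed antipode_closed)
  have bt: "bilin M H ?T (?t g)" if g: "length g = Suc (Suc (Suc 0))" "set g \<subseteq> carrier H" for g
  proof -
    obtain x y z where g: "g = [x, y, z]" "x \<in> carrier H" "y \<in> carrier H" "z \<in> carrier H"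
      using len3 [OF g(1)] g(2) by auto
    show ?thesis
    proof (rule bilinI)
      show "(\<lambda>m'. ?t g m' a) \<in> linear_maps K M ?T" if "a \<in> carrier H" for a
        by (rule linear_comp [OF act_linear bilin_left [OF tb]]) (use g that in \<open>auto simp: antipode_closed\<close>)
      show "?t g m' \<in> linear_maps K H ?T" if "m' \<in> carrier M" for m'
        by (rule linear_comp [OF linear_comp [OF mult_left_linear mult_right_linear] bilin_right [OF tb]])
           (use g that in \<open>auto simp: antipode_closed act_closed\<close>)
    qed
  qed
  have FG: "?F g = ?G g" if "length g = Suc (Suc (Suc 0))" "set g \<subseteq> carrier H" for g
    by (rule coaction [OF T bt [OF that] m])
  \<comment> \<open>Needed to evaluate the outer \<open>tlift\<close> on the iterated coproduct. The
    slots are linear for different reasons: h_(1) through \<open>S\<close>, h_(2) through the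
    action, h_(3) through multiplication.\<close>
  have mt: "multilin H ?T (Suc (Suc (Suc 0))) (\<lambda>g. ?t g m' a)" if ma: "m' \<in> carrier M" "a \<in> carrier H" for m' a
  proof (rule multilinI)
    fix xs ys assume l: "set xs \<subseteq> carrier H" "set ys \<subseteq> carrier H" "length xs + length ys + 1 = Suc (Suc (Suc 0))"
    consider x y where "xs = []" "ys = [x, y]" | x y where "xs = [x]" "ys = [y]" | x y where "xs = [x, y]" "ys = []"
      using l(3) by (cases xs; cases ys; cases "tl xs"; cases "tl ys") auto
    then show "(\<lambda>v. ?t (xs @ v # ys) m' a) \<in> linear_maps K H ?T"
    proof cases
      case 1
      have "(\<lambda>v. tens K M H (act x m') (y \<cdot> a \<cdot> S v)) \<in> linear_maps K H ?T"
        by (rule linear_comp [OF linear_comp [OF antipode_linear mult_left_linear] bilin_right [OF tb]])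
           (use l 1 ma in \<open>auto simp: act_closed\<close>)
      then show ?thesis using 1 by simp
    next
      case 2
      have "(\<lambda>v. tens K M H (act v m') (y \<cdot> a \<cdot> S x)) \<in> linear_maps K H ?T"
        by (rule linear_comp [OF act_linear' bilin_left [OF tb]])
           (use l 2 ma in \<open>auto simp: antipode_closed\<close>)
      then show ?thesis using 2 by simp
    next
      case 3
      have "(\<lambda>v. tens K M H (act y m') (v \<cdot> a \<cdot> S x)) \<in> linear_maps K H ?T"
        by (rule linear_comp [OF linear_comp [OF mult_right_linear mult_right_linear] bilin_right [OF tb]])
           (use l 3 ma in \<open>auto simp: act_closed antipode_closed\<close>)
      then show ?thesis using 3 by simp
    qed
  qed simp
  have "multilin H ?T (Suc (Suc (Suc 0))) ?G"
  proof (rule multilin_lsum [OF T])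
    fix p assume "p \<in> set (coa m)"
    then obtain m' a where "p = (m', a)" "m' \<in> carrier M" "a \<in> carrier H"
      using coa(1) [OF m] by blast
    then show "multilin H ?T (Suc (Suc (Suc 0))) (\<lambda>g. case p of (m', a) \<Rightarrow> ?t g m' a)"
      using mt by (simp only: prod.case)
  qed
  then have "multilin H ?T (Suc (Suc (Suc 0))) ?F"
    by (rule multilin_cong [OF H_module]) (rule FG [symmetric])
  then have mF: "multilin H ?T (Suc 2) ?F"
    by (simp only: numeral_2_eq_2)
  have "\<rho> (act h m) = lsum ?T ?F (iter 2 h)"
    unfolding coact_act [OF h m] by (rule sweedler_iter [OF T mF h])
  also have "\<dots> = lsum ?T ?G (iter 2 h)"
    by (rule lsum_iter_cong [OF h FG]) simp_all
  finally have eq: "\<rho> (act h m) = lsum ?T ?G (iter 2 h)" .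
  note L = tensor_lift [OF M_module H_module W F]
  have it: "length g = Suc (Suc (Suc 0))" "set g \<subseteq> carrier H" if "g \<in> set (iter 2 h)" for g
    using iter_closed [OF h that] by simp_all
  have "lsum W (\<lambda>(m', a). F m' a) (coa (act h m)) = tlift K W (\<lambda>(m', a). F m' a) (\<rho> (act h m))"
    by (rule coaction [OF W F act_closed [OF h m], symmetric])
  also have "\<dots> = lsum W (\<lambda>g. tlift K W (\<lambda>(m', a). F m' a) (?G g)) (iter 2 h)"
    unfolding eq by (rule linear_lsum [OF T W L(1)], rule coaction_closed [OF T m], rule tc [OF it])
  also have "\<dots> = lsum W (\<lambda>g. lsum W (\<lambda>(m', a). F (act (g ! 1) m') (g ! 2 \<cdot> a \<cdot> S (g ! 0))) (coa m)) (iter 2 h)"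
  proof (rule lsum_cong)
    fix g assume "g \<in> set (iter 2 h)"
    note g = it [OF this]
    have gc: "g ! 0 \<in> carrier H" "g ! 1 \<in> carrier H" "g ! 2 \<in> carrier H"
      using g by (auto simp: subset_iff)
    have "tlift K W (\<lambda>(m', a). F m' a) (?G g) =
        lsum W (\<lambda>x. tlift K W (\<lambda>(m', a). F m' a) (case x of (m', a) \<Rightarrow> ?t g m' a)) (coa m)"
      using coa_closed [OF m] gc
      by (intro linear_lsum [OF T W L(1)]) (auto intro!: c act_closed antipode_closed)
    also have "\<dots> = lsum W (\<lambda>(m', a). F (act (g ! 1) m') (g ! 2 \<cdot> a \<cdot> S (g ! 0))) (coa m)"
      using coa_closed [OF m] gc by (intro lsum_cong) (auto intro!: L(2) act_closed antipode_closed)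
    finally show "tlift K W (\<lambda>(m', a). F m' a) (?G g) =
        lsum W (\<lambda>(m', a). F (act (g ! 1) m') (g ! 2 \<cdot> a \<cdot> S (g ! 0))) (coa m)" .
  qed
  finally show ?thesis .
qed

end

context modular_crossed_module
begin

lemma coaction_modular:
  assumes W: "module K W" and f: "f \<in> linear_maps K M W" and m: "m \<in> carrier M"
  shows "lsum W (\<lambda>(m', a). f (act a m')) (coa m) = f m"
proof -
  have B: "bilin M H M (\<lambda>m' a. act a m')"
    by (intro bilinI act_linear act_linear')
  show ?thesis
    using linear_coaction [OF M_module W B f m] modular [OF m] by simp
qed

end

context hopf_module
begin

section \<open>Well-definedness of the operators\<close>

text \<open>\<epsilon> is multiplicative, so the weight of a product entry splits into the weight of
  \<open>l ! i\<close> and that of \<open>g ! i\<close>. The second factor deletes one component of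
  the coproduct of \<open>h\<close>, and the rest acts on the shortened word.\<close>

lemma face_exists:
  assumes i: "i \<le> Suc n"
  shows "\<exists>\<phi>. \<phi> \<in> linear_maps K (Zn (Suc n)) (Zn n) \<and>
    (\<forall>l m. length l = Suc (Suc n) \<longrightarrow> set l \<subseteq> carrier H \<longrightarrow> m \<in> carrier M \<longrightarrow>
      \<phi> (zt (Suc n) l m) = \<epsilon> (l ! i) \<odot>\<^bsub>Zn n\<^esub> zt n (take i l @ drop (Suc i) l) m)"
proof (rule Z_lift [OF Zn_module])
  interpret Z: module K "Zn n" by (rule Zn_module)
  let ?G = "\<lambda>l m. \<epsilon> (l ! i) \<odot>\<^bsub>Zn n\<^esub> zt n (take i l @ drop (Suc i) l) m"
  fix m assume m: "m \<in> carrier M"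
  have F: "multilin H (Zn n) (Suc n + 0) (\<lambda>l. zt n l m)" using zt_multilin [OF m] by simp
  show "multilin H (Zn n) (Suc (Suc n)) (\<lambda>l. ?G l m)"
  proof -
    \<comment> \<open>Deletion is substitution of the empty word, hence block length 0.\<close>
    have "multilin H (Zn n) (Suc (Suc n)) (\<lambda>l. \<epsilon> (l ! i) \<odot>\<^bsub>Zn n\<^esub> zt n (take i l @ [] @ drop (Suc i) l) m)"
      by (rule multilin_subst [OF H_module F i, where \<Phi> = "\<lambda>G x. \<epsilon> x \<odot>\<^bsub>Zn n\<^esub> G []"])
         (simp_all add: counit_scale_linear Zn_module linear_scale counit_closed multilin_closed)
    then show ?thesis by simp
  qed
next
  fix l assume l: "length l = Suc (Suc n)" "set l \<subseteq> carrier H"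
  let ?G = "\<lambda>l m. \<epsilon> (l ! i) \<odot>\<^bsub>Zn n\<^esub> zt n (take i l @ drop (Suc i) l) m"
  let ?l = "take i l @ drop (Suc i) l"
  have x: "l ! i \<in> carrier H" using l i by (auto simp: subset_iff)
  have l': "length ?l = Suc n" "set ?l \<subseteq> carrier H"
    using l i by (simp_all add: set_take_le set_drop_le)
  show "?G l \<in> linear_maps K M (Zn n)"
    by (intro linear_scale Zn_module zt_linear l' counit_closed x)
  fix h m assume h: "h \<in> carrier H" and m: "m \<in> carrier M"
  let ?F = "\<lambda>g. zt n (map2 (\<cdot>) ?l g) m"
  have F: "multilin H (Zn n) (Suc n) ?F"
    by (rule multilin_map2_right [OF zt_multilin [OF m] l'])
  have "lsum (Zn n) (\<lambda>g. ?G (map2 (\<cdot>) l g) m) (iter (Suc n) h) =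
      lsum (Zn n) (\<lambda>g. \<epsilon> (l ! i) \<odot>\<^bsub>Zn n\<^esub> (\<epsilon> (g ! i) \<odot>\<^bsub>Zn n\<^esub> ?F (take i g @ drop (Suc i) g))) (iter (Suc n) h)"
  proof (rule lsum_iter_cong [OF h])
    fix g assume g: "length g = Suc (Suc n)" "set g \<subseteq> carrier H"
    interpret Z: module K "Zn n" by (rule Zn_module)
    have y: "g ! i \<in> carrier H" using g i by (auto simp: subset_iff)
    have "take i (map2 (\<cdot>) l g) @ drop (Suc i) (map2 (\<cdot>) l g) =
        map2 (\<cdot>) ?l (take i g @ drop (Suc i) g)"
      using l g i by (simp add: take_map drop_map take_zip drop_zip)
    moreover have "map2 (\<cdot>) l g ! i = l ! i \<cdot> g ! i"
      using l g i by simp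
    moreover have "?F (take i g @ drop (Suc i) g) \<in> carrier (Zn n)"
      by (rule multilin_closed [OF F]) (use g i in \<open>simp_all add: set_take_le set_drop_le\<close>)
    ultimately show "?G (map2 (\<cdot>) l g) m =
        \<epsilon> (l ! i) \<odot>\<^bsub>Zn n\<^esub> (\<epsilon> (g ! i) \<odot>\<^bsub>Zn n\<^esub> ?F (take i g @ drop (Suc i) g))"
      using x y by (simp add: counit_mult counit_closed Z.smult_assoc1)
  qed
  also have "\<dots> = \<epsilon> (l ! i) \<odot>\<^bsub>Zn n\<^esub>
      lsum (Zn n) (\<lambda>g. \<epsilon> (g ! i) \<odot>\<^bsub>Zn n\<^esub> ?F (take i g @ drop (Suc i) g)) (iter (Suc n) h)"
  proof (rule smult_lsum [OF Zn_module, symmetric])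
    fix g assume "g \<in> set (iter (Suc n) h)"
    note g = iter_closed [OF h this]
    interpret Z: module K "Zn n" by (rule Zn_module)
    have "g ! i \<in> carrier H" using g i by (auto simp: subset_iff)
    moreover have "?F (take i g @ drop (Suc i) g) \<in> carrier (Zn n)"
      by (rule multilin_closed [OF F]) (use g i in \<open>simp_all add: set_take_le set_drop_le\<close>)
    ultimately show "\<epsilon> (g ! i) \<odot>\<^bsub>Zn n\<^esub> ?F (take i g @ drop (Suc i) g) \<in> carrier (Zn n)"
      by (intro Z.smult_closed counit_closed)
  qed (rule counit_closed [OF x])
  also have "lsum (Zn n) (\<lambda>g. \<epsilon> (g ! i) \<odot>\<^bsub>Zn n\<^esub> ?F (take i g @ drop (Suc i) g)) (iter (Suc n) h) =
      lsum (Zn n) ?F (iter n h)"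
    by (rule iter_counit [OF Zn_module h i F])
  also have "\<dots> = zt n ?l (act h m)"
    by (rule zt_balanced [OF l' h m])
  finally show "lsum (Zn n) (\<lambda>g. ?G (map2 (\<cdot>) l g) m) (iter (Suc n) h) = ?G l (act h m)" .
qed

text \<open>\<Delta> is multiplicative, so splitting the product of \<open>l ! i\<close> and
  \<open>g ! i\<close> splits both factors. For a fixed splitting of \<open>l ! i\<close>, the
  splitting of \<open>g ! i\<close> just lengthens the coproduct of \<open>h\<close> by one
  component.\<close>

lemma degen_exists:
  assumes i: "i \<le> n"
  shows "\<exists>\<phi>. \<phi> \<in> linear_maps K (Zn n) (Zn (Suc n)) \<and>
    (\<forall>l m. length l = Suc n \<longrightarrow> set l \<subseteq> carrier H \<longrightarrow> m \<in> carrier M \<longrightarrow>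
      \<phi> (zt n l m) = lsum (Zn (Suc n))
        (\<lambda>(a, b). zt (Suc n) (take i l @ [a, b] @ drop (Suc i) l) m) (cop (l ! i)))"
proof (rule Z_lift [OF Zn_module])
  let ?Z = "Zn (Suc n)"
  let ?G = "\<lambda>l m. lsum ?Z (\<lambda>(a, b). zt (Suc n) (take i l @ [a, b] @ drop (Suc i) l) m) (cop (l ! i))"
  fix m assume m: "m \<in> carrier M"
  have F: "multilin H ?Z (n + 2) (\<lambda>l. zt (Suc n) l m)" using zt_multilin [OF m, of "Suc n"] by simp
  have b: "bilin H H ?Z (\<lambda>a b. G [a, b])" if G: "multilin H ?Z 2 G" for G
    using multilin_slot [OF G, of "[]" "[_]"] multilin_slot [OF G, of "[_]" "[]"]
    by (intro bilinI) auto
  show "multilin H ?Z (Suc n) (\<lambda>l. ?G l m)"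
  proof (rule multilin_subst [OF H_module F i, where \<Phi> = "\<lambda>G x. lsum ?Z (\<lambda>(a, b). G [a, b]) (cop x)"])
    show "(\<lambda>x. lsum ?Z (\<lambda>(a, b). G [a, b]) (cop x)) \<in> linear_maps K H ?Z" if "multilin H ?Z 2 G" for G
      by (rule sweedler_linear [OF Zn_module b [OF that]])
    show "(\<lambda>v. lsum ?Z (\<lambda>(a, b). G v [a, b]) (cop x)) \<in> linear_maps K H ?Z"
      if "\<And>l. \<lbrakk>length l = 2; set l \<subseteq> carrier H\<rbrakk> \<Longrightarrow> (\<lambda>v. G v l) \<in> linear_maps K H ?Z" "x \<in> carrier H" for G x
      using cop_closed [OF that(2)]
      by (intro linear_lsum_pointwise [OF Zn_module]) (auto intro!: that(1))
  qed
next
  let ?Z = "Zn (Suc n)"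
  let ?G = "\<lambda>l m. lsum ?Z (\<lambda>(a, b). zt (Suc n) (take i l @ [a, b] @ drop (Suc i) l) m) (cop (l ! i))"
  fix l assume l: "length l = Suc n" "set l \<subseteq> carrier H"
  have x: "l ! i \<in> carrier H" using l i by (auto simp: subset_iff)
  have l': "length (take i l @ [a, b] @ drop (Suc i) l) = Suc (Suc n)"
    "set (take i l @ [a, b] @ drop (Suc i) l) \<subseteq> carrier H" if "a \<in> carrier H" "b \<in> carrier H" for a b
    using l i that by (simp_all add: set_take_le set_drop_le)
  show "?G l \<in> linear_maps K M ?Z"
  proof (rule linear_lsum_pointwise [OF Zn_module])
    fix p assume "p \<in> set (cop (l ! i))"
    then obtain a b where p: "p = (a, b)" and ab: "a \<in> carrier H" "b \<in> carrier H"
      using cop(1) [OF x] by blast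
    show "(\<lambda>m. case p of (a, b) \<Rightarrow> zt (Suc n) (take i l @ [a, b] @ drop (Suc i) l) m) \<in> linear_maps K M ?Z"
      unfolding p prod.case by (rule zt_linear [OF l' [OF ab]])
  qed
  fix h m assume h: "h \<in> carrier H" and m: "m \<in> carrier M"
  let ?F = "\<lambda>a b g. zt (Suc n) (map2 (\<cdot>) (take i l @ [a, b] @ drop (Suc i) l) g) m"
  have F: "multilin H ?Z (Suc (Suc n)) (?F a b)" if "a \<in> carrier H" "b \<in> carrier H" for a b
    by (rule multilin_map2_right [OF zt_multilin [OF m] l' [OF that]])
  let ?E = "\<lambda>a b g. lsum ?Z (\<lambda>(a', b'). ?F a b (take i g @ [a', b'] @ drop (Suc i) g)) (cop (g ! i))"
  have "lsum ?Z (\<lambda>g. ?G (map2 (\<cdot>) l g) m) (iter n h) =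
      lsum ?Z (\<lambda>g. lsum ?Z (\<lambda>p. case p of (a, b) \<Rightarrow> ?E a b g) (cop (l ! i))) (iter n h)"
  proof (rule lsum_iter_cong [OF h])
    fix g assume g: "length g = Suc n" "set g \<subseteq> carrier H"
    have y: "g ! i \<in> carrier H" using g i by (auto simp: subset_iff)
    let ?t = "take i (map2 (\<cdot>) l g)" and ?d = "drop (Suc i) (map2 (\<cdot>) l g)"
    have td: "length ?t + Suc (length ?d) = Suc n" "set ?t \<subseteq> carrier H" "set ?d \<subseteq> carrier H"
      using l g i set_map2_mult [OF l(2) g(2)] by (simp_all add: set_take_le set_drop_le del: set_map)
    have eq: "?t @ [a \<cdot> a', b \<cdot> b'] @ ?d =
        map2 (\<cdot>) (take i l @ [a, b] @ drop (Suc i) l) (take i g @ [a', b'] @ drop (Suc i) g)" for a b a' b'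
      using l g i by (simp add: take_map drop_map take_zip drop_zip)
    have b: "bilin H H ?Z (\<lambda>a b. zt (Suc n) (?t @ [a, b] @ ?d) m)"
    proof (rule bilinI)
      show "(\<lambda>a. zt (Suc n) (?t @ [a, b] @ ?d) m) \<in> linear_maps K H ?Z" if "b \<in> carrier H" for b
        using multilin_slot [OF zt_multilin [OF m], of ?t "b # ?d" "Suc n"] td that by simp
      show "(\<lambda>b. zt (Suc n) (?t @ [a, b] @ ?d) m) \<in> linear_maps K H ?Z" if "a \<in> carrier H" for a
        using multilin_slot [OF zt_multilin [OF m], of "?t @ [a]" ?d "Suc n"] td that by simp
    qed
    have "map2 (\<cdot>) l g ! i = l ! i \<cdot> g ! i"
      using l g i by simp
    then have "?G (map2 (\<cdot>) l g) m =
        lsum ?Z (\<lambda>(a, b). zt (Suc n) (?t @ [a, b] @ ?d) m) (cop (l ! i \<cdot> g ! i))"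
      by simp
    also have "\<dots> = lsum ?Z (\<lambda>p. case p of (a, b) \<Rightarrow> ?E a b g) (cop (l ! i))"
      unfolding sweedler_mult [OF Zn_module b x y] eq ..
    finally show "?G (map2 (\<cdot>) l g) m = lsum ?Z (\<lambda>p. case p of (a, b) \<Rightarrow> ?E a b g) (cop (l ! i))" .
  qed
  \<comment> \<open>The sum over the components of \<open>h\<close> is moved inside, because the
    expansion in one position concerns a single integrand, here the one with \<open>(a, b)\<close>
    fixed.\<close>
  also have "\<dots> = lsum ?Z (\<lambda>p. lsum ?Z (\<lambda>g. case p of (a, b) \<Rightarrow> ?E a b g) (iter n h)) (cop (l ! i))"
  proof (rule lsum_swap [OF Zn_module])
    fix g p assume "g \<in> set (iter n h)" "p \<in> set (cop (l ! i))"
    then obtain a b where p: "p = (a, b)" "a \<in> carrier H" "b \<in> carrier H"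
      and g: "length g = Suc n" "set g \<subseteq> carrier H"
      using cop(1) [OF x] iter_closed [OF h] by blast
    show "(case p of (a, b) \<Rightarrow> ?E a b g) \<in> carrier ?Z"
      unfolding p prod.case by (rule expand_closed [OF Zn_module F [OF p(2,3)] i g])
  qed
  also have "\<dots> = ?G l (act h m)"
  proof (rule lsum_cong)
    fix p assume "p \<in> set (cop (l ! i))"
    then obtain a b where p: "p = (a, b)" and ab: "a \<in> carrier H" "b \<in> carrier H"
      using cop(1) [OF x] by blast
    have "lsum ?Z (\<lambda>g. ?E a b g) (iter n h) = lsum ?Z (?F a b) (iter (Suc n) h)"
      by (rule iter_expand [OF Zn_module h i F [OF ab]])
    also have "\<dots> = zt (Suc n) (take i l @ [a, b] @ drop (Suc i) l) (act h m)"
      by (rule zt_balanced [OF l' [OF ab] h m])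
    finally show "lsum ?Z (\<lambda>g. case p of (a, b) \<Rightarrow> ?E a b g) (iter n h) =
        (case p of (a, b) \<Rightarrow> zt (Suc n) (take i l @ [a, b] @ drop (Suc i) l) (act h m))"
      by (simp only: p prod.case)
  qed
  finally show "lsum ?Z (\<lambda>g. ?G (map2 (\<cdot>) l g) m) (iter n h) = ?G l (act h m)" .
qed

end

context crossed_module
begin

lemma rotate_bilin:
  assumes l: "length l = n" "set l \<subseteq> carrier H" and y: "y \<in> carrier H"
  shows "bilin M H (Zn n) (\<lambda>m a. zt n ((y \<cdot> a) # l) m)"
proof (rule bilinI)
  show "(\<lambda>m. zt n ((y \<cdot> a) # l) m) \<in> linear_maps K M (Zn n)" if "a \<in> carrier H" for a
    by (rule zt_linear) (use l y that in auto)
  show "(\<lambda>a. zt n ((y \<cdot> a) # l) m) \<in> linear_maps K H (Zn n)" if "m \<in> carrier M" for m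
    by (rule linear_comp [OF mult_left_linear [OF y] multilin_hd [OF zt_multilin [OF that] l]])
qed

text \<open>The varying slot is either the last entry, which goes to the front and is multiplied by
  \<open>a\<close>, or an earlier one, which moves one place to the right.\<close>

lemma rotate_multilin:
  assumes F: "multilin H W (Suc n) F" and a: "a \<in> carrier H"
  shows "multilin H W (Suc n) (\<lambda>l. F ((l ! n \<cdot> a) # take n l))"
proof (rule multilinI)
  fix xs ys assume l: "set xs \<subseteq> carrier H" "set ys \<subseteq> carrier H" "length xs + length ys + 1 = Suc n"
  show "(\<lambda>v. F (((xs @ v # ys) ! n \<cdot> a) # take n (xs @ v # ys))) \<in> linear_maps K H W"
  proof (cases ys rule: rev_cases)
    case Nil
    have "(\<lambda>v. F ((v \<cdot> a) # xs)) \<in> linear_maps K H W"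
      by (rule linear_comp [OF mult_right_linear [OF a] multilin_hd [OF F]]) (use l Nil in auto)
    then show ?thesis using l Nil by (simp add: nth_append)
  next
    case (snoc zs y)
    have "(\<lambda>v. F (((y \<cdot> a) # xs) @ v # zs)) \<in> linear_maps K H W"
      by (rule multilin_slot [OF F]) (use l snoc a in auto)
    moreover have "(xs @ v # ys) ! n = y" "take n (xs @ v # ys) = xs @ v # zs" for v
    proof -
      have "n = length (xs @ v # zs)" using l(3) snoc by simp
      moreover have "xs @ v # ys = (xs @ v # zs) @ [y]" using snoc by simp
      ultimately show "(xs @ v # ys) ! n = y" "take n (xs @ v # ys) = xs @ v # zs"
        by (metis nth_append_length, metis append_eq_conv_conj)
    qed
    ultimately show ?thesis by simp
  qed
qed simp

text \<open>With \<open>q = [S(h\<^sub>(\<^sub>1\<^sub>)) h\<^sub>(\<^sub>2\<^sub>), h\<^sub>(\<^sub>3\<^sub>), \<dots>, h\<^sub>(\<^sub>n\<^sub>+\<^sub>3\<^sub>)]\<close> this is the shape of \<open>\<tau>\<^sub>n(\<dots> \<otimes>\<^sub>H h m)\<close> after \<open>h\<^sub>(\<^sub>2\<^sub>)\<close> has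
  been moved back across \<open>\<otimes>\<^sub>H\<close>.\<close>

lemma twist_multilin:
  assumes l: "length l = n" "set l \<subseteq> carrier H" and y: "y \<in> carrier H" and a: "a \<in> carrier H"
    and F: "multilin H W (Suc n) F"
  shows "multilin H W (Suc (Suc n))
    (\<lambda>q. F ((y \<cdot> (q ! Suc n \<cdot> a \<cdot> q ! 0)) # map2 (\<cdot>) l (take n (tl q))))"
    (is "multilin H W _ ?E")
proof (rule multilinI)
  fix xs ys assume q: "set xs \<subseteq> carrier H" "set ys \<subseteq> carrier H" "length xs + length ys + 1 = Suc (Suc n)"
  have E: "?E (x # k @ [z]) = F ((y \<cdot> (z \<cdot> a \<cdot> x)) # map2 (\<cdot>) l k)"
    if "length k = n" for x z k
    using that by (simp add: nth_append)
  show "(\<lambda>v. ?E (xs @ v # ys)) \<in> linear_maps K H W"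
  \<comment> \<open>The slot is the first entry, the last one, or lies in the block between them,
    where the entrywise product with \<open>l\<close> is multilinear.\<close>
  proof (cases xs)
    case Nil
    then obtain k z where k: "ys = k @ [z]" "length k = n"
      using q by (cases ys rule: rev_cases) auto
    have "(\<lambda>v. F ((y \<cdot> (z \<cdot> a \<cdot> v)) # map2 (\<cdot>) l k)) \<in> linear_maps K H W"
      by (rule linear_comp [OF linear_comp [OF mult_left_linear mult_left_linear] multilin_hd [OF F]])
         (use l y a q k in \<open>simp_all add: set_map2_mult del: set_map\<close>)
    then show ?thesis using E [OF k(2)] Nil k(1) by simp
  next
    case (Cons x xs')
    show ?thesis
    proof (cases ys rule: rev_cases)
      case Nil
      have "(\<lambda>v. F ((y \<cdot> (v \<cdot> a \<cdot> x)) # map2 (\<cdot>) l xs')) \<in> linear_maps K H W"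
        by (rule linear_comp [OF linear_comp [OF linear_comp [OF mult_right_linear mult_right_linear]
              mult_left_linear] multilin_hd [OF F]])
           (use l y a q Nil Cons in \<open>simp_all add: set_map2_mult del: set_map\<close>)
      then show ?thesis using E [of xs'] Nil Cons q(3) by simp
    next
      case (snoc ys' z)
      have "multilin H W n (\<lambda>k. F ((y \<cdot> (z \<cdot> a \<cdot> x)) # map2 (\<cdot>) l k))"
        by (rule multilin_map2_right [OF multilin_Cons [OF F] l]) (use y a q snoc Cons in auto)
      then have "(\<lambda>v. F ((y \<cdot> (z \<cdot> a \<cdot> x)) # map2 (\<cdot>) l (xs' @ v # ys'))) \<in> linear_maps K H W"
        by (rule multilin_slot) (use q snoc Cons in auto)
      moreover have "?E (xs @ v # ys) = F ((y \<cdot> (z \<cdot> a \<cdot> x)) # map2 (\<cdot>) l (xs' @ v # ys'))" for v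
        using E [of "xs' @ v # ys'" x z] q snoc Cons by simp
      ultimately show ?thesis by simp
    qed
  qed
qed simp

text \<open>The chain for balancedness starts from \<open>act h m\<close>, since the crossed module
  axiom rewrites the coaction of such an element. The sum over \<open>coa m\<close> is then moved
  outside, so that for a fixed pair the components of \<open>h\<close> can be treated by the
  position lemmas.\<close>

lemma cyc_exists:
  "\<exists>\<phi>. \<phi> \<in> linear_maps K (Zn n) (Zn n) \<and>
    (\<forall>l m. length l = Suc n \<longrightarrow> set l \<subseteq> carrier H \<longrightarrow> m \<in> carrier M \<longrightarrow>
      \<phi> (zt n l m) = lsum (Zn n) (\<lambda>(m', a). zt n ((l ! n \<cdot> a) # take n l) m') (coa m))"
proof (rule Z_lift [OF Zn_module])
  fix m assume m: "m \<in> carrier M"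
  show "multilin H (Zn n) (Suc n) (\<lambda>l. lsum (Zn n) (\<lambda>(m', a). zt n ((l ! n \<cdot> a) # take n l) m') (coa m))"
  proof (rule multilin_lsum [OF Zn_module])
    fix p assume "p \<in> set (coa m)"
    then obtain m' a where p: "p = (m', a)" "m' \<in> carrier M" "a \<in> carrier H"
      using coa(1) [OF m] by blast
    show "multilin H (Zn n) (Suc n) (\<lambda>l. case p of (m', a) \<Rightarrow> zt n ((l ! n \<cdot> a) # take n l) m')"
      unfolding p prod.case by (rule rotate_multilin [OF zt_multilin [OF p(2)] p(3)])
  qed
next
  fix l assume l: "length l = Suc n" "set l \<subseteq> carrier H"
  let ?Z = "Zn n" and ?y = "l ! n" and ?l = "take n l"
  have y: "?y \<in> carrier H" using l by (auto simp: subset_iff)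
  have l': "length ?l = n" "set ?l \<subseteq> carrier H" using l by (simp_all add: set_take_le)
  let ?G = "\<lambda>l m. lsum ?Z (\<lambda>(m', a). zt n ((l ! n \<cdot> a) # take n l) m') (coa m)"
  show "?G l \<in> linear_maps K M ?Z"
    by (rule coaction_linear [OF Zn_module rotate_bilin [OF l' y]])
  fix h m assume h: "h \<in> carrier H" and m: "m \<in> carrier M"
  let ?E = "\<lambda>m' a q. zt n ((?y \<cdot> (q ! Suc n \<cdot> a \<cdot> q ! 0)) # map2 (\<cdot>) ?l (take n (tl q))) m'"
  have E: "multilin H ?Z (Suc (Suc n)) (?E m' a)" if "m' \<in> carrier M" "a \<in> carrier H" for m' a
    by (rule twist_multilin [OF l' y that(2) zt_multilin [OF that(1)]])
  \<comment> \<open>The argument of \<open>?F m' a\<close> consists of h_(1), ..., h_(n+3). The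
    first two are merged through the antipode, the last one is what was h_(3) before the middle
    component was expanded.\<close>
  let ?F = "\<lambda>m' a q. ?E m' a ((S (q ! 0) \<cdot> q ! 1) # drop 2 q)"
  have F: "multilin H ?Z (Suc (Suc (Suc n))) (?F m' a)" if "m' \<in> carrier M" "a \<in> carrier H" for m' a
    by (rule multilin_antipode [OF E [OF that]])
  have pairs: "\<exists>m' a. p = (m', a) \<and> m' \<in> carrier M \<and> a \<in> carrier H" if "p \<in> set (coa m)" for p
    using coa(1) [OF m] that by blast
  have len3: "\<exists>x z w. g = [x, z, w] \<and> x \<in> carrier H \<and> z \<in> carrier H \<and> w \<in> carrier H"
    if "length g = Suc 2" "set g \<subseteq> carrier H" for g
    using that by (auto simp: numeral_2_eq_2 length_Suc_conv)
  have "?G l (act h m) = lsum ?Z (\<lambda>g. lsum ?Z (\<lambda>(m', a).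
      zt n ((?y \<cdot> (g ! 2 \<cdot> a \<cdot> S (g ! 0))) # ?l) (act (g ! 1) m')) (coa m)) (iter 2 h)"
    by (rule coaction_act [OF Zn_module rotate_bilin [OF l' y] h m])
  also have "\<dots> = lsum ?Z (\<lambda>g. lsum ?Z (\<lambda>(m', a).
      lsum ?Z (\<lambda>k. ?F m' a (take 1 g @ k @ drop (Suc 1) g)) (iter n (g ! 1))) (coa m)) (iter 2 h)"
  proof (rule lsum_iter_cong [OF h], rule coaction_cong [OF m])
    fix g m' a assume "length g = Suc 2" "set g \<subseteq> carrier H" and m': "m' \<in> carrier M" and a: "a \<in> carrier H"
    then obtain x z w where g: "g = [x, z, w]" "x \<in> carrier H" "z \<in> carrier H" "w \<in> carrier H"
      using len3 by blast
    let ?c = "?y \<cdot> (w \<cdot> a \<cdot> S x)"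
    have c: "?c \<in> carrier H" using y a g by (simp add: antipode_closed)
    have "zt n (?c # ?l) (act z m') = lsum ?Z (\<lambda>k. zt n (map2 (\<cdot>) (?c # ?l) k) m') (iter n z)"
      by (rule zt_balanced [symmetric]) (use l' c g m' in auto)
    also have "\<dots> = lsum ?Z (\<lambda>k. ?F m' a (take 1 g @ k @ drop (Suc 1) g)) (iter n z)"
    proof (rule lsum_iter_cong [OF g(3)])
      fix k assume k: "length k = Suc n" "set k \<subseteq> carrier H"
      then obtain k0 k' where k': "k = k0 # k'" by (cases k) auto
      \<comment> \<open>Reassociating brings S(h_(1)) next to the first component of h_(2).\<close>
      have "?c \<cdot> k0 = ?y \<cdot> (w \<cdot> a \<cdot> (S x \<cdot> k0))"
        using k k' y a g by (simp add: antipode_closed H.m_assoc)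
      then show "zt n (map2 (\<cdot>) (?c # ?l) k) m' = ?F m' a (take 1 g @ k @ drop (Suc 1) g)"
        using k k' g by (simp add: nth_append numeral_2_eq_2)
    qed
    finally show "zt n ((?y \<cdot> (g ! 2 \<cdot> a \<cdot> S (g ! 0))) # ?l) (act (g ! 1) m') =
        lsum ?Z (\<lambda>k. ?F m' a (take 1 g @ k @ drop (Suc 1) g)) (iter n (g ! 1))"
      using g by (simp add: numeral_2_eq_2)
  qed
  also have "\<dots> = lsum ?Z (\<lambda>p. lsum ?Z (\<lambda>g. case p of (m', a) \<Rightarrow>
      lsum ?Z (\<lambda>k. ?F m' a (take 1 g @ k @ drop (Suc 1) g)) (iter n (g ! 1))) (iter 2 h)) (coa m)"
  proof (rule lsum_swap [OF Zn_module])
    fix g p assume g: "g \<in> set (iter 2 h)" and "p \<in> set (coa m)"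
    then obtain m' a where p: "p = (m', a)" "m' \<in> carrier M" "a \<in> carrier H"
      using pairs by blast
    obtain x z w where g: "g = [x, z, w]" "x \<in> carrier H" "z \<in> carrier H" "w \<in> carrier H"
      using len3 iter_closed [OF h g] by blast
    show "(case p of (m', a) \<Rightarrow> lsum ?Z (\<lambda>k. ?F m' a (take 1 g @ k @ drop (Suc 1) g)) (iter n (g ! 1))) \<in> carrier ?Z"
      unfolding p prod.case
    proof (rule lsum_iter_closed [OF Zn_module])
      show "?F m' a (take 1 g @ k @ drop (Suc 1) g) \<in> carrier ?Z" if "length k = Suc n" "set k \<subseteq> carrier H" for k
        by (rule multilin_closed [OF F [OF p(2,3)]]) (use g that in auto)
    qed (use g in simp)
  qed
  also have "\<dots> = lsum ?Z (\<lambda>p. lsum ?Z (\<lambda>g. case p of (m', a) \<Rightarrow>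
      zt n ((?y \<cdot> (g ! n \<cdot> a)) # map2 (\<cdot>) ?l (take n g)) m') (iter n h)) (coa m)"
  proof (rule lsum_cong)
    fix p assume "p \<in> set (coa m)"
    then obtain m' a where p: "p = (m', a)" "m' \<in> carrier M" "a \<in> carrier H"
      using pairs by blast
    \<comment> \<open>Expanding the middle one of three components into n + 1 gives the n + 3
      components of a single iterated coproduct.\<close>
    have "lsum ?Z (\<lambda>g. lsum ?Z (\<lambda>k. ?F m' a (take 1 g @ k @ drop (Suc 1) g)) (iter n (g ! 1))) (iter 2 h) =
        lsum ?Z (?F m' a) (iter (2 + n) h)"
      by (rule iter_block [OF Zn_module h]) (use F [OF p(2,3)] in simp_all)
    \<comment> \<open>After the cancellation \<open>q ! 0\<close> is the unit and
      \<open>q ! Suc n\<close> is \<open>g ! n\<close>, with \<open>g\<close> running through n + 1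
      components.\<close>
    also have "\<dots> = lsum ?Z (\<lambda>g. ?E m' a (\<one>\<^bsub>H\<^esub> # g)) (iter n h)"
      using iter_antipode [OF Zn_module h E [OF p(2,3)]] by simp
    also have "\<dots> = lsum ?Z (\<lambda>g. zt n ((?y \<cdot> (g ! n \<cdot> a)) # map2 (\<cdot>) ?l (take n g)) m') (iter n h)"
      by (rule lsum_iter_cong [OF h]) (use p in \<open>simp add: subset_iff\<close>)
    finally show "lsum ?Z (\<lambda>g. case p of (m', a) \<Rightarrow>
        lsum ?Z (\<lambda>k. ?F m' a (take 1 g @ k @ drop (Suc 1) g)) (iter n (g ! 1))) (iter 2 h) =
      lsum ?Z (\<lambda>g. case p of (m', a) \<Rightarrow>
        zt n ((?y \<cdot> (g ! n \<cdot> a)) # map2 (\<cdot>) ?l (take n g)) m') (iter n h)"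
      by (simp only: p prod.case)
  qed
  also have "\<dots> = lsum ?Z (\<lambda>g. lsum ?Z (\<lambda>p. case p of (m', a) \<Rightarrow>
      zt n ((?y \<cdot> (g ! n \<cdot> a)) # map2 (\<cdot>) ?l (take n g)) m') (coa m)) (iter n h)"
  proof (rule lsum_swap [OF Zn_module])
    fix p g assume "p \<in> set (coa m)" and g: "g \<in> set (iter n h)"
    then obtain m' a where p: "p = (m', a)" "m' \<in> carrier M" "a \<in> carrier H"
      using pairs by blast
    have "g ! n \<in> carrier H" "length (take n g) = n" "set (take n g) \<subseteq> carrier H"
      using iter_closed [OF h g] by (auto simp: set_take_le subsetD)
    then show "(case p of (m', a) \<Rightarrow>
        zt n ((?y \<cdot> (g ! n \<cdot> a)) # map2 (\<cdot>) ?l (take n g)) m') \<in> carrier ?Z"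
      unfolding p prod.case using p(2,3) y l'
      by (intro zt_closed) (simp_all add: set_map2_mult del: set_map)
  qed
  \<comment> \<open>By associativity the head is the last entry of the acted-on word times
    \<open>a\<close>, and the tail consists of its other entries: this is the formula of \<tau>_n on
    that word.\<close>
  also have "\<dots> = lsum ?Z (\<lambda>g. ?G (map2 (\<cdot>) l g) m) (iter n h)"
  proof (rule lsum_iter_cong [OF h], rule coaction_cong [OF m])
    fix g m' a assume g: "length g = Suc n" "set g \<subseteq> carrier H" and a: "a \<in> carrier H"
    have "g ! n \<in> carrier H" using g by (auto simp: subset_iff)
    then show "zt n ((?y \<cdot> (g ! n \<cdot> a)) # map2 (\<cdot>) ?l (take n g)) m' =
        zt n ((map2 (\<cdot>) l g ! n \<cdot> a) # take n (map2 (\<cdot>) l g)) m'"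
      using l g y a by (simp add: H.m_assoc take_map take_zip)
  qed
  finally show "lsum ?Z (\<lambda>g. ?G (map2 (\<cdot>) l g) m) (iter n h) = ?G l (act h m)" by simp
qed

end

section \<open>The last component of a coproduct, and operators under Sweedler sums\<close>

context hopf_algebra
begin

text \<open>Expanding the first of two components into a block isolates the last component.
  Iterating \<tau>_n needs this form: the component that multiplies the last entry of the word is
  the one to be set apart.\<close>

lemma iter_last:
  assumes W: "module K W" and h: "h \<in> carrier H" and F: "multilin H W (Suc (Suc n)) F"
  shows "lsum W F (iter (Suc n) h) = lsum W (\<lambda>(a, b). lsum W (\<lambda>k. F (k @ [b])) (iter n a)) (cop h)"
proof -
  let ?E = "\<lambda>l. lsum W (\<lambda>k. F (take 0 l @ k @ drop (Suc 0) l)) (iter n (l ! 0))"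
  have Ec: "?E l \<in> carrier W" if "length l = Suc (Suc 0)" "set l \<subseteq> carrier H" for l
  proof -
    have "l ! 0 \<in> carrier H" using that by (auto simp: subset_iff)
    then show ?thesis
      by (rule lsum_iter_closed [OF W])
         (use that in \<open>simp add: multilin_closed [OF F] set_drop_le\<close>)
  qed
  have "lsum W F (iter (Suc n) h) = lsum W ?E (iter (Suc 0) h)"
    using iter_block [OF W h, of 0 "Suc 0" n F] F by simp
  also have "\<dots> = lsum W (\<lambda>(a, b). lsum W (\<lambda>l. ?E (a # l)) (iter 0 b)) (cop h)"
    by (rule lsum_iter_Suc [OF W h Ec])
  also have "\<dots> = lsum W (\<lambda>(a, b). lsum W (\<lambda>k. F (k @ [b])) (iter n a)) (cop h)"
  proof (rule sweedler_cong [OF h])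
    fix a b assume "a \<in> carrier H" "b \<in> carrier H"
    then have "?E [a, b] \<in> carrier W" by (intro Ec) auto
    then show "lsum W (\<lambda>l. ?E (a # l)) (iter 0 b) = lsum W (\<lambda>k. F (k @ [b])) (iter n a)"
      using lsum_single [OF W, of "\<lambda>l. ?E (a # l)" "[b]"] by simp
  qed
  finally show ?thesis .
qed

end

context hopf_module
begin

text \<open>The pattern of the identities below: an operator whose value \<open>E\<close> is known
  on each spanning element is applied under the Sweedler sum coming from a previous
  operator.\<close>

lemma linear_sweedler_zt:
  assumes f: "f \<in> linear_maps K (Zn n) W" and W: "module K W" and h: "h \<in> carrier H"
    and m: "m \<in> carrier M"
    and L: "\<And>a b. \<lbrakk>a \<in> carrier H; b \<in> carrier H\<rbrakk> \<Longrightarrow> length (L a b) = Suc n \<and> set (L a b) \<subseteq> carrier H"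
    and E: "\<And>a b. \<lbrakk>a \<in> carrier H; b \<in> carrier H\<rbrakk> \<Longrightarrow> f (zt n (L a b) m) = E a b"
  shows "f (lsum (Zn n) (\<lambda>(a, b). zt n (L a b) m) (cop h)) = lsum W (\<lambda>(a, b). E a b) (cop h)"
proof -
  have "f (lsum (Zn n) (\<lambda>(a, b). zt n (L a b) m) (cop h)) =
      lsum W (\<lambda>p. f (case p of (a, b) \<Rightarrow> zt n (L a b) m)) (cop h)"
  proof (rule linear_lsum [OF Zn_module W f])
    fix p assume "p \<in> set (cop h)"
    then obtain a b where "p = (a, b)" "a \<in> carrier H" "b \<in> carrier H" using cop(1) [OF h] by blast
    then show "(case p of (a, b) \<Rightarrow> zt n (L a b) m) \<in> carrier (Zn n)"
      using L zt_closed m by simp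
  qed
  also have "\<dots> = lsum W (\<lambda>(a, b). E a b) (cop h)"
    by (rule lsum_cong) (use cop_closed [OF h] E in auto)
  finally show ?thesis .
qed

text \<open>\<open>hopf_cyclic_operators\<close> forms the Sweedler sum inside the tensor power;
  calculations on spanning elements need it outside, and linearity of \<open>Z_tens\<close> in its
  first argument moves it there.\<close>

lemma degen_eq:
  assumes i: "i \<le> n" and l: "length l = Suc n" "set l \<subseteq> carrier H" and m: "m \<in> carrier M"
  shows "Z_tens K H \<Delta> M act (Suc n) (tlift K (TP (Suc n))
      (\<lambda>(a, b). pure K H (take i l @ [a, b] @ drop (Suc i) l)) (\<Delta> (l ! i))) m =
    lsum (Zn (Suc n)) (\<lambda>(a, b). zt (Suc n) (take i l @ [a, b] @ drop (Suc i) l) m) (cop (l ! i))"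
proof -
  let ?p = "\<lambda>a b. pure K H (take i l @ [a, b] @ drop (Suc i) l)"
  have x: "l ! i \<in> carrier H" using l i by (auto simp: subset_iff)
  have pc: "?p a b \<in> carrier (TP (Suc n))" if "a \<in> carrier H" "b \<in> carrier H" for a b
    using l i that by (intro pure_closed [OF H_module]) (simp add: words_def set_take_le set_drop_le)
  note P = pure_multilin [OF H_module, of "Suc (Suc n)"]
  have "bilin H H (TP (Suc n)) ?p"
  proof (rule bilinI)
    show "(\<lambda>a. ?p a b) \<in> linear_maps K H (TP (Suc n))" if "b \<in> carrier H" for b
      using multilin_slot [OF P, of "take i l" "b # drop (Suc i) l"] l i that
      by (simp add: set_take_le set_drop_le)
    show "?p a \<in> linear_maps K H (TP (Suc n))" if "a \<in> carrier H" for a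
      using multilin_slot [OF P, of "take i l @ [a]" "drop (Suc i) l"] l i that
      by (simp add: set_take_le set_drop_le)
  qed
  then have "tlift K (TP (Suc n)) (\<lambda>(a, b). ?p a b) (\<Delta> (l ! i)) =
      lsum (TP (Suc n)) (\<lambda>(a, b). ?p a b) (cop (l ! i))"
    by (rule sweedler [OF TP_module _ x])
  moreover have "Z_tens K H \<Delta> M act (Suc n) (lsum (TP (Suc n)) (\<lambda>(a, b). ?p a b) (cop (l ! i))) m =
      lsum (Zn (Suc n)) (\<lambda>p. Z_tens K H \<Delta> M act (Suc n) (case p of (a, b) \<Rightarrow> ?p a b) m) (cop (l ! i))"
    by (rule linear_lsum [OF TP_module Zn_module bilin_left [OF Z_tens_bilin m]])
       (use cop_closed [OF x] pc in auto)
  moreover have "\<dots> = lsum (Zn (Suc n)) (\<lambda>(a, b). zt (Suc n) (take i l @ [a, b] @ drop (Suc i) l) m) (cop (l ! i))"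
    by (rule lsum_cong) auto
  ultimately show ?thesis by simp
qed

end

context crossed_module
begin

lemma linear_coaction_zt:
  assumes f: "f \<in> linear_maps K (Zn n) W" and W: "module K W" and m: "m \<in> carrier M"
    and L: "\<And>a. a \<in> carrier H \<Longrightarrow> length (L a) = Suc n \<and> set (L a) \<subseteq> carrier H"
    and E: "\<And>m' a. \<lbrakk>m' \<in> carrier M; a \<in> carrier H\<rbrakk> \<Longrightarrow> f (zt n (L a) m') = E m' a"
  shows "f (lsum (Zn n) (\<lambda>(m', a). zt n (L a) m') (coa m)) = lsum W (\<lambda>(m', a). E m' a) (coa m)"
proof -
  have "f (lsum (Zn n) (\<lambda>(m', a). zt n (L a) m') (coa m)) =
      lsum W (\<lambda>p. f (case p of (m', a) \<Rightarrow> zt n (L a) m')) (coa m)"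
  proof (rule linear_lsum [OF Zn_module W f])
    fix p assume "p \<in> set (coa m)"
    then obtain m' a where "p = (m', a)" "m' \<in> carrier M" "a \<in> carrier H" using coa(1) [OF m] by blast
    then show "(case p of (m', a) \<Rightarrow> zt n (L a) m') \<in> carrier (Zn n)"
      using L zt_closed by simp
  qed
  also have "\<dots> = lsum W (\<lambda>(m', a). E m' a) (coa m)"
    by (rule lsum_cong) (use coa_closed [OF m] E in auto)
  finally show ?thesis .
qed

lemma cyc_eq:
  assumes l: "length l = Suc n" "set l \<subseteq> carrier H" and m: "m \<in> carrier M"
  shows "tlift K (Zn n) (\<lambda>(m', a). zt n ((l ! n \<cdot> a) # take n l) m') (\<rho> m) =
    lsum (Zn n) (\<lambda>(m', a). zt n ((l ! n \<cdot> a) # take n l) m') (coa m)"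
proof (rule coaction [OF Zn_module rotate_bilin m])
  show "l ! n \<in> carrier H" using l by (auto simp: subset_iff)
qed (use l in \<open>simp_all add: set_take_le\<close>)

text \<open>Without a family obeying the formulas, a claim about all such families would be vacuous.
  The lifts are obtained degree by degree and collected by choice.\<close>

lemma operators_exist: "\<exists>\<delta> \<sigma> \<tau>. hopf_cyclic_operators K H \<Delta> \<epsilon> M act \<rho> \<delta> \<sigma> \<tau>"
proof -
  define d where "d n i = (SOME \<phi>. \<phi> \<in> linear_maps K (Zn (Suc n)) (Zn n) \<and>
    (\<forall>l m. length l = Suc (Suc n) \<longrightarrow> set l \<subseteq> carrier H \<longrightarrow> m \<in> carrier M \<longrightarrow>
      \<phi> (zt (Suc n) l m) = \<epsilon> (l ! i) \<odot>\<^bsub>Zn n\<^esub> zt n (take i l @ drop (Suc i) l) m))" for n i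
  note d = someI_ex [OF face_exists, folded d_def]
  define s where "s n i = (SOME \<phi>. \<phi> \<in> linear_maps K (Zn n) (Zn (Suc n)) \<and>
    (\<forall>l m. length l = Suc n \<longrightarrow> set l \<subseteq> carrier H \<longrightarrow> m \<in> carrier M \<longrightarrow>
      \<phi> (zt n l m) = lsum (Zn (Suc n))
        (\<lambda>(a, b). zt (Suc n) (take i l @ [a, b] @ drop (Suc i) l) m) (cop (l ! i))))" for n i
  note s = someI_ex [OF degen_exists, folded s_def]
  define t where "t n = (SOME \<phi>. \<phi> \<in> linear_maps K (Zn n) (Zn n) \<and>
    (\<forall>l m. length l = Suc n \<longrightarrow> set l \<subseteq> carrier H \<longrightarrow> m \<in> carrier M \<longrightarrow>
      \<phi> (zt n l m) = lsum (Zn n) (\<lambda>(m', a). zt n ((l ! n \<cdot> a) # take n l) m') (coa m)))" for n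
  note t = someI_ex [OF cyc_exists, folded t_def]
  \<comment> \<open>\<open>d n\<close> starts in degree \<open>Suc n\<close>, hence the shift; in
    degree 0 truncated subtraction returns \<open>d 0\<close>, but faces are constrained only from
    degree 1 on.\<close>
  have "hopf_cyclic_operators K H \<Delta> \<epsilon> M act \<rho> (\<lambda>n. d (n - 1)) s t"
  proof
    fix n i :: nat assume "1 \<le> n" "i \<le> n"
    then obtain k where k: "n = Suc k" "i \<le> Suc k" by (cases n) auto
    show "d (n - 1) i \<in> linear_maps K (Zn n) (Zn (n - 1))"
      using d [OF k(2)] k by simp
    show "d (n - 1) i (zt n l m) = \<epsilon> (l ! i) \<odot>\<^bsub>Zn (n - 1)\<^esub> zt (n - 1) (take i l @ drop (i + 1) l) m"
      if "l \<in> words H (n + 1)" "m \<in> carrier M" for l m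
      using d [OF k(2)] k that by (simp add: words_def)
  next
    fix n i :: nat assume i: "i \<le> n"
    show "s n i \<in> linear_maps K (Zn n) (Zn (n + 1))"
      using s [OF i] by simp
    show "s n i (zt n l m) = Z_tens K H \<Delta> M act (n + 1) (tlift K (tensor_power K H (n + 2))
        (\<lambda>(a, b). pure K H (take i l @ [a, b] @ drop (i + 1) l)) (\<Delta> (l ! i))) m"
      if "l \<in> words H (n + 1)" "m \<in> carrier M" for l m
      using s [OF i] degen_eq [OF i] that by (simp add: words_def)
  next
    fix n
    show "t n \<in> linear_maps K (Zn n) (Zn n)" using t by blast
    show "t n (zt n l m) = tlift K (Zn n) (\<lambda>(m', a). zt n ((l ! n \<cdot> a) # take n l) m') (\<rho> m)"
      if "l \<in> words H (n + 1)" "m \<in> carrier M" for l m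
      using t [of n] cyc_eq that by (simp add: words_def)
  qed
  then show ?thesis by blast
qed

end


section \<open>Splitting words at one or two positions\<close>

lemma split_at:
  assumes "length l = Suc n" "i \<le> n"
  obtains p x q where "l = p @ x # q" "length p = i" "length q = n - i"
proof -
  have "l = take i l @ l ! i # drop (Suc i) l" using assms by (intro id_take_nth_drop) simp
  then show ?thesis using that assms by fastforce
qed

lemma split_at2:
  assumes "length l = Suc n" "i < j" "j \<le> n"
  obtains p x q y r where "l = p @ x # q @ y # r" "length p = i" "length q = j - Suc i" "length r = n - j"
proof -
  obtain p y r where 1: "l = p @ y # r" "length p = j" "length r = n - j"
    using split_at [OF assms(1,3)] .
  have "length p = Suc (j - 1)" "i \<le> j - 1" using 1 assms(2) by auto
  then obtain p' x q where 2: "p = p' @ x # q" "length p' = i" "length q = j - 1 - i"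
    by (rule split_at)
  show ?thesis by (rule that [of p' x q y r]) (use 1 2 in auto)
qed

lemma split_last:
  assumes "length l = Suc n"
  obtains q x where "l = q @ [x]" "length q = n"
  using assms by (cases l rule: rev_cases) auto

section \<open>The cyclic identities\<close>

context modular_crossed_module
begin

context
  fixes \<delta> \<sigma> \<tau>
  assumes ops: "hopf_cyclic_operators K H \<Delta> \<epsilon> M act \<rho> \<delta> \<sigma> \<tau>"
begin

interpretation O: hopf_cyclic_operators K H \<Delta> \<epsilon> M act \<rho> \<delta> \<sigma> \<tau>
  by (rule ops)

lemma face_lin: "i \<le> Suc n \<Longrightarrow> \<delta> (Suc n) i \<in> linear_maps K (Zn (Suc n)) (Zn n)"
  using O.face_linear [of "Suc n" i] by simp

lemma degen_lin: "i \<le> n \<Longrightarrow> \<sigma> n i \<in> linear_maps K (Zn n) (Zn (Suc n))"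
  using O.degen_linear [of i n] by simp

lemma cyc_lin: "\<tau> n \<in> linear_maps K (Zn n) (Zn n)"
  by (rule O.cyclic_linear)

text \<open>Writing words as \<open>p @ x # q\<close>, with \<open>i\<close> the length of
  \<open>p\<close>, turns deletion and splitting into list patterns, so composites of operators are
  evaluated without \<open>take\<close> and \<open>drop\<close>.\<close>

lemma face_zt:
  assumes "i = length p" "length p + length q = Suc n" "set p \<subseteq> carrier H" "x \<in> carrier H"
    "set q \<subseteq> carrier H" "m \<in> carrier M"
  shows "\<delta> (Suc n) i (zt (Suc n) (p @ x # q) m) = \<epsilon> x \<odot>\<^bsub>Zn n\<^esub> zt n (p @ q) m"
  using O.face [of "Suc n" i "p @ x # q" m] assms by (simp add: words_def)

lemma degen_zt:
  assumes "i = length p" "length p + length q = n" "set p \<subseteq> carrier H" "x \<in> carrier H"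
    "set q \<subseteq> carrier H" "m \<in> carrier M"
  shows "\<sigma> n i (zt n (p @ x # q) m) =
    lsum (Zn (Suc n)) (\<lambda>(a, b). zt (Suc n) (p @ a # b # q) m) (cop x)"
  using O.degen [of i n "p @ x # q" m] degen_eq [of i n "p @ x # q" m] assms by (simp add: words_def)

lemma cyc_zt:
  assumes "length q = n" "set q \<subseteq> carrier H" "x \<in> carrier H" "m \<in> carrier M"
  shows "\<tau> n (zt n (q @ [x]) m) = lsum (Zn n) (\<lambda>(m', a). zt n ((x \<cdot> a) # q) m') (coa m)"
  using O.cyclic [of "q @ [x]" n m] cyc_eq [of "q @ [x]" n m] assms
  by (simp add: words_def nth_append)

lemma smult_comm:
  assumes "a \<in> carrier K" "b \<in> carrier K" "z \<in> carrier (Zn n)"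
  shows "a \<odot>\<^bsub>Zn n\<^esub> (b \<odot>\<^bsub>Zn n\<^esub> z) = b \<odot>\<^bsub>Zn n\<^esub> (a \<odot>\<^bsub>Zn n\<^esub> z)"
proof -
  interpret Z: module K "Zn n" by (rule Zn_module)
  show ?thesis using assms by (metis K.m_comm Z.smult_assoc1)
qed

lemma slot_linear:
  assumes "length p + length q = n" "set p \<subseteq> carrier H" "set q \<subseteq> carrier H" "m \<in> carrier M"
  shows "(\<lambda>v. zt n (p @ v # q) m) \<in> linear_maps K H (Zn n)"
  by (rule multilin_slot [OF zt_multilin [OF assms(4)]]) (use assms in auto)

lemma smult_sweedler_zt:
  assumes "c \<in> carrier K" "h \<in> carrier H" "m \<in> carrier M"
    "\<And>a b. \<lbrakk>a \<in> carrier H; b \<in> carrier H\<rbrakk> \<Longrightarrow> length (L a b) = Suc n \<and> set (L a b) \<subseteq> carrier H"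
  shows "c \<odot>\<^bsub>Zn n\<^esub> lsum (Zn n) (\<lambda>(a, b). zt n (L a b) m) (cop h) =
    lsum (Zn n) (\<lambda>(a, b). c \<odot>\<^bsub>Zn n\<^esub> zt n (L a b) m) (cop h)"
  by (rule linear_sweedler_zt [OF linear_scale [OF Zn_module linear_id assms(1)] Zn_module assms(2-4)]) auto

lemma smult_coaction_zt:
  assumes "c \<in> carrier K" "m \<in> carrier M"
    "\<And>a. a \<in> carrier H \<Longrightarrow> length (L a) = Suc n \<and> set (L a) \<subseteq> carrier H"
  shows "c \<odot>\<^bsub>Zn n\<^esub> lsum (Zn n) (\<lambda>(m', a). zt n (L a) m') (coa m) =
    lsum (Zn n) (\<lambda>(m', a). c \<odot>\<^bsub>Zn n\<^esub> zt n (L a) m') (coa m)"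
  by (rule linear_coaction_zt [OF linear_scale [OF Zn_module linear_id assms(1)] Zn_module assms(2-3)]) auto

text \<open>After splitting at both positions, both composites delete \<open>x\<close> and
  \<open>y\<close>, and only the order of the two scalars differs.\<close>

lemma face_face:
  assumes "i < j" "j \<le> Suc (Suc n)" "z \<in> carrier (Zn (Suc (Suc n)))"
  shows "\<delta> (Suc n) i (\<delta> (Suc (Suc n)) j z) = \<delta> (Suc n) (j - 1) (\<delta> (Suc (Suc n)) i z)"
proof (rule Z_linear_eq [OF Zn_module _ _ _ assms(3)])
  show "(\<lambda>z. \<delta> (Suc n) i (\<delta> (Suc (Suc n)) j z)) \<in> linear_maps K (Zn (Suc (Suc n))) (Zn n)"
    by (rule linear_comp [OF face_lin face_lin]) (use assms in auto)
  show "(\<lambda>z. \<delta> (Suc n) (j - 1) (\<delta> (Suc (Suc n)) i z)) \<in> linear_maps K (Zn (Suc (Suc n))) (Zn n)"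
    by (rule linear_comp [OF face_lin face_lin]) (use assms in auto)
  fix l m assume l: "length l = Suc (Suc (Suc n))" "set l \<subseteq> carrier H" and m: "m \<in> carrier M"
  obtain p x q y r where s: "l = p @ x # q @ y # r" "length p = i" "length q = j - Suc i"
      "length r = Suc (Suc n) - j"
    using split_at2 [OF l(1) assms(1,2)] .
  have c: "set p \<subseteq> carrier H" "x \<in> carrier H" "set q \<subseteq> carrier H" "y \<in> carrier H" "set r \<subseteq> carrier H"
    using l(2) s(1) by auto
  note e = counit_closed [OF c(2)] counit_closed [OF c(4)]
  have zc: "zt n (p @ q @ r) m \<in> carrier (Zn n)"
    by (rule zt_closed) (use c m s assms in auto)
  show "\<delta> (Suc n) i (\<delta> (Suc (Suc n)) j (zt (Suc (Suc n)) l m)) =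
      \<delta> (Suc n) (j - 1) (\<delta> (Suc (Suc n)) i (zt (Suc (Suc n)) l m))"
    using face_zt [of j "p @ x # q" r "Suc n" y m] face_zt [of i p "q @ r" n x m]
      face_zt [of i p "q @ y # r" "Suc n" x m] face_zt [of "j - 1" "p @ q" r n y m]
      s(2-4) assms(1,2) c e m zc
    by (simp add: s(1) linear_smult [OF face_lin] zt_closed smult_comm)
qed

text \<open>For \<open>i = j\<close> the same entry is split twice, and coassociativity says that
  either half may be split again. For \<open>i < j\<close> different entries are split, and only the
  order of summation differs.\<close>

lemma degen_degen:
  assumes "i \<le> j" "j \<le> n" "z \<in> carrier (Zn n)"
  shows "\<sigma> (Suc n) i (\<sigma> n j z) = \<sigma> (Suc n) (Suc j) (\<sigma> n i z)"
proof (rule Z_linear_eq [OF Zn_module _ _ _ assms(3)])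
  show "(\<lambda>z. \<sigma> (Suc n) i (\<sigma> n j z)) \<in> linear_maps K (Zn n) (Zn (Suc (Suc n)))"
    by (rule linear_comp [OF degen_lin degen_lin]) (use assms in auto)
  show "(\<lambda>z. \<sigma> (Suc n) (Suc j) (\<sigma> n i z)) \<in> linear_maps K (Zn n) (Zn (Suc (Suc n)))"
    by (rule linear_comp [OF degen_lin degen_lin]) (use assms in auto)
  fix l m assume l: "length l = Suc n" "set l \<subseteq> carrier H" and m: "m \<in> carrier M"
  let ?Z = "Zn (Suc (Suc n))" and ?z = "zt (Suc (Suc n))"
  show "\<sigma> (Suc n) i (\<sigma> n j (zt n l m)) = \<sigma> (Suc n) (Suc j) (\<sigma> n i (zt n l m))"
  proof (cases "i = j")
    case True
    obtain p x q where s: "l = p @ x # q" "length p = i" "length q = n - i"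
      using split_at [OF l(1), of i] assms by auto
    have c: "set p \<subseteq> carrier H" "x \<in> carrier H" "set q \<subseteq> carrier H"
      using l(2) s(1) by auto
    have 1: "\<sigma> n i (zt n (p @ x # q) m) = lsum (Zn (Suc n)) (\<lambda>(a, b). zt (Suc n) (p @ a # b # q) m) (cop x)"
      by (rule degen_zt) (use c m s True assms in auto)
    have 2: "\<sigma> (Suc n) i (lsum (Zn (Suc n)) (\<lambda>(a, b). zt (Suc n) (p @ a # b # q) m) (cop x)) =
        lsum ?Z (\<lambda>(a, b). lsum ?Z (\<lambda>(a', a''). ?z (p @ a' # a'' # b # q) m) (cop a)) (cop x)"
      by (rule linear_sweedler_zt [OF degen_lin Zn_module c(2) m _ degen_zt])
         (use c m s True assms in auto)
    have 3: "\<sigma> (Suc n) (Suc i) (lsum (Zn (Suc n)) (\<lambda>(a, b). zt (Suc n) (p @ a # b # q) m) (cop x)) =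
        lsum ?Z (\<lambda>(a, b). lsum ?Z (\<lambda>(b', b''). ?z (p @ a # b' # b'' # q) m) (cop b)) (cop x)"
    proof (rule linear_sweedler_zt [OF degen_lin Zn_module c(2) m])
      fix a b assume ab: "a \<in> carrier H" "b \<in> carrier H"
      have "\<sigma> (Suc n) (Suc i) (zt (Suc n) ((p @ [a]) @ b # q) m) =
          lsum ?Z (\<lambda>(b', b''). ?z ((p @ [a]) @ b' # b'' # q) m) (cop b)"
        by (rule degen_zt) (use c m s True assms ab in auto)
      then show "\<sigma> (Suc n) (Suc i) (zt (Suc n) (p @ a # b # q) m) =
          lsum ?Z (\<lambda>(b', b''). ?z (p @ a # b' # b'' # q) m) (cop b)"
        by simp
    qed (use c m s True assms in auto)
    have "trilin H H H ?Z (\<lambda>a b d. ?z (p @ a # b # d # q) m)"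
      unfolding trilin_def
    proof (intro conjI ballI bilinI)
      fix b d assume "b \<in> carrier H" "d \<in> carrier H"
      then show "(\<lambda>a. ?z (p @ a # b # d # q) m) \<in> linear_maps K H ?Z"
        by (intro slot_linear) (use c m s True assms in auto)
    next
      fix a d assume "a \<in> carrier H" "d \<in> carrier H"
      then show "(\<lambda>b. ?z (p @ a # b # d # q) m) \<in> linear_maps K H ?Z"
        using slot_linear [of "p @ [a]" "d # q" "Suc (Suc n)" m] c m s True assms by auto
    next
      fix a b assume "a \<in> carrier H" "b \<in> carrier H"
      then show "(\<lambda>d. ?z (p @ a # b # d # q) m) \<in> linear_maps K H ?Z"
        using slot_linear [of "p @ [a, b]" "q" "Suc (Suc n)" m] c m s True assms by auto
    qed
    from sweedler_coassoc [OF Zn_module this c(2)] show ?thesis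
      using True s 1 2 3 by simp
  next
    case False
    then have ij: "i < j" using assms by simp
    obtain p x q y r where s: "l = p @ x # q @ y # r" "length p = i" "length q = j - Suc i"
        "length r = n - j"
      using split_at2 [OF l(1) ij assms(2)] .
    have c: "set p \<subseteq> carrier H" "x \<in> carrier H" "set q \<subseteq> carrier H" "y \<in> carrier H" "set r \<subseteq> carrier H"
      using l(2) s(1) by auto
    have "\<sigma> n j (zt n ((p @ x # q) @ y # r) m) =
        lsum (Zn (Suc n)) (\<lambda>(a, b). zt (Suc n) ((p @ x # q) @ a # b # r) m) (cop y)"
      by (rule degen_zt) (use c m s ij assms in auto)
    moreover have "\<sigma> (Suc n) i (lsum (Zn (Suc n)) (\<lambda>(a, b). zt (Suc n) (p @ x # q @ a # b # r) m) (cop y)) =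
        lsum ?Z (\<lambda>(a, b). lsum ?Z (\<lambda>(a', b'). ?z (p @ a' # b' # q @ a # b # r) m) (cop x)) (cop y)"
      by (rule linear_sweedler_zt [OF degen_lin Zn_module c(4) m _ degen_zt])
         (use c m s ij assms in auto)
    moreover have "\<sigma> n i (zt n (p @ x # q @ y # r) m) =
        lsum (Zn (Suc n)) (\<lambda>(a', b'). zt (Suc n) (p @ a' # b' # q @ y # r) m) (cop x)"
      by (rule degen_zt) (use c m s ij assms in auto)
    moreover have "\<sigma> (Suc n) (Suc j) (lsum (Zn (Suc n)) (\<lambda>(a', b'). zt (Suc n) (p @ a' # b' # q @ y # r) m) (cop x)) =
        lsum ?Z (\<lambda>(a', b'). lsum ?Z (\<lambda>(a, b). ?z (p @ a' # b' # q @ a # b # r) m) (cop y)) (cop x)"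
    proof (rule linear_sweedler_zt [OF degen_lin Zn_module c(2) m])
      fix a b assume ab: "a \<in> carrier H" "b \<in> carrier H"
      have "\<sigma> (Suc n) (Suc j) (zt (Suc n) ((p @ a # b # q) @ y # r) m) =
          lsum ?Z (\<lambda>(a', b'). ?z ((p @ a # b # q) @ a' # b' # r) m) (cop y)"
        by (rule degen_zt) (use c m s ij assms ab in auto)
      then show "\<sigma> (Suc n) (Suc j) (zt (Suc n) (p @ a # b # q @ y # r) m) =
          lsum ?Z (\<lambda>(a', b'). ?z (p @ a # b # q @ a' # b' # r) m) (cop y)"
        by simp
    qed (use c m s ij assms in auto)
    moreover have "lsum ?Z (\<lambda>v. lsum ?Z (\<lambda>u. ?z (p @ fst u # snd u # q @ fst v # snd v # r) m) (cop x)) (cop y) =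
        lsum ?Z (\<lambda>u. lsum ?Z (\<lambda>v. ?z (p @ fst u # snd u # q @ fst v # snd v # r) m) (cop y)) (cop x)"
      by (rule lsum_swap [OF Zn_module], rule zt_closed)
         (use cop_closed [OF c(2)] cop_closed [OF c(4)] c m s ij assms in auto)
    ultimately show ?thesis
      by (simp add: s(1) case_prod_unfold)
  qed
qed

text \<open>The deleted entry is not the split one, so its counit is a constant scalar for the
  Sweedler sum.\<close>

lemma face_degen_less:
  assumes "i < j" "j \<le> Suc n" "z \<in> carrier (Zn (Suc n))"
  shows "\<delta> (Suc (Suc n)) i (\<sigma> (Suc n) j z) = \<sigma> n (j - 1) (\<delta> (Suc n) i z)"
proof (rule Z_linear_eq [OF Zn_module _ _ _ assms(3)])
  show "(\<lambda>z. \<delta> (Suc (Suc n)) i (\<sigma> (Suc n) j z)) \<in> linear_maps K (Zn (Suc n)) (Zn (Suc n))"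
    by (rule linear_comp [OF degen_lin face_lin]) (use assms in auto)
  show "(\<lambda>z. \<sigma> n (j - 1) (\<delta> (Suc n) i z)) \<in> linear_maps K (Zn (Suc n)) (Zn (Suc n))"
    by (rule linear_comp [OF face_lin degen_lin]) (use assms in auto)
  fix l m assume l: "length l = Suc (Suc n)" "set l \<subseteq> carrier H" and m: "m \<in> carrier M"
  obtain p x q y r where s: "l = p @ x # q @ y # r" "length p = i" "length q = j - Suc i"
      "length r = Suc n - j"
    using split_at2 [OF l(1) assms(1,2)] .
  have c: "set p \<subseteq> carrier H" "x \<in> carrier H" "set q \<subseteq> carrier H" "y \<in> carrier H" "set r \<subseteq> carrier H"
    using l(2) s(1) by auto
  note e = counit_closed [OF c(2)]
  have "\<sigma> (Suc n) j (zt (Suc n) ((p @ x # q) @ y # r) m) =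
      lsum (Zn (Suc (Suc n))) (\<lambda>(a, b). zt (Suc (Suc n)) ((p @ x # q) @ a # b # r) m) (cop y)"
    by (rule degen_zt) (use c m s assms in auto)
  moreover have "\<delta> (Suc (Suc n)) i (lsum (Zn (Suc (Suc n))) (\<lambda>(a, b). zt (Suc (Suc n)) (p @ x # q @ a # b # r) m) (cop y)) =
      lsum (Zn (Suc n)) (\<lambda>(a, b). \<epsilon> x \<odot>\<^bsub>Zn (Suc n)\<^esub> zt (Suc n) (p @ q @ a # b # r) m) (cop y)"
    by (rule linear_sweedler_zt [OF face_lin Zn_module c(4) m _ face_zt])
       (use c m s assms in auto)
  moreover have "\<epsilon> x \<odot>\<^bsub>Zn (Suc n)\<^esub> lsum (Zn (Suc n)) (\<lambda>(a, b). zt (Suc n) (p @ q @ a # b # r) m) (cop y) =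
      lsum (Zn (Suc n)) (\<lambda>(a, b). \<epsilon> x \<odot>\<^bsub>Zn (Suc n)\<^esub> zt (Suc n) (p @ q @ a # b # r) m) (cop y)"
    by (rule smult_sweedler_zt [OF e c(4) m]) (use c m s assms in auto)
  ultimately show "\<delta> (Suc (Suc n)) i (\<sigma> (Suc n) j (zt (Suc n) l m)) = \<sigma> n (j - 1) (\<delta> (Suc n) i (zt (Suc n) l m))"
    using face_zt [of i p "q @ y # r" n x m] degen_zt [of "j - 1" "p @ q" r n y m]
      s(2-4) assms(1,2) c e m
    by (simp add: s(1) linear_smult [OF degen_lin] zt_closed)
qed

lemma face_degen_greater:
  assumes "Suc j < i" "i \<le> Suc (Suc n)" "z \<in> carrier (Zn (Suc n))"
  shows "\<delta> (Suc (Suc n)) i (\<sigma> (Suc n) j z) = \<sigma> n j (\<delta> (Suc n) (i - 1) z)"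
proof (rule Z_linear_eq [OF Zn_module _ _ _ assms(3)])
  show "(\<lambda>z. \<delta> (Suc (Suc n)) i (\<sigma> (Suc n) j z)) \<in> linear_maps K (Zn (Suc n)) (Zn (Suc n))"
    by (rule linear_comp [OF degen_lin face_lin]) (use assms in auto)
  show "(\<lambda>z. \<sigma> n j (\<delta> (Suc n) (i - 1) z)) \<in> linear_maps K (Zn (Suc n)) (Zn (Suc n))"
    by (rule linear_comp [OF face_lin degen_lin]) (use assms in auto)
  fix l m assume l: "length l = Suc (Suc n)" "set l \<subseteq> carrier H" and m: "m \<in> carrier M"
  \<comment> \<open>Splitting at \<open>j\<close> shifts the later entries by one, so position
    \<open>i\<close> of the longer word is position \<open>i - 1\<close> of the original.\<close>
  have ij: "j < i - 1" "i - 1 \<le> Suc n" using assms by auto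
  obtain p x q y r where s: "l = p @ x # q @ y # r" "length p = j" "length q = i - 1 - Suc j"
      "length r = Suc n - (i - 1)"
    using split_at2 [OF l(1) ij] .
  have c: "set p \<subseteq> carrier H" "x \<in> carrier H" "set q \<subseteq> carrier H" "y \<in> carrier H" "set r \<subseteq> carrier H"
    using l(2) s(1) by auto
  note e = counit_closed [OF c(4)]
  have "\<sigma> (Suc n) j (zt (Suc n) (p @ x # (q @ y # r)) m) =
      lsum (Zn (Suc (Suc n))) (\<lambda>(a, b). zt (Suc (Suc n)) (p @ a # b # (q @ y # r)) m) (cop x)"
    by (rule degen_zt) (use c m s assms in auto)
  moreover have "\<delta> (Suc (Suc n)) i (lsum (Zn (Suc (Suc n))) (\<lambda>(a, b). zt (Suc (Suc n)) (p @ a # b # q @ y # r) m) (cop x)) =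
      lsum (Zn (Suc n)) (\<lambda>(a, b). \<epsilon> y \<odot>\<^bsub>Zn (Suc n)\<^esub> zt (Suc n) (p @ a # b # q @ r) m) (cop x)"
  proof (rule linear_sweedler_zt [OF face_lin Zn_module c(2) m])
    fix a b assume ab: "a \<in> carrier H" "b \<in> carrier H"
    have "\<delta> (Suc (Suc n)) i (zt (Suc (Suc n)) ((p @ a # b # q) @ y # r) m) =
        \<epsilon> y \<odot>\<^bsub>Zn (Suc n)\<^esub> zt (Suc n) ((p @ a # b # q) @ r) m"
      by (rule face_zt) (use c m s assms ab in auto)
    then show "\<delta> (Suc (Suc n)) i (zt (Suc (Suc n)) (p @ a # b # q @ y # r) m) =
        \<epsilon> y \<odot>\<^bsub>Zn (Suc n)\<^esub> zt (Suc n) (p @ a # b # q @ r) m"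
      by simp
  qed (use c m s assms in auto)
  moreover have "\<epsilon> y \<odot>\<^bsub>Zn (Suc n)\<^esub> lsum (Zn (Suc n)) (\<lambda>(a, b). zt (Suc n) (p @ a # b # q @ r) m) (cop x) =
      lsum (Zn (Suc n)) (\<lambda>(a, b). \<epsilon> y \<odot>\<^bsub>Zn (Suc n)\<^esub> zt (Suc n) (p @ a # b # q @ r) m) (cop x)"
    by (rule smult_sweedler_zt [OF e c(2) m]) (use c m s assms in auto)
  moreover have "i = Suc (Suc (length p + length q))" "n = length p + length q + length r"
    using s(2-4) assms(1,2) by auto
  ultimately show "\<delta> (Suc (Suc n)) i (\<sigma> (Suc n) j (zt (Suc n) l m)) = \<sigma> n j (\<delta> (Suc n) (i - 1) (zt (Suc n) l m))"
    using face_zt [of "i - 1" "p @ x # q" r n y m] degen_zt [of j p "q @ r" n x m] s(2) c e m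
    by (simp add: s(1) linear_smult [OF degen_lin] zt_closed)
qed

text \<open>Deleting the left half of the split entry is the left counit axiom, deleting the right
  half is the right one.\<close>

lemma face_degen_same:
  assumes "j \<le> n" "z \<in> carrier (Zn n)"
  shows "\<delta> (Suc n) j (\<sigma> n j z) = z" and "\<delta> (Suc n) (Suc j) (\<sigma> n j z) = z"
proof -
  have l1: "(\<lambda>z. \<delta> (Suc n) j (\<sigma> n j z)) \<in> linear_maps K (Zn n) (Zn n)"
    by (rule linear_comp [OF degen_lin face_lin]) (use assms in auto)
  have l2: "(\<lambda>z. \<delta> (Suc n) (Suc j) (\<sigma> n j z)) \<in> linear_maps K (Zn n) (Zn n)"
    by (rule linear_comp [OF degen_lin face_lin]) (use assms in auto)
  {
    fix l m assume l: "length l = Suc n" "set l \<subseteq> carrier H" and m: "m \<in> carrier M"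
    obtain p x q where s: "l = p @ x # q" "length p = j" "length q = n - j"
      using split_at [OF l(1) assms(1)] .
    have c: "set p \<subseteq> carrier H" "x \<in> carrier H" "set q \<subseteq> carrier H"
      using l(2) s(1) by auto
    have lin: "(\<lambda>v. zt n (p @ v # q) m) \<in> linear_maps K H (Zn n)"
      by (rule slot_linear) (use c m s assms in auto)
    have 0: "\<sigma> n j (zt n (p @ x # q) m) = lsum (Zn (Suc n)) (\<lambda>(a, b). zt (Suc n) (p @ a # b # q) m) (cop x)"
      by (rule degen_zt) (use c m s assms in auto)
    have "\<delta> (Suc n) j (lsum (Zn (Suc n)) (\<lambda>(a, b). zt (Suc n) (p @ a # b # q) m) (cop x)) =
        lsum (Zn n) (\<lambda>(a, b). \<epsilon> a \<odot>\<^bsub>Zn n\<^esub> zt n (p @ b # q) m) (cop x)"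
      by (rule linear_sweedler_zt [OF face_lin Zn_module c(2) m _ face_zt]) (use c m s assms in auto)
    then have 1: "\<delta> (Suc n) j (\<sigma> n j (zt n l m)) = zt n l m"
      using 0 sweedler_counit_left [OF Zn_module lin c(2)] by (simp add: s(1))
    have "\<delta> (Suc n) (Suc j) (lsum (Zn (Suc n)) (\<lambda>(a, b). zt (Suc n) (p @ a # b # q) m) (cop x)) =
        lsum (Zn n) (\<lambda>(a, b). \<epsilon> b \<odot>\<^bsub>Zn n\<^esub> zt n (p @ a # q) m) (cop x)"
    proof (rule linear_sweedler_zt [OF face_lin Zn_module c(2) m])
      fix a b assume ab: "a \<in> carrier H" "b \<in> carrier H"
      have "\<delta> (Suc n) (Suc j) (zt (Suc n) ((p @ [a]) @ b # q) m) = \<epsilon> b \<odot>\<^bsub>Zn n\<^esub> zt n ((p @ [a]) @ q) m"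
        by (rule face_zt) (use c m s assms ab in auto)
      then show "\<delta> (Suc n) (Suc j) (zt (Suc n) (p @ a # b # q) m) = \<epsilon> b \<odot>\<^bsub>Zn n\<^esub> zt n (p @ a # q) m"
        by simp
    qed (use c m s assms in auto)
    then have "\<delta> (Suc n) (Suc j) (\<sigma> n j (zt n l m)) = zt n l m"
      using 0 sweedler_counit_right [OF Zn_module lin c(2)] by (simp add: s(1))
    note 1 this
  }
  note eq = this
  show "\<delta> (Suc n) j (\<sigma> n j z) = z"
    by (rule Z_linear_eq [OF Zn_module l1 linear_id eq(1) assms(2)])
  show "\<delta> (Suc n) (Suc j) (\<sigma> n j z) = z"
    by (rule Z_linear_eq [OF Zn_module l2 linear_id eq(2) assms(2)])
qed

text \<open>The deleted entry is merely shifted by \<tau>_n, while the coaction only changes the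
  entry coming from the last position.\<close>

lemma face_cyclic:
  assumes "0 < i" "i \<le> Suc n" "z \<in> carrier (Zn (Suc n))"
  shows "\<delta> (Suc n) i (\<tau> (Suc n) z) = \<tau> n (\<delta> (Suc n) (i - 1) z)"
proof (rule Z_linear_eq [OF Zn_module _ _ _ assms(3)])
  show "(\<lambda>z. \<delta> (Suc n) i (\<tau> (Suc n) z)) \<in> linear_maps K (Zn (Suc n)) (Zn n)"
    by (rule linear_comp [OF cyc_lin face_lin]) (use assms in auto)
  show "(\<lambda>z. \<tau> n (\<delta> (Suc n) (i - 1) z)) \<in> linear_maps K (Zn (Suc n)) (Zn n)"
    by (rule linear_comp [OF face_lin cyc_lin]) (use assms in auto)
  fix l m assume l: "length l = Suc (Suc n)" "set l \<subseteq> carrier H" and m: "m \<in> carrier M"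
  \<comment> \<open>The second splitting point is the last entry, which differs from position
    \<open>i - 1\<close>; therefore \<open>r\<close> is empty.\<close>
  obtain p x q y r where s: "l = p @ x # q @ y # r" "length p = i - 1" "length q = Suc n - Suc (i - 1)"
      "length r = Suc n - Suc n"
    by (rule split_at2 [OF l(1), of "i - 1" "Suc n"]) (use assms in auto)
  then have r: "r = []" by simp
  have c: "set p \<subseteq> carrier H" "x \<in> carrier H" "set q \<subseteq> carrier H" "y \<in> carrier H"
    using l(2) s(1) by auto
  note e = counit_closed [OF c(2)]
  have "\<tau> (Suc n) (zt (Suc n) ((p @ x # q) @ [y]) m) =
      lsum (Zn (Suc n)) (\<lambda>(m', a). zt (Suc n) ((y \<cdot> a) # (p @ x # q)) m') (coa m)"
    by (rule cyc_zt) (use c m s assms in auto)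
  moreover have "\<delta> (Suc n) i (lsum (Zn (Suc n)) (\<lambda>(m', a). zt (Suc n) ((y \<cdot> a) # p @ x # q) m') (coa m)) =
      lsum (Zn n) (\<lambda>(m', a). \<epsilon> x \<odot>\<^bsub>Zn n\<^esub> zt n ((y \<cdot> a) # p @ q) m') (coa m)"
  proof (rule linear_coaction_zt [OF face_lin Zn_module m])
    fix m' a assume ma: "m' \<in> carrier M" "a \<in> carrier H"
    have "\<delta> (Suc n) i (zt (Suc n) (((y \<cdot> a) # p) @ x # q) m') = \<epsilon> x \<odot>\<^bsub>Zn n\<^esub> zt n (((y \<cdot> a) # p) @ q) m'"
      by (rule face_zt) (use c m s assms ma in auto)
    then show "\<delta> (Suc n) i (zt (Suc n) ((y \<cdot> a) # p @ x # q) m') = \<epsilon> x \<odot>\<^bsub>Zn n\<^esub> zt n ((y \<cdot> a) # p @ q) m'"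
      by simp
  qed (use c m s assms in auto)
  moreover have "\<epsilon> x \<odot>\<^bsub>Zn n\<^esub> lsum (Zn n) (\<lambda>(m', a). zt n ((y \<cdot> a) # p @ q) m') (coa m) =
      lsum (Zn n) (\<lambda>(m', a). \<epsilon> x \<odot>\<^bsub>Zn n\<^esub> zt n ((y \<cdot> a) # p @ q) m') (coa m)"
    by (rule smult_coaction_zt [OF e m]) (use c m s assms in auto)
  ultimately show "\<delta> (Suc n) i (\<tau> (Suc n) (zt (Suc n) l m)) = \<tau> n (\<delta> (Suc n) (i - 1) (zt (Suc n) l m))"
    using face_zt [of "i - 1" p "q @ [y]" n x m] cyc_zt [of "p @ q" n y m] s(2-4) assms(1,2) c e m
    by (simp add: s(1) r linear_smult [OF cyc_lin] zt_closed)
qed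

text \<open>The split entry is not the last one, so its coproduct and the coaction of
  \<open>m\<close> give independent sums that may be exchanged.\<close>

lemma degen_cyclic:
  assumes "0 < i" "i \<le> n" "z \<in> carrier (Zn n)"
  shows "\<sigma> n i (\<tau> n z) = \<tau> (Suc n) (\<sigma> n (i - 1) z)"
proof (rule Z_linear_eq [OF Zn_module _ _ _ assms(3)])
  show "(\<lambda>z. \<sigma> n i (\<tau> n z)) \<in> linear_maps K (Zn n) (Zn (Suc n))"
    by (rule linear_comp [OF cyc_lin degen_lin]) (use assms in auto)
  show "(\<lambda>z. \<tau> (Suc n) (\<sigma> n (i - 1) z)) \<in> linear_maps K (Zn n) (Zn (Suc n))"
    by (rule linear_comp [OF degen_lin cyc_lin]) (use assms in auto)
  fix l m assume l: "length l = Suc n" "set l \<subseteq> carrier H" and m: "m \<in> carrier M"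
  obtain p x q y r where s: "l = p @ x # q @ y # r" "length p = i - 1" "length q = n - Suc (i - 1)"
      "length r = n - n"
    by (rule split_at2 [OF l(1), of "i - 1" n]) (use assms in auto)
  then have r: "r = []" by simp
  have c: "set p \<subseteq> carrier H" "x \<in> carrier H" "set q \<subseteq> carrier H" "y \<in> carrier H"
    using l(2) s(1) by auto
  let ?Z = "Zn (Suc n)" and ?z = "zt (Suc n)"
  have "\<tau> n (zt n ((p @ x # q) @ [y]) m) =
      lsum (Zn n) (\<lambda>(m', a). zt n ((y \<cdot> a) # (p @ x # q)) m') (coa m)"
    by (rule cyc_zt) (use c m s assms in auto)
  moreover have "\<sigma> n i (lsum (Zn n) (\<lambda>(m', a). zt n ((y \<cdot> a) # p @ x # q) m') (coa m)) =
      lsum ?Z (\<lambda>(m', a). lsum ?Z (\<lambda>(b, b'). ?z ((y \<cdot> a) # p @ b # b' # q) m') (cop x)) (coa m)"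
  proof (rule linear_coaction_zt [OF degen_lin Zn_module m])
    fix m' a assume ma: "m' \<in> carrier M" "a \<in> carrier H"
    have "\<sigma> n i (zt n (((y \<cdot> a) # p) @ x # q) m') =
        lsum ?Z (\<lambda>(b, b'). ?z (((y \<cdot> a) # p) @ b # b' # q) m') (cop x)"
      by (rule degen_zt) (use c m s assms ma in auto)
    then show "\<sigma> n i (zt n ((y \<cdot> a) # p @ x # q) m') =
        lsum ?Z (\<lambda>(b, b'). ?z ((y \<cdot> a) # p @ b # b' # q) m') (cop x)"
      by simp
  qed (use c m s assms in auto)
  moreover have "\<sigma> n (i - 1) (zt n (p @ x # (q @ [y])) m) =
      lsum ?Z (\<lambda>(b, b'). ?z (p @ b # b' # (q @ [y])) m) (cop x)"
    by (rule degen_zt) (use c m s assms in auto)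
  moreover have "\<tau> (Suc n) (lsum ?Z (\<lambda>(b, b'). ?z (p @ b # b' # q @ [y]) m) (cop x)) =
      lsum ?Z (\<lambda>(b, b'). lsum ?Z (\<lambda>(m', a). ?z ((y \<cdot> a) # p @ b # b' # q) m') (coa m)) (cop x)"
  proof (rule linear_sweedler_zt [OF cyc_lin Zn_module c(2) m])
    fix b b' assume bb: "b \<in> carrier H" "b' \<in> carrier H"
    have "\<tau> (Suc n) (?z ((p @ b # b' # q) @ [y]) m) =
        lsum ?Z (\<lambda>(m', a). ?z ((y \<cdot> a) # (p @ b # b' # q)) m') (coa m)"
      by (rule cyc_zt) (use c m s assms bb in auto)
    then show "\<tau> (Suc n) (?z (p @ b # b' # q @ [y]) m) =
        lsum ?Z (\<lambda>(m', a). ?z ((y \<cdot> a) # p @ b # b' # q) m') (coa m)"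
      by simp
  qed (use c m s assms in auto)
  moreover have "lsum ?Z (\<lambda>u. lsum ?Z (\<lambda>v. ?z ((y \<cdot> snd u) # p @ fst v # snd v # q) (fst u)) (cop x)) (coa m) =
      lsum ?Z (\<lambda>v. lsum ?Z (\<lambda>u. ?z ((y \<cdot> snd u) # p @ fst v # snd v # q) (fst u)) (coa m)) (cop x)"
    by (rule lsum_swap [OF Zn_module], rule zt_closed)
       (use cop_closed [OF c(2)] coa_closed [OF m] c m s assms in auto)
  ultimately show "\<sigma> n i (\<tau> n (zt n l m)) = \<tau> (Suc n) (\<sigma> n (i - 1) (zt n l m))"
    by (simp add: s(1) r case_prod_unfold)
qed

text \<open>The front entry after \<tau>_n is the product of \<open>y\<close> and m_<1>. \<epsilon>
  is multiplicative: its value on m_<1> is absorbed by the counit axiom of the coaction, and its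
  value on \<open>y\<close> is the weight for deleting the last entry.\<close>

lemma face_zero_cyclic:
  assumes "z \<in> carrier (Zn (Suc n))"
  shows "\<delta> (Suc n) 0 (\<tau> (Suc n) z) = \<delta> (Suc n) (Suc n) z"
proof (rule Z_linear_eq [OF Zn_module _ _ _ assms])
  show "(\<lambda>z. \<delta> (Suc n) 0 (\<tau> (Suc n) z)) \<in> linear_maps K (Zn (Suc n)) (Zn n)"
    by (rule linear_comp [OF cyc_lin face_lin]) auto
  show "\<delta> (Suc n) (Suc n) \<in> linear_maps K (Zn (Suc n)) (Zn n)"
    by (rule face_lin) auto
  fix l m assume l: "length l = Suc (Suc n)" "set l \<subseteq> carrier H" and m: "m \<in> carrier M"
  obtain q y where s: "l = q @ [y]" "length q = Suc n"
    using split_last [OF l(1)] .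
  have c: "set q \<subseteq> carrier H" "y \<in> carrier H" using l(2) s(1) by auto
  interpret Z: module K "Zn n" by (rule Zn_module)
  have lin: "zt n q \<in> linear_maps K M (Zn n)" by (rule zt_linear [OF s(2) c(1)])
  have "\<tau> (Suc n) (zt (Suc n) (q @ [y]) m) =
      lsum (Zn (Suc n)) (\<lambda>(m', a). zt (Suc n) ((y \<cdot> a) # q) m') (coa m)"
    by (rule cyc_zt) (use c m s in auto)
  moreover have "\<delta> (Suc n) 0 (lsum (Zn (Suc n)) (\<lambda>(m', a). zt (Suc n) ((y \<cdot> a) # q) m') (coa m)) =
      lsum (Zn n) (\<lambda>(m', a). \<epsilon> a \<odot>\<^bsub>Zn n\<^esub> (\<epsilon> y \<odot>\<^bsub>Zn n\<^esub> zt n q m')) (coa m)"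
  proof (rule linear_coaction_zt [OF face_lin Zn_module m])
    fix m' a assume ma: "m' \<in> carrier M" "a \<in> carrier H"
    have "\<delta> (Suc n) 0 (zt (Suc n) ([] @ (y \<cdot> a) # q) m') = \<epsilon> (y \<cdot> a) \<odot>\<^bsub>Zn n\<^esub> zt n ([] @ q) m'"
      by (rule face_zt) (use c m s ma in auto)
    also have "\<dots> = \<epsilon> y \<odot>\<^bsub>Zn n\<^esub> (\<epsilon> a \<odot>\<^bsub>Zn n\<^esub> zt n q m')"
      using c ma s by (simp add: counit_mult counit_closed Z.smult_assoc1 zt_closed)
    also have "\<dots> = \<epsilon> a \<odot>\<^bsub>Zn n\<^esub> (\<epsilon> y \<odot>\<^bsub>Zn n\<^esub> zt n q m')"
      by (rule smult_comm) (use c ma s in \<open>simp_all add: counit_closed zt_closed\<close>)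
    finally show "\<delta> (Suc n) 0 (zt (Suc n) ((y \<cdot> a) # q) m') =
        \<epsilon> a \<odot>\<^bsub>Zn n\<^esub> (\<epsilon> y \<odot>\<^bsub>Zn n\<^esub> zt n q m')"
      by simp
  qed (use c m s in auto)
  moreover have "\<dots> = \<epsilon> y \<odot>\<^bsub>Zn n\<^esub> zt n q m"
    by (rule coaction_counit [OF Zn_module linear_scale [OF Zn_module lin] m])
       (rule counit_closed [OF c(2)])
  moreover have "\<delta> (Suc n) (Suc n) (zt (Suc n) (q @ y # []) m) = \<epsilon> y \<odot>\<^bsub>Zn n\<^esub> zt n (q @ []) m"
    by (rule face_zt) (use c m s in auto)
  ultimately show "\<delta> (Suc n) 0 (\<tau> (Suc n) (zt (Suc n) l m)) = \<delta> (Suc n) (Suc n) (zt (Suc n) l m)"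
    by (simp add: s(1))
qed

text \<open>On the left, the coproduct of the product of \<open>y\<close> and m_<1> splits both
  factors. On the right, two coactions are taken, the second component landing in front of the
  first. Coassociativity of the coaction identifies the two.\<close>

lemma degen_zero_cyclic:
  assumes "z \<in> carrier (Zn n)"
  shows "\<sigma> n 0 (\<tau> n z) = \<tau> (Suc n) (\<tau> (Suc n) (\<sigma> n n z))"
proof (rule Z_linear_eq [OF Zn_module _ _ _ assms])
  show "(\<lambda>z. \<sigma> n 0 (\<tau> n z)) \<in> linear_maps K (Zn n) (Zn (Suc n))"
    by (rule linear_comp [OF cyc_lin degen_lin]) auto
  show "(\<lambda>z. \<tau> (Suc n) (\<tau> (Suc n) (\<sigma> n n z))) \<in> linear_maps K (Zn n) (Zn (Suc n))"
    by (rule linear_comp [OF linear_comp [OF degen_lin cyc_lin] cyc_lin]) auto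
  fix l m assume l: "length l = Suc n" "set l \<subseteq> carrier H" and m: "m \<in> carrier M"
  obtain q y where s: "l = q @ [y]" "length q = n"
    using split_last [OF l(1)] .
  have c: "set q \<subseteq> carrier H" "y \<in> carrier H" using l(2) s(1) by auto
  let ?Z = "Zn (Suc n)" and ?z = "zt (Suc n)"
  \<comment> \<open>\<open>u\<close> stands for a pair from \<open>cop y\<close>; kept as one index,
    its sum can be moved past the one over \<open>coa m\<close>.\<close>
  let ?G = "\<lambda>u m' a a'. ?z ((fst u \<cdot> a) # (snd u \<cdot> a') # q) m'"
  have G: "trilin M H H ?Z (?G u)" if u: "fst u \<in> carrier H" "snd u \<in> carrier H" for u
    unfolding trilin_def
  proof (intro conjI ballI bilinI)
    fix a a' assume "a \<in> carrier H" "a' \<in> carrier H"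
    then show "(\<lambda>m'. ?G u m' a a') \<in> linear_maps K M ?Z"
      by (intro zt_linear) (use c s u in auto)
  next
    fix a' m' assume "a' \<in> carrier H" "m' \<in> carrier M"
    then show "(\<lambda>a. ?G u m' a a') \<in> linear_maps K H ?Z"
      using linear_comp [OF mult_left_linear [OF u(1)] slot_linear [of "[]" "(snd u \<cdot> a') # q" "Suc n" m']]
        c s u by simp
  next
    fix m' a assume "m' \<in> carrier M" "a \<in> carrier H"
    then show "(\<lambda>a'. ?G u m' a a') \<in> linear_maps K H ?Z"
      using linear_comp [OF mult_left_linear [OF u(2)] slot_linear [of "[fst u \<cdot> a]" q "Suc n" m']]
        c s u by simp
  qed
  have yc: "fst u \<in> carrier H" "snd u \<in> carrier H" if "u \<in> set (cop y)" for u
    using cop_closed [OF c(2)] that by (cases u, simp)+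
  have vc: "fst v \<in> carrier M" "snd v \<in> carrier H" if "v \<in> set (coa m)" for v
    using coa_closed [OF m] that by (cases v, simp)+
  have Gc: "?G u m' a a' \<in> carrier ?Z"
    if "u \<in> set (cop y)" "m' \<in> carrier M" "a \<in> carrier H" "a' \<in> carrier H" for u m' a a'
    by (rule zt_closed) (use yc [OF that(1)] that c s in auto)
  have "\<tau> n (zt n (q @ [y]) m) = lsum (Zn n) (\<lambda>(m', a). zt n ((y \<cdot> a) # q) m') (coa m)"
    by (rule cyc_zt) (use c m s in auto)
  then have "\<sigma> n 0 (\<tau> n (zt n l m)) =
      \<sigma> n 0 (lsum (Zn n) (\<lambda>(m', a). zt n ((y \<cdot> a) # q) m') (coa m))"
    by (simp add: s(1))
  also have "\<dots> = lsum ?Z (\<lambda>(m', a). lsum ?Z (\<lambda>u. lsum ?Z (\<lambda>(a', a''). ?G u m' a' a'') (cop a)) (cop y)) (coa m)"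
  proof (rule linear_coaction_zt [OF degen_lin Zn_module m])
    fix m' a assume ma: "m' \<in> carrier M" "a \<in> carrier H"
    have "bilin H H ?Z (\<lambda>a b. ?z (a # b # q) m')"
    proof (rule bilinI)
      show "(\<lambda>a. ?z (a # b # q) m') \<in> linear_maps K H ?Z" if "b \<in> carrier H" for b
        using slot_linear [of "[]" "b # q" "Suc n" m'] that ma c s by simp
      show "(\<lambda>b. ?z (a # b # q) m') \<in> linear_maps K H ?Z" if "a \<in> carrier H" for a
        using slot_linear [of "[a]" q "Suc n" m'] that ma c s by simp
    qed
    note mult = sweedler_mult [OF Zn_module this c(2) ma(2)]
    have "\<sigma> n 0 (zt n ([] @ (y \<cdot> a) # q) m') =
        lsum ?Z (\<lambda>(a, b). ?z ([] @ a # b # q) m') (cop (y \<cdot> a))"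
      by (rule degen_zt) (use c m s ma in auto)
    then show "\<sigma> n 0 (zt n ((y \<cdot> a) # q) m') =
        lsum ?Z (\<lambda>u. lsum ?Z (\<lambda>(a', a''). ?G u m' a' a'') (cop a)) (cop y)"
      using mult by (simp add: case_prod_unfold)
  qed (use c m s in auto)
  also have "\<dots> = lsum ?Z (\<lambda>v. lsum ?Z (\<lambda>u. lsum ?Z (\<lambda>(a', a''). ?G u (fst v) a' a'') (cop (snd v))) (cop y)) (coa m)"
    by (simp add: case_prod_unfold)
  also have "\<dots> = lsum ?Z (\<lambda>u. lsum ?Z (\<lambda>v. lsum ?Z (\<lambda>(a', a''). ?G u (fst v) a' a'') (cop (snd v))) (coa m)) (cop y)"
    by (rule lsum_swap [OF Zn_module], rule sweedler_closed [OF Zn_module vc(2)], assumption)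
       (rule Gc [OF _ vc(1)])
  also have "\<dots> = lsum ?Z (\<lambda>u. lsum ?Z (\<lambda>(m', a). lsum ?Z (\<lambda>(m'', b). ?G u m'' b a) (coa m')) (coa m)) (cop y)"
  proof (rule lsum_cong)
    fix u assume "u \<in> set (cop y)"
    from coaction_coassoc [OF Zn_module G [OF yc [OF this]] m]
    show "lsum ?Z (\<lambda>v. lsum ?Z (\<lambda>(a', a''). ?G u (fst v) a' a'') (cop (snd v))) (coa m) =
        lsum ?Z (\<lambda>(m', a). lsum ?Z (\<lambda>(m'', b). ?G u m'' b a) (coa m')) (coa m)"
      by (simp add: case_prod_unfold)
  qed
  also have "\<dots> = lsum ?Z (\<lambda>(y', y''). lsum ?Z (\<lambda>(m', a). lsum ?Z (\<lambda>(m'', b).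
      ?z ((y' \<cdot> b) # (y'' \<cdot> a) # q) m'') (coa m')) (coa m)) (cop y)"
    by (simp add: case_prod_unfold)
  also have "\<dots> = \<tau> (Suc n) (\<tau> (Suc n) (lsum ?Z (\<lambda>(y', y''). ?z (q @ [y', y'']) m) (cop y)))"
  proof (rule linear_sweedler_zt [OF linear_comp [OF cyc_lin cyc_lin] Zn_module c(2) m, symmetric])
    fix a b assume ab: "a \<in> carrier H" "b \<in> carrier H"
    have "\<tau> (Suc n) (?z ((q @ [a]) @ [b]) m) = lsum ?Z (\<lambda>(m', d). ?z ((b \<cdot> d) # (q @ [a])) m') (coa m)"
      by (rule cyc_zt) (use c m s ab in auto)
    moreover have "\<tau> (Suc n) (lsum ?Z (\<lambda>(m', d). ?z ((b \<cdot> d) # q @ [a]) m') (coa m)) =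
        lsum ?Z (\<lambda>(m', d). lsum ?Z (\<lambda>(m'', d'). ?z ((a \<cdot> d') # (b \<cdot> d) # q) m'') (coa m')) (coa m)"
    proof (rule linear_coaction_zt [OF cyc_lin Zn_module m])
      fix m' d assume md: "m' \<in> carrier M" "d \<in> carrier H"
      have "\<tau> (Suc n) (?z (((b \<cdot> d) # q) @ [a]) m') =
          lsum ?Z (\<lambda>(m'', d'). ?z ((a \<cdot> d') # ((b \<cdot> d) # q)) m'') (coa m')"
        by (rule cyc_zt) (use c m s ab md in auto)
      then show "\<tau> (Suc n) (?z ((b \<cdot> d) # q @ [a]) m') =
          lsum ?Z (\<lambda>(m'', d'). ?z ((a \<cdot> d') # (b \<cdot> d) # q) m'') (coa m')"
        by simp
    qed (use c m s ab in auto)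
    ultimately show "\<tau> (Suc n) (\<tau> (Suc n) (?z (q @ [a, b]) m)) =
        lsum ?Z (\<lambda>(m', d). lsum ?Z (\<lambda>(m'', d'). ?z ((a \<cdot> d') # (b \<cdot> d) # q) m'') (coa m')) (coa m)"
      by simp
  qed (use c m s in auto)
  also have "lsum ?Z (\<lambda>(y', y''). ?z (q @ [y', y'']) m) (cop y) = \<sigma> n n (zt n (q @ y # []) m)"
    by (rule degen_zt [symmetric]) (use c m s in auto)
  finally show "\<sigma> n 0 (\<tau> n (zt n l m)) = \<tau> (Suc n) (\<tau> (Suc n) (\<sigma> n n (zt n l m)))"
    by (simp add: s(1))
qed

lemma cyc_power_linear: "(\<tau> n ^^ k) \<in> linear_maps K (Zn n) (Zn n)"
proof (induction k)
  case 0
  then show ?case using linear_id by (simp add: id_def)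
next
  case (Suc k)
  then show ?case using linear_comp [OF Suc cyc_lin] by (simp add: comp_def)
qed

text \<open>The power is counted by \<open>k\<close>, independently of \<open>n\<close>, to allow
  induction. The waiting entries \<open>p\<close> and the element \<open>m\<close> must be
  arbitrary, because the first \<tau>_n already prepends an entry to \<open>p\<close> and replaces
  \<open>m\<close>.\<close>

lemma cyc_power_zt:
  assumes "length q = Suc k" "length p + k = n" "set p \<subseteq> carrier H" "set q \<subseteq> carrier H" "m \<in> carrier M"
  shows "(\<tau> n ^^ Suc k) (zt n (p @ q) m) =
    lsum (Zn n) (\<lambda>(m', a). lsum (Zn n) (\<lambda>g. zt n (map2 (\<cdot>) q g @ p) m') (iter k a)) (coa m)"
  using assms
proof (induction k arbitrary: p q m)
  case 0
  then obtain y where y: "q = [y]" "y \<in> carrier H" by (cases q) auto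
  have "\<tau> n (zt n (p @ [y]) m) = lsum (Zn n) (\<lambda>(m', a). zt n ((y \<cdot> a) # p) m') (coa m)"
    by (rule cyc_zt) (use 0 y in auto)
  also have "\<dots> = lsum (Zn n) (\<lambda>(m', a). lsum (Zn n) (\<lambda>g. zt n (map2 (\<cdot>) q g @ p) m') (iter 0 a)) (coa m)"
  proof (rule coaction_cong [OF 0(5)])
    fix m' a assume "m' \<in> carrier M" "a \<in> carrier H"
    then have "zt n ((y \<cdot> a) # p) m' \<in> carrier (Zn n)" by (intro zt_closed) (use 0 y in auto)
    then show "zt n ((y \<cdot> a) # p) m' = lsum (Zn n) (\<lambda>g. zt n (map2 (\<cdot>) q g @ p) m') (iter 0 a)"
      using lsum_single [OF Zn_module, of "\<lambda>g. zt n (map2 (\<cdot>) q g @ p) m'" "[a]" n] y by simp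
  qed
  finally show ?case using y by simp
next
  case (Suc k)
  note m = Suc.prems(5)
  obtain q' y where q: "q = q' @ [y]" "length q' = Suc k"
    using split_last [OF Suc.prems(1)] .
  have c: "set p \<subseteq> carrier H" "set q' \<subseteq> carrier H" "y \<in> carrier H" using Suc.prems q by auto
  let ?G = "\<lambda>m' b a. lsum (Zn n) (\<lambda>g. zt n (map2 (\<cdot>) q' g @ (y \<cdot> a) # p) m') (iter k b)"
  have mlin: "multilin H (Zn n) (Suc k) (\<lambda>g. zt n (map2 (\<cdot>) q' g @ r) m')"
    if "m' \<in> carrier M" "length r + k = n" "set r \<subseteq> carrier H" for m' r
    using multilin_map2_right [OF multilin_context [OF zt_multilin [OF that(1)], of "[]" r "Suc k" n] q(2) c(2)]
      that by simp
  have G: "trilin M H H (Zn n) ?G"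
    unfolding trilin_def
  proof (intro conjI ballI bilinI)
    fix a b assume ab: "a \<in> carrier H" "b \<in> carrier H"
    show "(\<lambda>m'. ?G m' b a) \<in> linear_maps K M (Zn n)"
      by (intro linear_lsum_pointwise Zn_module zt_linear)
         (use iter_closed [OF ab(2)] set_map2_mult [OF c(2)] q(2) Suc.prems c ab in
           \<open>simp_all del: set_map\<close>)
  next
    fix a m' assume am: "a \<in> carrier H" "m' \<in> carrier M"
    show "(\<lambda>b. ?G m' b a) \<in> linear_maps K H (Zn n)"
      by (rule lsum_iter_linear [OF Zn_module mlin [OF am(2)]]) (use Suc.prems c am in auto)
  next
    fix m' b assume mb: "m' \<in> carrier M" "b \<in> carrier H"
    show "?G m' b \<in> linear_maps K H (Zn n)"
      by (intro linear_lsum_pointwise Zn_module linear_comp [OF mult_left_linear [OF c(3)] slot_linear])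
         (use iter_closed [OF mb(2)] set_map2_mult [OF c(2)] q(2) Suc.prems c mb in
           \<open>simp_all del: set_map\<close>)
  qed
  have "\<tau> n (zt n ((p @ q') @ [y]) m) = lsum (Zn n) (\<lambda>(m', a). zt n ((y \<cdot> a) # (p @ q')) m') (coa m)"
    by (rule cyc_zt) (use Suc.prems c q in auto)
  \<comment> \<open>The innermost application is split off, because its effect on the word is known;
    the others fall under the induction hypothesis with \<open>(y \<cdot> a) # p\<close> in place of
    \<open>p\<close>.\<close>
  then have "(\<tau> n ^^ Suc (Suc k)) (zt n (p @ q) m) =
      (\<tau> n ^^ Suc k) (lsum (Zn n) (\<lambda>(m', a). zt n ((y \<cdot> a) # p @ q') m') (coa m))"
    unfolding funpow_Suc_right [of "Suc k"] comp_def by (simp only: q(1) append_assoc)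
  also have "\<dots> = lsum (Zn n) (\<lambda>(m', a). lsum (Zn n) (\<lambda>(m'', b). ?G m'' b a) (coa m')) (coa m)"
  proof (rule linear_coaction_zt [OF cyc_power_linear Zn_module m])
    fix m' a assume ma: "m' \<in> carrier M" "a \<in> carrier H"
    have "(\<tau> n ^^ Suc k) (zt n (((y \<cdot> a) # p) @ q') m') =
        lsum (Zn n) (\<lambda>(m'', b). lsum (Zn n) (\<lambda>g. zt n (map2 (\<cdot>) q' g @ ((y \<cdot> a) # p)) m'') (iter k b)) (coa m')"
      by (rule Suc.IH) (use Suc.prems q c ma in auto)
    then show "(\<tau> n ^^ Suc k) (zt n ((y \<cdot> a) # p @ q') m') = lsum (Zn n) (\<lambda>(m'', b). ?G m'' b a) (coa m')"
      by (simp only: append_Cons)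
  qed (use Suc.prems q c in auto)
  also have "\<dots> = lsum (Zn n) (\<lambda>(m', a). lsum (Zn n) (\<lambda>(a', a''). ?G m' a' a'') (cop a)) (coa m)"
    by (rule coaction_coassoc [OF Zn_module G m])
  also have "\<dots> = lsum (Zn n) (\<lambda>(m', a). lsum (Zn n) (\<lambda>g. zt n (map2 (\<cdot>) q g @ p) m') (iter (Suc k) a)) (coa m)"
  proof (rule coaction_cong [OF m])
    fix m' a assume ma: "m' \<in> carrier M" "a \<in> carrier H"
    have F: "multilin H (Zn n) (Suc (Suc k)) (\<lambda>g. zt n (map2 (\<cdot>) q g @ p) m')"
      using multilin_map2_right [OF multilin_context [OF zt_multilin [OF ma(1)], of "[]" p "Suc (Suc k)" n]
          Suc.prems(1,4)] Suc.prems by simp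
    \<comment> \<open>The component paired with \<open>y\<close> was produced by the first \<tau>_n,
      and coassociativity of the coaction puts it last.\<close>
    have "lsum (Zn n) (\<lambda>g. zt n (map2 (\<cdot>) q g @ p) m') (iter (Suc k) a) =
        lsum (Zn n) (\<lambda>(a', a''). lsum (Zn n) (\<lambda>g. zt n (map2 (\<cdot>) q (g @ [a'']) @ p) m') (iter k a')) (cop a)"
      by (rule iter_last [OF Zn_module ma(2) F])
    also have "\<dots> = lsum (Zn n) (\<lambda>(a', a''). ?G m' a' a'') (cop a)"
      by (intro sweedler_cong [OF ma(2)] lsum_iter_cong) (simp_all add: q)
    finally show "lsum (Zn n) (\<lambda>(a', a''). ?G m' a' a'') (cop a) =
        lsum (Zn n) (\<lambda>g. zt n (map2 (\<cdot>) q g @ p) m') (iter (Suc k) a)" by simp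
  qed
  finally show ?case .
qed

lemma cyclic_order:
  assumes "z \<in> carrier (Zn n)"
  shows "(\<tau> n ^^ Suc n) z = z"
proof (rule Z_linear_eq [OF Zn_module cyc_power_linear linear_id _ assms])
  fix l m assume l: "length l = Suc n" "set l \<subseteq> carrier H" and m: "m \<in> carrier M"
  \<comment> \<open>With \<open>p\<close> empty every entry receives a component, so the inner sum
    is a diagonal action and can be moved across the tensor.\<close>
  have "(\<tau> n ^^ Suc n) (zt n ([] @ l) m) =
      lsum (Zn n) (\<lambda>(m', a). lsum (Zn n) (\<lambda>g. zt n (map2 (\<cdot>) l g @ []) m') (iter n a)) (coa m)"
    by (rule cyc_power_zt) (use l m in auto)
  also have "\<dots> = lsum (Zn n) (\<lambda>(m', a). zt n l (act a m')) (coa m)"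
    by (rule coaction_cong [OF m]) (simp add: zt_balanced [OF l])
  also have "\<dots> = zt n l m"
    by (rule coaction_modular [OF Zn_module zt_linear [OF l] m])
  finally show "(\<tau> n ^^ Suc n) (zt n l m) = zt n l m" by simp
qed

lemma cyclic: "cyclic_module K Zn \<delta> \<sigma> \<tau>"
proof (intro cyclic_module.intro simplicial_module.intro cyclic_module_axioms.intro)
  fix n i j :: nat and z
  show "module K (Zn n)" by (rule Zn_module)
  show "\<delta> n i \<in> linear_maps K (Zn n) (Zn (n - 1))" if "1 \<le> n" "i \<le> n"
    by (rule O.face_linear [OF that])
  show "\<sigma> n i \<in> linear_maps K (Zn n) (Zn (n + 1))" if "i \<le> n"
    by (rule O.degen_linear [OF that])
  show "\<tau> n \<in> linear_maps K (Zn n) (Zn n)" by (rule cyc_lin)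
  assume z: "z \<in> carrier (Zn n)"
  show "\<delta> (n - 1) i (\<delta> n j z) = \<delta> (n - 1) (j - 1) (\<delta> n i z)" if "i < j" "j \<le> n" "2 \<le> n"
    using face_face [of i j "n - 2" z] that z
    by (cases n; cases "n - 1") (auto simp: numeral_2_eq_2)
  show "\<sigma> (n + 1) i (\<sigma> n j z) = \<sigma> (n + 1) (j + 1) (\<sigma> n i z)" if "i \<le> j" "j \<le> n"
    using degen_degen [OF that z] by simp
  \<comment> \<open>The bounds exclude \<open>n = 0\<close>, so \<open>n - 1\<close> is a genuine
    predecessor; the same holds in the other identities that mention it.\<close>
  show "\<delta> (n + 1) i (\<sigma> n j z) = \<sigma> (n - 1) (j - 1) (\<delta> n i z)" if "i < j" "j \<le> n"
    using face_degen_less [of i j "n - 1" z] that z by (cases n) auto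
  show "\<delta> (n + 1) j (\<sigma> n j z) = z" if "j \<le> n"
    using face_degen_same(1) [OF that z] by simp
  show "\<delta> (n + 1) (j + 1) (\<sigma> n j z) = z" if "j \<le> n"
    using face_degen_same(2) [OF that z] by simp
  show "\<delta> (n + 1) i (\<sigma> n j z) = \<sigma> (n - 1) j (\<delta> n (i - 1) z)" if "j + 1 < i" "i \<le> n + 1"
    using face_degen_greater [of j i "n - 1" z] that z by (cases n) auto
  show "\<delta> n i (\<tau> n z) = \<tau> (n - 1) (\<delta> n (i - 1) z)" if "0 < i" "i \<le> n"
    using face_cyclic [of i "n - 1" z] that z by (cases n) auto
  show "\<sigma> n i (\<tau> n z) = \<tau> (n + 1) (\<sigma> n (i - 1) z)" if "0 < i" "i \<le> n"
    using degen_cyclic [OF that z] by simp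
  show "\<delta> n 0 (\<tau> n z) = \<delta> n n z" if "1 \<le> n"
    using face_zero_cyclic [of z "n - 1"] that z by (cases n) auto
  show "\<sigma> n 0 (\<tau> n z) = \<tau> (n + 1) (\<tau> (n + 1) (\<sigma> n n z))"
    using degen_zero_cyclic [OF z] by simp
  show "(\<tau> n ^^ (n + 1)) z = z"
    using cyclic_order [OF z] by simp
qed

end

end

theorem theorem4p13:
  fixes K :: "'k ring" and H :: "('k, 'h) module"
    and \<Delta> :: "'h \<Rightarrow> ('h \<times> 'h \<Rightarrow> 'k) set" and \<epsilon> :: "'h \<Rightarrow> 'k" and S :: "'h \<Rightarrow> 'h"
    and M :: "('k, 'm) module" and act :: "'h \<Rightarrow> 'm \<Rightarrow> 'm"
    and \<rho> :: "'m \<Rightarrow> ('m \<times> 'h \<Rightarrow> 'k) set"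
  assumes "modular_crossed_module K H \<Delta> \<epsilon> S M act \<rho>"
  shows "(\<exists>\<delta> \<sigma> \<tau>. hopf_cyclic_operators K H \<Delta> \<epsilon> M act \<rho> \<delta> \<sigma> \<tau>) \<and>
    (\<forall>\<delta> \<sigma> \<tau>. hopf_cyclic_operators K H \<Delta> \<epsilon> M act \<rho> \<delta> \<sigma> \<tau> \<longrightarrow>
       cyclic_module K (Z_HM K H \<Delta> M act) \<delta> \<sigma> \<tau>)"
proof -
  interpret modular_crossed_module K H \<Delta> \<epsilon> S M act \<rho> by fact
  show ?thesis using operators_exist cyclic by blast
qed

end
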